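(* Let $d\ge 1$, let $\Omega\subset\mathbb{R}^d$ be a bounded domain, let $0<\lambda_1\le\lambda_2\le\cdots$ be the eigenvalues of the Dirichlet Laplacian on $\Omega$, and let $R_\sigma(z)$ denote their Riesz means. (i) For $0<\sigma\le 2$ and $z\ge\lambda_1$, $$R_{\sigma-1}(z)\ \ge\ \left(1+\frac d4\right)\frac1z\,R_\sigma(z),$$ $$R_\sigma'(z)\ \ge\ \left(1+\frac d4\right)\frac{\sigma}{z}\,R_\sigma(z),$$ and consequently $$\frac{R_\sigma(z)}{z^{\sigma+\frac{d\sigma}{4}}}$$ is a nondecreasing function of $z$. (ii) For $2\le\sigma<\infty$ and $z\ge\lambda_1$, $$R_{\sigma-1}(z)\ \ge\ \left(1+\frac{d}{2\sigma}\right)\frac1z\,R_\sigma(z),$$ $$R_\sigma'(z)\ \ge\ \left(\sigma+\frac d2\right)\frac1z\,R_\sigma(z),$$ and consequently $$\frac{R_\sigma(z)}{z^{\sigma+\frac d2}}$$ is a nondecreasing function of $z$.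
   Context: $\{\lambda_k\}_{k\ge1}$ are the eigenvalues, in nondecreasing order and repeated according to multiplicity, of $-\Delta$ on $\Omega$ with Dirichlet boundary conditions on $\partial\Omega$. With $x_+:=\max(0,x)$, the Riesz mean of order $\sigma>0$ is $R_\sigma(z):=\sum_k (z-\lambda_k)_+^\sigma$. For $\sigma=0$, $R_0(z):=\lim_{\sigma\downarrow0}R_\sigma(z)$, i.e. the number of $k$ with $\lambda_k<z$. For negative order $\sigma\in(-1,0)$, $R_\sigma(z)$ is given by the same formula with the sum taken over those $k$ with $\lambda_k<z$. The prime denotes the derivative with respect to $z$; when $0<\sigma\le1$ the inequality for $R_\sigma'(z)$ is understood at those $z$ where $R_\sigma$ is differentiable. *)

theory Defs
  imports "HOL-Analysis.Analysis"
begin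

primrec Ck :: "nat \<Rightarrow> ('a::euclidean_space \<Rightarrow> real) \<Rightarrow> bool" where
  "Ck 0 f \<longleftrightarrow> continuous_on UNIV f"
| "Ck (Suc k) f \<longleftrightarrow>
     (\<forall>x. f differentiable (at x)) \<and>
     (\<forall>b\<in>Basis. Ck k (\<lambda>x. frechet_derivative f (at x) b))"

definition smooth :: "('a::euclidean_space \<Rightarrow> real) \<Rightarrow> bool" where
  "smooth f \<longleftrightarrow> (\<forall>k. Ck k f)"

definition grad :: "('a::euclidean_space \<Rightarrow> real) \<Rightarrow> 'a \<Rightarrow> 'a" where
  "grad f x = (\<Sum>b\<in>Basis. frechet_derivative f (at x) b *\<^sub>R b)"

text \<open>The space \<open>C\<^sub>c\<^sup>\<infinity>(\<Omega>)\<close>; its elements are extended by zero to the whole space.\<close>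
definition test_functions :: "'a::euclidean_space set \<Rightarrow> ('a \<Rightarrow> real) set" where
  "test_functions \<Omega> =
     {\<phi>. smooth \<phi> \<and> compact (closure {x. \<phi> x \<noteq> 0}) \<and> closure {x. \<phi> x \<noteq> 0} \<subseteq> \<Omega>}"

text \<open>
  Elements of \<open>L\<^sup>2(\<Omega>)\<close> are represented by functions on the whole space; all notions below depend
  only on their values almost everywhere in \<open>\<Omega>\<close>.
\<close>
definition L2 :: "'a::euclidean_space set \<Rightarrow> ('a \<Rightarrow> 'b::euclidean_space) set" where
  "L2 \<Omega> = {f \<in> borel_measurable (lebesgue_on \<Omega>). integrable (lebesgue_on \<Omega>) (\<lambda>x. (norm (f x))\<^sup>2)}"

definition weak_gradient :: "'a::euclidean_space set \<Rightarrow> ('a \<Rightarrow> real) \<Rightarrow> ('a \<Rightarrow> 'a) \<Rightarrow> bool" where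
  "weak_gradient \<Omega> u g \<longleftrightarrow>
     (\<forall>\<phi>\<in>test_functions \<Omega>. \<forall>b\<in>Basis.
        (\<integral>x. u x * (grad \<phi> x \<bullet> b) \<partial>lebesgue_on \<Omega>) = - (\<integral>x. (g x \<bullet> b) * \<phi> x \<partial>lebesgue_on \<Omega>))"

text \<open>
  \<open>H10 \<Omega> u g\<close>: the function \<open>u\<close> belongs to \<open>H\<^sup>1\<^sub>0(\<Omega>)\<close>, the closure of \<open>C\<^sub>c\<^sup>\<infinity>(\<Omega>)\<close> in the
  norm of \<open>H\<^sup>1(\<Omega>)\<close>, and \<open>g\<close> is its weak gradient.
\<close>
definition H10 :: "'a::euclidean_space set \<Rightarrow> ('a \<Rightarrow> real) \<Rightarrow> ('a \<Rightarrow> 'a) \<Rightarrow> bool" where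
  "H10 \<Omega> u g \<longleftrightarrow>
     u \<in> L2 \<Omega> \<and> g \<in> L2 \<Omega> \<and> weak_gradient \<Omega> u g \<and>
     (\<exists>\<phi>. (\<forall>n. \<phi> n \<in> test_functions \<Omega>) \<and>
          (\<lambda>n::nat. \<integral>x. (u x - \<phi> n x)\<^sup>2 + (norm (g x - grad (\<phi> n) x))\<^sup>2 \<partial>lebesgue_on \<Omega>)
            \<longlonglongrightarrow> 0)"

text \<open>
  \<open>dirichlet_laplacian \<Omega> u f\<close>: the function \<open>u\<close> lies in the domain of the Dirichlet Laplacian
  (the self-adjoint operator on \<open>L\<^sup>2(\<Omega>)\<close> with form domain \<open>H\<^sup>1\<^sub>0(\<Omega>)\<close>) and \<open>- \<Delta> u = f\<close>.
  No regularity of the boundary is needed.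
\<close>
definition dirichlet_laplacian ::
  "'a::euclidean_space set \<Rightarrow> ('a \<Rightarrow> real) \<Rightarrow> ('a \<Rightarrow> real) \<Rightarrow> bool" where
  "dirichlet_laplacian \<Omega> u f \<longleftrightarrow>
     f \<in> L2 \<Omega> \<and>
     (\<exists>g. H10 \<Omega> u g \<and>
        (\<forall>\<phi>\<in>test_functions \<Omega>.
           (\<integral>x. g x \<bullet> grad \<phi> x \<partial>lebesgue_on \<Omega>) = (\<integral>x. f x * \<phi> x \<partial>lebesgue_on \<Omega>)))"

definition eigenspace :: "'a::euclidean_space set \<Rightarrow> real \<Rightarrow> ('a \<Rightarrow> real) set" where
  "eigenspace \<Omega> \<mu> = {u. dirichlet_laplacian \<Omega> u (\<lambda>x. \<mu> * u x)}"

text \<open>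
  The space \<open>V\<close> of functions has dimension \<open>n\<close> after identification of functions that agree
  almost everywhere with respect to \<open>M\<close>.
\<close>
definition has_dim_AE :: "'a measure \<Rightarrow> ('a \<Rightarrow> real) set \<Rightarrow> nat \<Rightarrow> bool" where
  "has_dim_AE M V n \<longleftrightarrow>
     (\<exists>e. (\<forall>i<n. e i \<in> V) \<and>
          (\<forall>c. (AE x in M. (\<Sum>i<n. c i * e i x) = 0) \<longrightarrow> (\<forall>i<n. c i = 0)) \<and>
          (\<forall>u\<in>V. \<exists>c. AE x in M. u x = (\<Sum>i<n. c i * e i x)))"

text \<open>
  The sequence \<open>ev\<close> lists all eigenvalues of the Dirichlet Laplacian in nondecreasing order, each
  repeated according to its multiplicity. Indices start at \<open>0\<close>, so \<open>ev 0\<close> is the lowest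
  eigenvalue \<open>\<lambda>\<^sub>1\<close>. For a real number \<open>\<mu>\<close> that is not an eigenvalue the condition says
  that \<open>\<mu>\<close> does not occur in the sequence.
\<close>
definition dirichlet_eigenvalues :: "'a::euclidean_space set \<Rightarrow> (nat \<Rightarrow> real) \<Rightarrow> bool" where
  "dirichlet_eigenvalues \<Omega> ev \<longleftrightarrow>
     mono ev \<and>
     (\<forall>\<mu>. finite {k. ev k = \<mu>} \<and>
          has_dim_AE (lebesgue_on \<Omega>) (eigenspace \<Omega> \<mu>) (card {k. ev k = \<mu>}))"

definition riesz_mean :: "(nat \<Rightarrow> real) \<Rightarrow> real \<Rightarrow> real \<Rightarrow> real" where
  "riesz_mean ev \<sigma> z =
     (if \<sigma> > 0 then (\<Sum>k. max 0 (z - ev k) powr \<sigma>)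
      else if \<sigma> = 0 then Lim (at_right 0) (\<lambda>s. \<Sum>k. max 0 (z - ev k) powr s)
      else (\<Sum>k\<in>{k. ev k < z}. (z - ev k) powr \<sigma>))"

end

(*
  Everything follows from Yang's inequality d * sum (z - l_k)_+^2 <= 4 * sum (z - l_k)_+ l_k, the case
  sigma = 2. For sigma < 2 the weights (z - l_k)^(sigma - 2) increase in l_k while the summand
  d (z - l_k) - 4 l_k decreases; for sigma > 2 one integrates Yang's inequality at t against
  (z - t)^(sigma - 3). Finally sigma * R_(sigma - 1) is the left derivative of R_sigma.

  Yang's inequality comes from the commutators of the Laplacian with the coordinate functions x_b:
  the functions x_b e_k, made orthogonal to all eigenfunctions e_j with l_j < z, are inserted into the
  min-max lower bound. That bound needs only the existence of minimizers, hence the compactness of the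
  embedding of H^1_0 in L^2 (via ball averages and the Arzela-Ascoli theorem) and the completeness of L^2;
  completeness of the eigenfunctions is not needed.
*)
theory Submission
  imports Defs "HOL-Complex_Analysis.Great_Picard" "HOL-Library.Diagonal_Subsequence"
    "HOL-Library.Function_Algebras"
begin

section \<open>Semi-inner products\<close>

text \<open>Functions are identified only almost everywhere, and a weak gradient is fixed only up to
  null sets. The proof therefore works with pairs of a function and its gradient and with forms that
  are merely semidefinite: an eigenvector orthogonal to all listed ones is a vector of norm zero,
  not the zero vector. The constants have one source. The commutator of d/dx_b with x_b is 1, and
  adding up the d coordinates yields the factor d. The commutator of minus the Laplacian with x_b is
  -2 d/dx_b; its square in a Cauchy-Schwarz estimate yields the 4, and the squares of the partial
  derivatives of e_k add up to l_k. With l_k = z - (z - l_k), Yang's inequality reads d R_2 \<le> 4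
  (z R_1 - R_2), whence 1 + d/4. Against the kernel (z - t)^(sigma - 3) the moments of (t - l)^2 and
  of t - l on [l, z] have the ratio 2 (z - l) / sigma, which turns d/4 into d/(2 sigma). For sigma
  \<le> 1 the function R_sigma has kinks at the eigenvalues. The left derivative exists there all
  the same, and monotonicity is obtained by integrating across finitely many kinks.\<close>

abbreviation sq :: "('v \<Rightarrow> 'v \<Rightarrow> real) \<Rightarrow> 'v \<Rightarrow> real" where
  "sq B x \<equiv> B x x"

text \<open>Only semidefinite, because functions that agree almost everywhere are at distance zero
  without being equal. The laws are restricted to a carrier \<open>S\<close>, since the integrals
  behind \<open>B\<close> are additive only on square-integrable functions.\<close>

locale semi_inner =
  fixes S :: "'v::real_vector set" and B :: "'v \<Rightarrow> 'v \<Rightarrow> real"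
  assumes subspace: "subspace S"
    and sym: "\<lbrakk>x \<in> S; y \<in> S\<rbrakk> \<Longrightarrow> B x y = B y x"
    and add_left: "\<lbrakk>x \<in> S; y \<in> S; z \<in> S\<rbrakk> \<Longrightarrow> B (x + y) z = B x z + B y z"
    and scale_left: "\<lbrakk>x \<in> S; z \<in> S\<rbrakk> \<Longrightarrow> B (c *\<^sub>R x) z = c * B x z"
    and nonneg: "x \<in> S \<Longrightarrow> 0 \<le> B x x"
begin

lemma mem_add: "x \<in> S \<Longrightarrow> y \<in> S \<Longrightarrow> x + y \<in> S"
  and mem_scale: "x \<in> S \<Longrightarrow> c *\<^sub>R x \<in> S"
  and mem_diff: "x \<in> S \<Longrightarrow> y \<in> S \<Longrightarrow> x - y \<in> S"
  and mem_zero: "0 \<in> S"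
  using subspace by (auto simp: subspace_def intro: subspace_diff[OF subspace])

lemma mem_sum: "(\<And>i. i \<in> I \<Longrightarrow> f i \<in> S) \<Longrightarrow> sum f I \<in> S"
  by (rule subspace_sum[OF subspace])

lemma add_right: "\<lbrakk>x \<in> S; y \<in> S; z \<in> S\<rbrakk> \<Longrightarrow> B z (x + y) = B z x + B z y"
  using sym[of z "x + y"] sym[of z x] sym[of z y] add_left[of x y z] by (simp add: mem_add)

lemma scale_right: "\<lbrakk>x \<in> S; z \<in> S\<rbrakk> \<Longrightarrow> B z (c *\<^sub>R x) = c * B z x"
  using sym[of z "c *\<^sub>R x"] sym[of z x] scale_left[of x z c] by (simp add: mem_scale)

lemma diff_left: "\<lbrakk>x \<in> S; y \<in> S; z \<in> S\<rbrakk> \<Longrightarrow> B (x - y) z = B x z - B y z"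
  using add_left[of "x - y" y z] by (simp add: mem_diff)

lemma diff_right: "\<lbrakk>x \<in> S; y \<in> S; z \<in> S\<rbrakk> \<Longrightarrow> B z (x - y) = B z x - B z y"
  using add_right[of "x - y" y z] by (simp add: mem_diff)

lemma zero_left: "z \<in> S \<Longrightarrow> B 0 z = 0"
  using scale_left[of z z 0] by simp

lemma zero_right: "z \<in> S \<Longrightarrow> B z 0 = 0"
  using scale_right[of z z 0] by simp

lemma sum_left:
  "(\<And>i. i \<in> I \<Longrightarrow> f i \<in> S) \<Longrightarrow> z \<in> S \<Longrightarrow> B (\<Sum>i\<in>I. f i) z = (\<Sum>i\<in>I. B (f i) z)"
  by (induction I rule: infinite_finite_induct) (auto simp: zero_left add_left mem_sum)

lemma sum_right:
  "(\<And>i. i \<in> I \<Longrightarrow> f i \<in> S) \<Longrightarrow> z \<in> S \<Longrightarrow> B z (\<Sum>i\<in>I. f i) = (\<Sum>i\<in>I. B z (f i))"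
  by (induction I rule: infinite_finite_induct) (auto simp: zero_right add_right mem_sum)

lemmas B_simps = add_left add_right scale_left scale_right diff_left diff_right
  mem_add mem_scale mem_diff

lemma parallelogram:
  "\<lbrakk>x \<in> S; y \<in> S\<rbrakk> \<Longrightarrow> B (x - y) (x - y) + B (x + y) (x + y) = 2 * B x x + 2 * B y y"
  by (simp add: B_simps)

lemma Cauchy_Schwarz:
  assumes "x \<in> S" "y \<in> S"
  shows "(B x y)\<^sup>2 \<le> B x x * B y y"
proof -
  have q: "0 \<le> t\<^sup>2 * B x x + 2 * t * B x y + B y y" for t
  proof -
    have "0 \<le> sq B (t *\<^sub>R x + y)"
      using assms by (intro nonneg) (simp add: B_simps)
    also have "\<dots> = t\<^sup>2 * B x x + 2 * t * B x y + B y y"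
      using assms by (simp add: B_simps sym[of y x] power2_eq_square algebra_simps)
    finally show ?thesis .
  qed
  show ?thesis
  proof (cases "B x x = 0")
    case True
    have "B x y = 0"
    proof (rule ccontr)
      assume ne: "B x y \<noteq> 0"
      \<comment> \<open>With \<open>B x x = 0\<close> the quadratic is affine in \<open>t\<close>;
        at this \<open>t\<close> its value is -1.\<close>
      from q[of "- (B y y + 1) / (2 * B x y)"] show False
        using True ne by (simp add: field_simps)
    qed
    then show ?thesis using True by simp
  next
    case False
    then have pos: "B x x > 0" using nonneg[OF assms(1)] by linarith
    have "(B x y / B x x)\<^sup>2 * B x x = (B x y)\<^sup>2 / B x x"
      using pos by (simp add: field_simps power2_eq_square)
    then have "0 \<le> B y y - (B x y)\<^sup>2 / B x x"
      using q[of "- B x y / B x x"] pos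
      by (simp add: power2_eq_square)
    then show ?thesis using pos by (simp add: field_simps)
  qed
qed

text \<open>Serves as the variational equation: a minimizer of a Rayleigh quotient is a null vector
  of a nonnegative shifted form, and Cauchy-Schwarz makes it orthogonal to the whole
  carrier.\<close>

lemma null_orthogonal:
  assumes "x \<in> S" "y \<in> S" "B x x = 0"
  shows "B x y = 0"
  using Cauchy_Schwarz[OF assms(1,2)] assms(3) by simp

lemma sq_add_le:
  assumes "x \<in> S" "y \<in> S"
  shows "B (x + y) (x + y) \<le> 2 * B x x + 2 * B y y"
  using parallelogram[OF assms] nonneg[OF mem_diff[OF assms]] by linarith

text \<open>Forms are jointly continuous for the seminorm they define. This carries identities from
  test functions to their closure and constraints from a minimizing sequence to its limit.\<close>

lemma tendsto_form:
  assumes "\<And>n. x n \<in> S" "\<And>n. y n \<in> S" "u \<in> S" "v \<in> S"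
    and "(\<lambda>n. B (x n - u) (x n - u)) \<longlonglongrightarrow> 0" "(\<lambda>n. B (y n - v) (y n - v)) \<longlonglongrightarrow> 0"
  shows "(\<lambda>n. B (x n) (y n)) \<longlonglongrightarrow> B u v"
proof -
  have abs: "\<bar>B p q\<bar> \<le> sqrt (B p p) * sqrt (B q q)" if "p \<in> S" "q \<in> S" for p q
    using real_sqrt_le_mono[OF Cauchy_Schwarz[OF that]] by (simp add: real_sqrt_mult)
  let ?d = "\<lambda>n. sqrt (B (x n - u) (x n - u))" and ?e = "\<lambda>n. sqrt (B (y n - v) (y n - v))"
  have lim: "?d \<longlonglongrightarrow> 0" "?e \<longlonglongrightarrow> 0"
    using tendsto_real_sqrt[OF assms(5)] tendsto_real_sqrt[OF assms(6)] by simp_all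
  have "(\<lambda>n. B (x n) (y n) - B u v) \<longlonglongrightarrow> 0"
  proof (rule Lim_null_comparison)
    show "\<forall>\<^sub>F n in sequentially. norm (B (x n) (y n) - B u v) \<le>
      ?d n * ?e n + ?d n * sqrt (B v v) + sqrt (B u u) * ?e n"
    proof (rule always_eventually, rule allI)
      fix n
      have "B (x n) (y n) - B u v = B (x n - u) (y n - v) + B (x n - u) v + B u (y n - v)"
        using assms(1-4) by (simp add: B_simps)
      also have "\<bar>\<dots>\<bar> \<le> \<bar>B (x n - u) (y n - v)\<bar> + \<bar>B (x n - u) v\<bar> + \<bar>B u (y n - v)\<bar>"
        by linarith
      also have "\<dots> \<le> ?d n * ?e n + ?d n * sqrt (B v v) + sqrt (B u u) * ?e n"
        using assms(1-4) by (intro add_mono abs mem_diff)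
      finally show "norm (B (x n) (y n) - B u v) \<le>
          ?d n * ?e n + ?d n * sqrt (B v v) + sqrt (B u u) * ?e n" by simp
    qed
    show "(\<lambda>n. ?d n * ?e n + ?d n * sqrt (B v v) + sqrt (B u u) * ?e n) \<longlonglongrightarrow> 0"
    proof -
      have "(\<lambda>n. ?d n * ?e n + ?d n * sqrt (B v v) + sqrt (B u u) * ?e n)
          \<longlonglongrightarrow> 0 * 0 + 0 * sqrt (B v v) + sqrt (B u u) * 0"
        by (intro tendsto_add tendsto_mult lim tendsto_const)
      then show ?thesis by simp
    qed
  qed
  then show ?thesis by (simp add: LIM_zero_iff)
qed

definition orthonormal :: "('k \<Rightarrow> 'v) \<Rightarrow> 'k set \<Rightarrow> bool" where
  "orthonormal f I \<longleftrightarrow> f ` I \<subseteq> S \<and> (\<forall>i\<in>I. \<forall>j\<in>I. B (f i) (f j) = (if i = j then 1 else 0))"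

lemma projection_orthogonal:
  assumes "orthonormal f I" "finite I" "x \<in> S" "j \<in> I"
  shows "B (x - (\<Sum>i\<in>I. B x (f i) *\<^sub>R f i)) (f j) = 0"
proof -
  have fS: "f i \<in> S" if "i \<in> I" for i using assms(1) that by (auto simp: orthonormal_def)
  have "B (x - (\<Sum>i\<in>I. B x (f i) *\<^sub>R f i)) (f j) = B x (f j) - (\<Sum>i\<in>I. B x (f i) * B (f i) (f j))"
    using assms fS by (simp add: diff_left sum_left scale_left mem_sum mem_scale)
  also have "(\<Sum>i\<in>I. B x (f i) * B (f i) (f j)) = (\<Sum>i\<in>I. if i = j then B x (f j) else 0)"
    using assms by (intro sum.cong) (auto simp: orthonormal_def)
  finally show ?thesis using assms by simp
qed

text \<open>Gram-Schmidt. Since \<open>B\<close> may have null vectors, linear independence is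
  replaced by the second hypothesis: each \<open>e i\<close> has nonzero distance from every
  combination of its predecessors, so that normalization is possible.\<close>

lemma ex_orthonormal_basis:
  fixes e :: "nat \<Rightarrow> 'v"
  assumes "\<And>i. i < n \<Longrightarrow> e i \<in> S"
    and "\<And>i s. i < n \<Longrightarrow> s \<in> span (e ` {..<i}) \<Longrightarrow> B (e i - s) (e i - s) \<noteq> 0"
  shows "\<exists>f. orthonormal f {..<n} \<and> span (f ` {..<n}) = span (e ` {..<n})"
  using assms
proof (induction n)
  case 0
  then show ?case by (simp add: orthonormal_def)
next
  case (Suc n)
  then obtain f where f: "orthonormal f {..<n}" and sp: "span (f ` {..<n}) = span (e ` {..<n})"
    by (metis less_SucI)
  have fS: "f i \<in> S" if "i < n" for i using f that by (auto simp: orthonormal_def)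
  define s where "s = (\<Sum>i<n. B (e n) (f i) *\<^sub>R f i)"
  define g where "g = e n - s"
  have s: "s \<in> span (f ` {..<n})"
    unfolding s_def by (intro span_sum span_scale span_base) auto
  have sS: "s \<in> S" unfolding s_def by (intro mem_sum mem_scale fS) auto
  have gS: "g \<in> S" unfolding g_def using sS Suc.prems(1) by (intro mem_diff) auto
  have gg: "B g g > 0"
    using Suc.prems(2)[of n s] s sp nonneg[OF gS] unfolding g_def by fastforce
  have g0: "B g (f i) = 0" if "i < n" for i
    using projection_orthogonal[OF f, of "e n" i] Suc.prems(1) that by (simp add: g_def s_def)
  define c where "c = 1 / sqrt (B g g)"
  have c: "c > 0" using gg by (simp add: c_def)
  define h where "h = f(n := c *\<^sub>R g)"
  have cc: "c * (c * B g g) = 1" using gg by (simp add: c_def)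
  have g0': "B (f i) g = 0" if "i < n" for i
    using g0[OF that] sym[OF gS fS[OF that]] by simp
  have "orthonormal h {..<Suc n}"
    unfolding orthonormal_def
  proof (intro conjI ballI)
    show "h ` {..<Suc n} \<subseteq> S"
      using fS gS by (auto simp: h_def mem_scale)
  next
    fix i j assume "i \<in> {..<Suc n}" "j \<in> {..<Suc n}"
    then consider "i < n" "j < n" | "i = n" "j < n" | "i < n" "j = n" | "i = n" "j = n"
      by (auto simp: less_Suc_eq)
    then show "B (h i) (h j) = (if i = j then 1 else 0)"
      by cases (use f fS gS g0 g0' cc in \<open>auto simp: h_def scale_left scale_right mem_scale orthonormal_def\<close>)
  qed
  moreover have "span (h ` {..<Suc n}) = span (e ` {..<Suc n})"
  proof -
    have im: "h ` {..<Suc n} = insert (c *\<^sub>R g) (f ` {..<n})"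
      by (auto simp: h_def lessThan_Suc image_iff)
    have "span (h ` {..<Suc n}) \<subseteq> span (e ` {..<Suc n})"
    proof (rule span_minimal)
      have mono: "span (e ` {..<n}) \<subseteq> span (e ` {..<Suc n})" by (intro span_mono) auto
      have "c *\<^sub>R g \<in> span (e ` {..<Suc n})"
        unfolding g_def
      proof (intro span_scale span_diff)
        show "e n \<in> span (e ` {..<Suc n})" by (rule span_base) simp
        show "s \<in> span (e ` {..<Suc n})" using s mono unfolding sp by (rule rev_subsetD)
      qed
      moreover have "f ` {..<n} \<subseteq> span (e ` {..<Suc n})"
        by (rule order_trans[OF span_superset[of "f ` {..<n}", unfolded sp] mono])
      ultimately show "h ` {..<Suc n} \<subseteq> span (e ` {..<Suc n})" unfolding im by auto
    qed auto
    moreover have "span (e ` {..<Suc n}) \<subseteq> span (h ` {..<Suc n})"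
    proof (rule span_minimal)
      have mono: "span (f ` {..<n}) \<subseteq> span (h ` {..<Suc n})" unfolding im by (intro span_mono) auto
      have "e n = (1 / c) *\<^sub>R (c *\<^sub>R g) + s" using c by (simp add: g_def)
      also have "\<dots> \<in> span (h ` {..<Suc n})"
      proof (rule span_add)
        show "(1 / c) *\<^sub>R (c *\<^sub>R g) \<in> span (h ` {..<Suc n})"
          unfolding im by (rule span_scale, rule span_base) simp
        show "s \<in> span (h ` {..<Suc n})" using s mono by (rule rev_subsetD)
      qed
      finally have "e n \<in> span (h ` {..<Suc n})" .
      moreover have "e ` {..<n} \<subseteq> span (h ` {..<Suc n})"
        using order_trans[OF _ mono] sp span_superset[of "e ` {..<n}"] by simp
      ultimately show "e ` {..<Suc n} \<subseteq> span (h ` {..<Suc n})" by (auto simp: lessThan_Suc)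
    qed auto
    ultimately show ?thesis by blast
  qed
  ultimately show ?case by blast
qed

end

text \<open>Coefficients are attached to indices and not to vectors, so repetitions among the
  \<open>e i\<close> do no harm; \<open>has_dim_AE\<close> speaks of linear combinations in the same
  way.\<close>

lemma span_image_lessThan:
  fixes e :: "nat \<Rightarrow> 'v::real_vector"
  assumes "s \<in> span (e ` {..<n})"
  shows "\<exists>c. s = (\<Sum>i<n. c i *\<^sub>R e i)"
proof -
  let ?T = "{s. \<exists>c. s = (\<Sum>i<n. c i *\<^sub>R e i)}"
  have "subspace ?T"
    unfolding subspace_def
  proof (intro conjI ballI allI)
    show "0 \<in> ?T" by (auto intro!: exI[of _ "\<lambda>_. 0"])
  next
    fix x y assume "x \<in> ?T" "y \<in> ?T"
    then obtain c d where "x = (\<Sum>i<n. c i *\<^sub>R e i)" "y = (\<Sum>i<n. d i *\<^sub>R e i)" by auto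
    then show "x + y \<in> ?T"
      by (auto intro!: exI[of _ "\<lambda>i. c i + d i"] simp: scaleR_add_left sum.distrib)
  next
    fix a x assume "x \<in> ?T"
    then obtain c where "x = (\<Sum>i<n. c i *\<^sub>R e i)" by auto
    then show "a *\<^sub>R x \<in> ?T"
      by (auto intro!: exI[of _ "\<lambda>i. a * c i"] simp: scaleR_sum_right)
  qed
  moreover have "e ` {..<n} \<subseteq> ?T"
  proof clarify
    fix i assume "i < n"
    then show "\<exists>c. e i = (\<Sum>j<n. c j *\<^sub>R e j)"
      by (auto intro!: exI[of _ "\<lambda>j. if j = i then 1 else 0"] simp: if_distrib[of "\<lambda>c. c *\<^sub>R _"] cong: if_cong)
  qed
  ultimately have "span (e ` {..<n}) \<subseteq> ?T" by (intro span_minimal)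
  then show ?thesis using assms by auto
qed

section \<open>Eigenvectors of compact forms\<close>

text \<open>Separates the spectral argument from the function spaces. \<open>compactness\<close>
  yields only a subsequence that is Cauchy for \<open>m\<close>; a limit inside \<open>V\<close>
  comes from \<open>complete\<close>, and only after the sequence is known to be Cauchy for
  \<open>a\<close> as well.\<close>

locale compact_form =
  m: semi_inner V m + a: semi_inner V a
  for V :: "'v::real_vector set" and m a :: "'v \<Rightarrow> 'v \<Rightarrow> real" +
  assumes compactness: "\<And>v C. (\<And>n::nat. v n \<in> V) \<Longrightarrow> (\<And>n. m (v n) (v n) \<le> C) \<Longrightarrow>
      (\<And>n. a (v n) (v n) \<le> C) \<Longrightarrow>
      \<exists>r :: nat \<Rightarrow> nat. strict_mono r \<and> (\<forall>\<epsilon>>0. \<exists>N. \<forall>i\<ge>N. \<forall>j\<ge>N. sq m (v (r i) - v (r j)) < \<epsilon>)"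
    and complete: "\<And>v. (\<And>n::nat. v n \<in> V) \<Longrightarrow>
      (\<And>\<epsilon>. \<epsilon> > 0 \<Longrightarrow> \<exists>N. \<forall>i\<ge>N. \<forall>j\<ge>N. sq m (v i - v j) < \<epsilon>) \<Longrightarrow>
      (\<And>\<epsilon>. \<epsilon> > 0 \<Longrightarrow> \<exists>N. \<forall>i\<ge>N. \<forall>j\<ge>N. sq a (v i - v j) < \<epsilon>) \<Longrightarrow>
      \<exists>u\<in>V. (\<lambda>n. m (v n - u) (v n - u)) \<longlonglongrightarrow> 0 \<and> (\<lambda>n. a (v n - u) (v n - u)) \<longlonglongrightarrow> 0"
begin

definition eigen :: "real \<Rightarrow> 'v \<Rightarrow> bool" where
  "eigen \<mu> u \<longleftrightarrow> u \<in> V \<and> (\<forall>w\<in>V. a u w = \<mu> * m u w)"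

text \<open>Orthonormal vectors have mutual squared distance 2, so infinitely many of them with
  bounded energy would contradict compactness. The definition of the eigenvalue sequence bounds only
  each multiplicity; this excludes accumulation at a finite value.\<close>

lemma finite_eigen_bounded:
  assumes "m.orthonormal e I" "\<And>k. k \<in> I \<Longrightarrow> eigen (ev k) (e k)" "\<And>k. k \<in> I \<Longrightarrow> ev k \<le> C"
  shows "finite (I :: nat set)"
proof (rule ccontr)
  assume "infinite I"
  then obtain s :: "nat \<Rightarrow> nat" where s: "inj s" "range s \<subseteq> I"
    using infinite_countable_subset by blast
  have sI: "s n \<in> I" for n using s by auto
  have eV: "e (s n) \<in> V" for n using assms(1) sI[of n] by (auto simp: m.orthonormal_def)
  have one: "m (e (s n)) (e (s n)) = 1" for n using assms(1) sI by (auto simp: m.orthonormal_def)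
  have "a (e (s n)) (e (s n)) \<le> C" for n
    using assms(2,3)[OF sI[of n]] one[of n] eV[of n] by (auto simp: eigen_def)
  then have ub: "a (e (s n)) (e (s n)) \<le> max C 1" "m (e (s n)) (e (s n)) \<le> max C 1" for n
    by (simp_all add: one le_max_iff_disj)
  obtain r :: "nat \<Rightarrow> nat" where "strict_mono r"
    and r: "\<forall>\<epsilon>>0. \<exists>N. \<forall>i\<ge>N. \<forall>j\<ge>N. sq m (e (s (r i)) - e (s (r j))) < \<epsilon>"
    using compactness[of "\<lambda>n. e (s n)", OF eV ub(2) ub(1)] by blast
  from r obtain N where N: "\<forall>i\<ge>N. \<forall>j\<ge>N. sq m (e (s (r i)) - e (s (r j))) < 1"
    by (meson zero_less_one)
  have "s (r N) \<noteq> s (r (Suc N))"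
    using s(1) strict_mono_eq[OF \<open>strict_mono r\<close>] by (simp add: inj_eq)
  then have "m (e (s (r N))) (e (s (r (Suc N)))) = 0" "m (e (s (r (Suc N)))) (e (s (r N))) = 0"
    using assms(1) sI by (auto simp: m.orthonormal_def)
  then have "sq m (e (s (r N)) - e (s (r (Suc N)))) = 2"
    using eV one by (simp add: m.B_simps)
  then show False using N[rule_format, of N "Suc N"] by simp
qed

text \<open>A minimizing sequence is Cauchy for \<open>m\<close> along a subsequence by compactness and then for \<open>a\<close>
  by the parallelogram law.\<close>
lemma ex_minimizer:
  assumes W: "W = {w \<in> V. \<forall>k\<in>K. m w (e k) = 0}" and e: "\<And>k. k \<in> K \<Longrightarrow> e k \<in> V"
    and w0: "w0 \<in> W" "m w0 w0 > 0"
  shows "\<exists>u \<mu>. u \<in> W \<and> m u u = 1 \<and> a u u = \<mu> \<and> (\<forall>w\<in>W. \<mu> * m w w \<le> a w w)"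
proof -
  have WV: "w \<in> V" if "w \<in> W" for w using that W by auto
  have Wadd: "x + y \<in> W" if "x \<in> W" "y \<in> W" for x y
    using that W e by (auto simp: m.B_simps)
  have Wscale: "c *\<^sub>R x \<in> W" if "x \<in> W" for x c
    using that W e by (auto simp: m.B_simps)
  define Q where "Q = {a w w | w. w \<in> W \<and> m w w = 1}"
  define \<mu> where "\<mu> = Inf Q"
  have normalize: "\<exists>c. c *\<^sub>R w \<in> W \<and> sq m (c *\<^sub>R w) = 1 \<and> sq a (c *\<^sub>R w) = a w w / m w w"
    if "w \<in> W" "m w w > 0" for w
  proof (intro exI[of _ "1 / sqrt (m w w)"] conjI Wscale that)
    show "sq m ((1 / sqrt (m w w)) *\<^sub>R w) = 1"
      using that WV by (simp add: m.B_simps)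
    show "sq a ((1 / sqrt (m w w)) *\<^sub>R w) = a w w / m w w"
      using that WV by (simp add: a.B_simps)
  qed
  have Qne: "Q \<noteq> {}" using normalize[OF w0] by (auto simp: Q_def)
  have bdd: "bdd_below Q" using a.nonneg WV by (auto simp: Q_def intro!: bdd_belowI[of _ 0])
  have low: "\<mu> * m w w \<le> a w w" if "w \<in> W" for w
  proof (cases "m w w > 0")
    case True
    from normalize[OF that True] have "a w w / m w w \<in> Q" by (auto simp: Q_def) metis
    then have "\<mu> \<le> a w w / m w w" unfolding \<mu>_def by (rule cInf_lower[OF _ bdd])
    then show ?thesis using True by (simp add: field_simps)
  next
    case False
    then have "m w w = 0" using m.nonneg[OF WV[OF that]] by linarith
    then show ?thesis using a.nonneg[OF WV[OF that]] by simp
  qed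
  have "\<exists>w. w \<in> W \<and> m w w = 1 \<and> a w w < \<mu> + 1 / real (Suc n)" for n
  proof -
    have "Inf Q < \<mu> + 1 / real (Suc n)" by (simp add: \<mu>_def)
    then show ?thesis using cInf_lessD[OF Qne] by (fastforce simp: Q_def)
  qed
  then obtain v where vW: "\<And>n. v n \<in> W" and v1: "\<And>n. m (v n) (v n) = 1"
    and va: "\<And>n. a (v n) (v n) < \<mu> + 1 / real (Suc n)" by metis
  have vV: "v n \<in> V" for n using vW WV by auto
  have "a (v n) (v n) \<le> max 1 (\<mu> + 1)" for n
    using va[of n] by (smt (verit, best) divide_le_eq_1_pos of_nat_0_less_iff of_nat_1_eq_iff
        of_nat_Suc of_nat_0_le_iff)
  moreover have "m (v n) (v n) \<le> max 1 (\<mu> + 1)" for n by (simp add: v1)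
  ultimately obtain r :: "nat \<Rightarrow> nat" where r: "strict_mono r"
    and rC: "\<forall>\<epsilon>>0. \<exists>N. \<forall>i\<ge>N. \<forall>j\<ge>N. sq m (v (r i) - v (r j)) < \<epsilon>"
    using compactness[of v, OF vV] by blast
  have aC: "\<exists>N. \<forall>i\<ge>N. \<forall>j\<ge>N. sq a (v (r i) - v (r j)) < \<epsilon>" if "\<epsilon> > 0" for \<epsilon>
  proof -
    define \<delta> where "\<delta> = \<epsilon> / (2 * (\<bar>\<mu>\<bar> + 1))"
    have "\<delta> > 0" using that by (simp add: \<delta>_def)
    then obtain N1 where N1: "\<And>i j. i \<ge> N1 \<Longrightarrow> j \<ge> N1 \<Longrightarrow> sq m (v (r i) - v (r j)) < \<delta>"
      using rC by meson
    obtain N2 where N2: "1 / real (Suc N2) < \<epsilon> / 8"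
      using \<open>\<epsilon> > 0\<close> nat_approx_posE[of "\<epsilon> / 8"] by auto
    have "sq a (v (r i) - v (r j)) < \<epsilon>" if "i \<ge> max N1 N2" "j \<ge> max N1 N2" for i j
    proof -
      have small: "a (v (r k)) (v (r k)) < \<mu> + \<epsilon> / 8" if "k \<ge> max N1 N2" for k
      proof -
        have "N2 \<le> r k" using that seq_suble[OF r, of k] by linarith
        then have "1 / real (Suc (r k)) \<le> 1 / real (Suc N2)" by (intro divide_left_mono) auto
        then show ?thesis using va[of "r k"] N2 by linarith
      qed
      let ?d = "v (r i) - v (r j)" and ?s = "v (r i) + v (r j)"
      have md: "m ?d ?d < \<delta>" using N1 that by auto
      have "m ?d ?d + m ?s ?s = 4" using m.parallelogram[OF vV vV, of "r i" "r j"] v1 by simp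
      then have ms: "m ?s ?s = 4 - m ?d ?d" by linarith
      \<comment> \<open>The sum of two members of the sequence lies in \<open>W\<close> again, so
        its energy is at least \<mu> times its mass. In the parallelogram law for \<open>a\<close>
        the multiples of \<mu> cancel, and at most \<epsilon>/2 from near-minimality and
        \<epsilon>/2 from the choice of \<delta> remain.\<close>
      have "\<mu> * m ?s ?s \<le> a ?s ?s" by (intro low Wadd vW)
      then have "4 * \<mu> - \<mu> * m ?d ?d \<le> a ?s ?s" unfolding ms by (simp add: algebra_simps)
      moreover have "a ?d ?d + a ?s ?s = 2 * a (v (r i)) (v (r i)) + 2 * a (v (r j)) (v (r j))"
        by (intro a.parallelogram vV)
      moreover have "\<mu> * m ?d ?d \<le> \<epsilon> / 2"
      proof -
        have "\<mu> * m ?d ?d \<le> (\<bar>\<mu>\<bar> + 1) * \<delta>"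
          using md m.nonneg[OF m.mem_diff[OF vV vV], of "r i" "r j"]
          by (intro mult_mono) auto
        also have "\<dots> = \<epsilon> / 2" by (simp add: \<delta>_def field_simps)
        finally show ?thesis .
      qed
      ultimately show ?thesis using small[OF that(1)] small[OF that(2)] by linarith
    qed
    then show ?thesis by blast
  qed
  obtain u where u: "u \<in> V" "(\<lambda>n. sq m (v (r n) - u)) \<longlonglongrightarrow> 0"
      "(\<lambda>n. sq a (v (r n) - u)) \<longlonglongrightarrow> 0"
    using complete[of "\<lambda>n. v (r n)"] vV rC aC by blast
  have mu: "m u u = 1"
    using m.tendsto_form[of "\<lambda>n. v (r n)" "\<lambda>n. v (r n)" u u] u vV v1
    by (auto simp: LIMSEQ_const_iff)
  have "m u (e k) = 0" if "k \<in> K" for k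
  proof -
    have "(\<lambda>n. m (v (r n)) (e k)) \<longlonglongrightarrow> m u (e k)"
      using m.tendsto_form[of "\<lambda>n. v (r n)" "\<lambda>n. e k" u "e k"] u vV e[OF that]
      by (simp add: m.zero_left m.mem_zero)
    moreover have "m (v (r n)) (e k) = 0" for n using vW[of "r n"] W that by auto
    ultimately show ?thesis by (simp add: LIMSEQ_const_iff)
  qed
  then have uW: "u \<in> W" using u W by auto
  have lim: "(\<lambda>n. a (v (r n)) (v (r n))) \<longlonglongrightarrow> a u u"
    by (intro a.tendsto_form u vV)
  have "(\<lambda>n. \<mu> + 1 / real (Suc (r n))) \<longlonglongrightarrow> \<mu> + 0"
    by (intro tendsto_add tendsto_const LIMSEQ_subseq_LIMSEQ[OF lim_1_over_n[THEN LIMSEQ_Suc] r, unfolded o_def])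
  then have "a u u \<le> \<mu>"
    using lim va by (intro LIMSEQ_le[OF lim]) (auto intro: less_imp_le)
  moreover have "\<mu> \<le> a u u" using low[OF uW] mu by simp
  ultimately show ?thesis using uW mu low by (intro exI[of _ u] exI[of _ \<mu>]) auto
qed

text \<open>The minimizer of the Rayleigh quotient on the complement of the \<open>e k\<close> is an
  eigenvector with mass 1. The hypothesis \<open>null\<close>, which says that \<open>K\<close>
  exhausts the eigenvectors below \<open>z\<close>, then forces the minimum to be at least
  \<open>z\<close>.\<close>

lemma min_max_lower_bound:
  assumes e: "m.orthonormal e K" "finite K" and ev: "\<And>k. k \<in> K \<Longrightarrow> eigen (ev k) (e k)"
    and null: "\<And>\<mu> u. eigen \<mu> u \<Longrightarrow> \<mu> < z \<Longrightarrow> (\<forall>k\<in>K. m u (e k) = 0) \<Longrightarrow> m u u = 0"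
    and v: "v \<in> V" "\<forall>k\<in>K. m v (e k) = 0"
  shows "z * m v v \<le> a v v"
proof (cases "m v v > 0")
  case False
  then have "m v v = 0" using m.nonneg[OF v(1)] by linarith
  then show ?thesis using a.nonneg[OF v(1)] by simp
next
  case True
  define W where "W = {w \<in> V. \<forall>k\<in>K. m w (e k) = 0}"
  have eV: "e k \<in> V" if "k \<in> K" for k using ev[OF that] by (simp add: eigen_def)
  obtain u \<mu> where u: "u \<in> W" "m u u = 1" "a u u = \<mu>" and low: "\<And>w. w \<in> W \<Longrightarrow> \<mu> * m w w \<le> a w w"
    using ex_minimizer[OF W_def eV _ True] v by (auto simp: W_def)
  have subW: "subspace W"
    using eV m.mem_zero
    by (auto simp: subspace_def W_def m.B_simps m.zero_left)
  have WV: "W \<subseteq> V" by (auto simp: W_def)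
  \<comment> \<open>By minimality this form is nonnegative on \<open>W\<close>, and it vanishes at
    \<open>u\<close>; hence \<open>u\<close> is orthogonal to \<open>W\<close> for it.\<close>
  interpret q: semi_inner W "\<lambda>x y. a x y - \<mu> * m x y"
  proof
    show "subspace W" by (rule subW)
  next
    fix x y assume "x \<in> W" "y \<in> W"
    then show "a x y - \<mu> * m x y = a y x - \<mu> * m y x"
      using WV by (metis a.sym m.sym subsetD)
  next
    fix x y z assume "x \<in> W" "y \<in> W" "z \<in> W"
    then have "x \<in> V" "y \<in> V" "z \<in> V" using WV by auto
    then show "a (x + y) z - \<mu> * m (x + y) z = a x z - \<mu> * m x z + (a y z - \<mu> * m y z)"
      by (simp add: a.B_simps m.B_simps algebra_simps)
  next
    fix c x z assume "x \<in> W" "z \<in> W"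
    then have "x \<in> V" "z \<in> V" using WV by auto
    then show "a (c *\<^sub>R x) z - \<mu> * m (c *\<^sub>R x) z = c * (a x z - \<mu> * m x z)"
      by (simp add: a.B_simps m.B_simps algebra_simps)
  next
    fix x assume "x \<in> W"
    then show "0 \<le> a x x - \<mu> * m x x" using low by simp
  qed
  have uV: "u \<in> V" using u WV by auto
  have "eigen \<mu> u"
    unfolding eigen_def
  proof (intro conjI ballI uV)
    fix w assume w: "w \<in> V"
    \<comment> \<open>An arbitrary \<open>w\<close> differs from an element of \<open>W\<close> by
      its projection \<open>p\<close>. Both forms vanish between \<open>u\<close> and
      \<open>p\<close>, because the \<open>e k\<close> are eigenvectors orthogonal to
      \<open>u\<close>; so the equation extends from \<open>W\<close> to \<open>V\<close>.\<close>
    define p where "p = (\<Sum>k\<in>K. m w (e k) *\<^sub>R e k)"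
    have pV: "p \<in> V" unfolding p_def using eV by (intro m.mem_sum m.mem_scale)
    have "w - p \<in> W"
      using m.projection_orthogonal[OF e w] w pV by (auto simp: W_def p_def m.mem_diff)
    then have "a u (w - p) - \<mu> * m u (w - p) = 0"
      using q.null_orthogonal[of u "w - p"] u by simp
    moreover have "m u p = 0"
      unfolding p_def using u(1) uV eV by (simp add: m.sum_right m.mem_scale m.scale_right W_def)
    moreover have "a u p = 0"
    proof -
      have "a u (e k) = 0" if "k \<in> K" for k
        using ev[OF that] uV u(1) that a.sym[OF uV eV[OF that]] m.sym[OF uV eV[OF that]]
        by (simp add: eigen_def W_def)
      then show ?thesis
        unfolding p_def using uV eV by (simp add: a.sum_right a.mem_scale a.scale_right)
    qed
    ultimately show "a u w = \<mu> * m u w"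
      using uV w pV by (simp add: a.diff_right m.diff_right)
  qed
  then have "z \<le> \<mu>" using null[of \<mu> u] u by (force simp: W_def)
  then have "z * m v v \<le> \<mu> * m v v" using True by simp
  also have "\<dots> \<le> a v v" using low v by (simp add: W_def)
  finally show ?thesis .
qed

end

section \<open>Yang's inequality for commutators\<close>

text \<open>Yang's argument: the trial functions \<open>X e\<^sub>k - \<Sum>\<^sub>j \<langle>X e\<^sub>k, e\<^sub>j\<rangle> e\<^sub>j\<close> are inserted into the min-max lower
  bound; the double sums left over cancel because \<open>\<langle>X e\<^sub>k, e\<^sub>j\<rangle>\<close> is symmetric.\<close>
lemma Yang_commutator_inequality:
  fixes V S :: "'v::real_vector set" and ev :: "'k \<Rightarrow> real"
  assumes m: "semi_inner S m" and a: "semi_inner V a" and VS: "V \<subseteq> S"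
    and K: "finite K" "semi_inner.orthonormal S m e K"
    and eV: "\<And>k. k \<in> K \<Longrightarrow> e k \<in> V"
    and eig: "\<And>k w. k \<in> K \<Longrightarrow> w \<in> V \<Longrightarrow> a (e k) w = ev k * m (e k) w"
    and less: "\<And>k. k \<in> K \<Longrightarrow> ev k < z"
    and low: "\<And>v. v \<in> V \<Longrightarrow> (\<And>k. k \<in> K \<Longrightarrow> m v (e k) = 0) \<Longrightarrow> z * m v v \<le> a v v"
    and XV: "\<And>v. v \<in> V \<Longrightarrow> X v \<in> V" and DS: "\<And>v. v \<in> V \<Longrightarrow> D v \<in> S"
    and aX: "\<And>u w. u \<in> V \<Longrightarrow> w \<in> V \<Longrightarrow> a (X u) w = a u (X w) - m (D u) w + m u (D w)"
    and skew: "\<And>u w. u \<in> V \<Longrightarrow> w \<in> V \<Longrightarrow> m (D u) w = - m u (D w)"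
    and Xsym: "\<And>u w. u \<in> V \<Longrightarrow> w \<in> V \<Longrightarrow> m (X u) w = m u (X w)"
    and comm: "\<And>u. u \<in> V \<Longrightarrow> m (D (X u)) u = m (D u) (X u) + m u u"
  shows "(\<Sum>k\<in>K. (z - ev k)\<^sup>2) \<le> 4 * (\<Sum>k\<in>K. (z - ev k) * m (D (e k)) (D (e k)))"
proof -
  interpret m: semi_inner S m by (rule m)
  interpret a: semi_inner V a by (rule a)
  define \<alpha> where "\<alpha> k j = m (X (e k)) (e j)" for k j
  define \<beta> where "\<beta> k j = m (D (e k)) (e j)" for k j
  define T where "T k = m (D (e k)) (D (e k))" for k
  define p where "p k = (\<Sum>j\<in>K. \<alpha> k j *\<^sub>R e j)" for k
  define \<phi> where "\<phi> k = X (e k) - p k" for k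
  define P where "P k = - 2 * m (D (e k)) (\<phi> k)" for k
  have S: "v \<in> S" if "v \<in> V" for v using that VS by auto
  have eS: "e k \<in> S" if "k \<in> K" for k using S eV that by auto
  have on: "m (e i) (e j) = (if i = j then 1 else 0)" if "i \<in> K" "j \<in> K" for i j
    using K(2) that by (auto simp: m.orthonormal_def)
  have XeV: "X (e k) \<in> V" if "k \<in> K" for k using XV eV that by auto
  have pV: "p k \<in> V" for k
    unfolding p_def by (intro a.mem_sum a.mem_scale eV)
  have phiV: "\<phi> k \<in> V" if "k \<in> K" for k
    unfolding \<phi>_def by (intro a.mem_diff pV XeV that)
  have phi_orth: "m (\<phi> k) (e j) = 0" if "k \<in> K" "j \<in> K" for k j
    using m.projection_orthogonal[OF K(2,1) S[OF XeV[OF that(1)]] that(2)]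
    by (simp add: \<phi>_def p_def \<alpha>_def)
  have phi_orth': "m (e j) (\<phi> k) = 0" if "k \<in> K" "j \<in> K" for k j
    using phi_orth[OF that] m.sym[OF eS[OF that(2)] S[OF phiV[OF that(1)]]] by simp
  have mp: "m (p i) (\<phi> k) = 0" if "k \<in> K" for i k
    unfolding p_def using that phiV S eS phi_orth'
    by (simp add: m.sum_left m.scale_left m.mem_scale)
  have ap: "a (p i) (\<phi> k) = 0" if "k \<in> K" for i k
    unfolding p_def using that phiV eV phi_orth'
    by (simp add: a.sum_left a.scale_left a.mem_scale eig)
  \<comment> \<open>The weak form of the commutator identity: applying the operator minus
    \<open>ev k\<close> to \<open>X (e k)\<close> gives \<open>-2 * D (e k)\<close>.\<close>
  have aXe: "a (X (e k)) w = ev k * m (X (e k)) w - 2 * m (D (e k)) w" if "k \<in> K" "w \<in> V" for k w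
    using aX[OF eV[OF that(1)] that(2)] eig[OF that(1) XV[OF that(2)]]
      Xsym[OF eV[OF that(1)] that(2)] skew[OF eV[OF that(1)] that(2)] by simp
  have \<alpha>_sym: "\<alpha> k j = \<alpha> j k" if "k \<in> K" "j \<in> K" for k j
    unfolding \<alpha>_def using Xsym[OF eV eV] that m.sym[OF eS S[OF XeV]] by metis
  have step1: "(z - ev k) * sq m (\<phi> k) \<le> P k" if k: "k \<in> K" for k
  proof -
    have "sq a (\<phi> k) = a (X (e k)) (\<phi> k)"
      using ap[OF k] XeV[OF k] pV phiV[OF k] by (subst \<phi>_def) (simp add: a.diff_left)
    also have "\<dots> = ev k * m (X (e k)) (\<phi> k) + P k"
      using aXe[OF k phiV[OF k]] by (simp add: P_def)
    also have "m (X (e k)) (\<phi> k) = sq m (\<phi> k)"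
      using mp[OF k, of k] S[OF XeV[OF k]] S[OF pV[of k]] S[OF phiV[OF k]]
      by (subst (2) \<phi>_def) (simp add: m.diff_left)
    finally show ?thesis
      using low[OF phiV[OF k] phi_orth[OF k]] by (simp add: algebra_simps)
  qed
  \<comment> \<open>The value \<open>a (X (e k)) (e j)\<close> is computed twice, once with the
    eigenvalue equation of \<open>e j\<close> and once with that of \<open>e k\<close>.\<close>
  have step2: "2 * \<beta> k j = (ev k - ev j) * \<alpha> k j" if "k \<in> K" "j \<in> K" for k j
  proof -
    have "a (X (e k)) (e j) = ev j * \<alpha> k j"
      using eig[OF that(2) XeV[OF that(1)]] a.sym[OF XeV[OF that(1)] eV[OF that(2)]]
        m.sym[OF S[OF XeV[OF that(1)]] eS[OF that(2)]] by (simp add: \<alpha>_def)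
    moreover have "a (X (e k)) (e j) = ev k * \<alpha> k j - 2 * \<beta> k j"
      using aXe[OF that(1) eV[OF that(2)]] by (simp add: \<alpha>_def \<beta>_def)
    ultimately show ?thesis by (simp add: algebra_simps)
  qed
  have step3: "P k = 1 + (\<Sum>j\<in>K. (ev k - ev j) * (\<alpha> k j)\<^sup>2)" if k: "k \<in> K" for k
  proof -
    \<comment> \<open>By \<open>skew\<close> the left side of \<open>comm\<close> is minus the first
      term on its right, so twice this product is minus the mass of \<open>e k\<close>. The leading
      1 of \<open>P k\<close> originates here.\<close>
    have "m (D (e k)) (X (e k)) = - (1/2)"
      using comm[OF eV[OF k]] skew[OF XeV[OF k] eV[OF k]] on[OF k k]
        m.sym[OF DS[OF eV[OF k]] S[OF XeV[OF k]]] by simp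
    moreover have "m (D (e k)) (p k) = (\<Sum>j\<in>K. \<alpha> k j * \<beta> k j)"
      unfolding p_def \<beta>_def using DS[OF eV[OF k]] eS
      by (simp add: m.sum_right m.scale_right m.mem_scale)
    ultimately have "P k = 1 + (\<Sum>j\<in>K. \<alpha> k j * (2 * \<beta> k j))"
      unfolding P_def \<phi>_def using DS[OF eV[OF k]] S[OF XeV[OF k]] S[OF pV[of k]]
      by (simp add: m.diff_right sum_distrib_left mult_ac)
    also have "(\<Sum>j\<in>K. \<alpha> k j * (2 * \<beta> k j)) = (\<Sum>j\<in>K. (ev k - ev j) * (\<alpha> k j)\<^sup>2)"
      using step2[OF k] by (intro sum.cong) (auto simp: power2_eq_square)
    finally show ?thesis .
  qed
  \<comment> \<open>As \<phi> \<open>k\<close> is orthogonal to all \<open>e j\<close>, the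
    projection \<open>q\<close> of \<open>D (e k)\<close> may be removed before applying
    Cauchy-Schwarz. The gain, the sum of the squares of \<beta>, is what later completes the double
    sum to an antisymmetric one.\<close>
  have step4: "(z - ev k) * P k \<le> 4 * (T k - (\<Sum>j\<in>K. (\<beta> k j)\<^sup>2))" if k: "k \<in> K" for k
  proof -
    define q where "q = (\<Sum>j\<in>K. \<beta> k j *\<^sub>R e j)"
    define h where "h = D (e k) - q"
    have De: "D (e k) \<in> S" using DS eV k by auto
    have qS: "q \<in> S" unfolding q_def using eS by (intro m.mem_sum m.mem_scale)
    have hS: "h \<in> S" unfolding h_def by (intro m.mem_diff De qS)
    have h0: "m h (e j) = 0" if "j \<in> K" for j
      using m.projection_orthogonal[OF K(2,1) De that] by (simp add: h_def q_def \<beta>_def)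
    have hq: "m h q = 0"
      unfolding q_def using hS eS h0 by (simp add: m.sum_right m.mem_scale m.scale_right)
    have "m q (D (e k)) = (\<Sum>j\<in>K. (\<beta> k j)\<^sup>2)"
      unfolding q_def using De eS m.sym[OF eS De]
      by (simp add: m.sum_left m.mem_scale m.scale_left \<beta>_def power2_eq_square)
    moreover have "m h h = m (D (e k)) (D (e k)) - m q (D (e k))"
      using hq hS De qS by (subst (2) h_def) (simp add: m.diff_right, simp add: h_def m.diff_left)
    ultimately have hh: "m h h = T k - (\<Sum>j\<in>K. (\<beta> k j)\<^sup>2)" by (simp add: T_def)
    have "m q (\<phi> k) = 0"
      unfolding q_def using k phiV S eS phi_orth' by (simp add: m.sum_left m.scale_left m.mem_scale)
    then have "P k = - 2 * m h (\<phi> k)"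
      using De qS S[OF phiV[OF k]] by (simp add: P_def h_def m.diff_left)
    then have "(P k)\<^sup>2 \<le> 4 * (m h h * sq m (\<phi> k))"
      using m.Cauchy_Schwarz[OF hS S[OF phiV[OF k]]] by (simp add: power_mult_distrib)
    then have "(z - ev k) * (P k)\<^sup>2 \<le> (z - ev k) * (4 * (m h h * sq m (\<phi> k)))"
      using less[OF k] by (intro mult_left_mono) auto
    also have "\<dots> = 4 * m h h * ((z - ev k) * sq m (\<phi> k))" by (simp add: mult_ac)
    also have "\<dots> \<le> 4 * m h h * P k"
      using step1[OF k] m.nonneg[OF hS] by (intro mult_left_mono) auto
    finally have le: "(z - ev k) * P k * P k \<le> 4 * m h h * P k" by (simp add: power2_eq_square mult_ac)
    have "0 \<le> (z - ev k) * sq m (\<phi> k)"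
      using less[OF k] m.nonneg[OF S[OF phiV[OF k]]] by auto
    then have "P k \<ge> 0" using step1[OF k] by linarith
    then consider "P k = 0" | "P k > 0" by linarith
    then have "(z - ev k) * P k \<le> 4 * m h h"
    proof cases
      case 1
      then show ?thesis using m.nonneg[OF hS] by simp
    next
      case 2
      then show ?thesis using le mult_le_cancel_right_pos by blast
    qed
    then show ?thesis by (simp add: hh)
  qed
  have key: "(z - ev k)\<^sup>2 + (\<Sum>j\<in>K. (z - ev k)\<^sup>2 * ((ev k - ev j) * (\<alpha> k j)\<^sup>2))
      \<le> 4 * ((z - ev k) * T k) - (\<Sum>j\<in>K. (z - ev k) * ((ev k - ev j)\<^sup>2 * (\<alpha> k j)\<^sup>2))" if k: "k \<in> K" for k
  proof -
    have \<beta>sq: "4 * (\<Sum>j\<in>K. (\<beta> k j)\<^sup>2) = (\<Sum>j\<in>K. (ev k - ev j)\<^sup>2 * (\<alpha> k j)\<^sup>2)"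
      unfolding sum_distrib_left
    proof (intro sum.cong refl)
      fix j assume "j \<in> K"
      have "4 * (\<beta> k j)\<^sup>2 = (2 * \<beta> k j)\<^sup>2" by (simp add: power_mult_distrib)
      then show "4 * (\<beta> k j)\<^sup>2 = (ev k - ev j)\<^sup>2 * (\<alpha> k j)\<^sup>2"
        unfolding step2[OF k \<open>j \<in> K\<close>] by (simp add: power_mult_distrib)
    qed
    have "(z - ev k) * ((z - ev k) * P k) \<le> (z - ev k) * (4 * (T k - (\<Sum>j\<in>K. (\<beta> k j)\<^sup>2)))"
      using step4[OF k] less[OF k] by (intro mult_left_mono) auto
    also have "\<dots> = 4 * ((z - ev k) * T k) - (z - ev k) * (4 * (\<Sum>j\<in>K. (\<beta> k j)\<^sup>2))"
      by (simp add: algebra_simps)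
    also have "\<dots> = 4 * ((z - ev k) * T k) - (\<Sum>j\<in>K. (z - ev k) * ((ev k - ev j)\<^sup>2 * (\<alpha> k j)\<^sup>2))"
      unfolding \<beta>sq by (simp add: sum_distrib_left)
    also have "(z - ev k) * ((z - ev k) * P k) =
        (z - ev k)\<^sup>2 + (\<Sum>j\<in>K. (z - ev k)\<^sup>2 * ((ev k - ev j) * (\<alpha> k j)\<^sup>2))"
      unfolding step3[OF k] by (simp add: power2_eq_square distrib_left sum_distrib_left mult.assoc)
    finally show ?thesis .
  qed
  \<comment> \<open>The bracket factors: \<open>F k j\<close> equals
    \<open>(z - ev k) * (z - ev j) * (ev k - ev j)\<close> times the square of the symmetric
    \<alpha> \<open>k j\<close>, and is therefore antisymmetric.\<close>
  define F where "F k j = (z - ev k)\<^sup>2 * ((ev k - ev j) * (\<alpha> k j)\<^sup>2) +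
      (z - ev k) * ((ev k - ev j)\<^sup>2 * (\<alpha> k j)\<^sup>2)" for k j
  have anti: "F k j = - F j k" if "k \<in> K" "j \<in> K" for k j
    unfolding F_def \<alpha>_sym[OF that] by (simp add: power2_eq_square algebra_simps)
  have "(\<Sum>k\<in>K. \<Sum>j\<in>K. F k j) = (\<Sum>k\<in>K. \<Sum>j\<in>K. - F j k)"
    by (intro sum.cong refl anti)
  also have "\<dots> = - (\<Sum>k\<in>K. \<Sum>j\<in>K. F k j)"
    by (subst sum.swap) (simp add: sum_negf)
  finally have F0: "(\<Sum>k\<in>K. \<Sum>j\<in>K. F k j) = 0" by simp
  have "(\<Sum>k\<in>K. (z - ev k)\<^sup>2 + (\<Sum>j\<in>K. F k j)) \<le> (\<Sum>k\<in>K. 4 * ((z - ev k) * T k))"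
  proof (rule sum_mono)
    fix k assume "k \<in> K"
    show "(z - ev k)\<^sup>2 + (\<Sum>j\<in>K. F k j) \<le> 4 * ((z - ev k) * T k)"
      unfolding F_def sum.distrib using key[OF \<open>k \<in> K\<close>] by linarith
  qed
  then show ?thesis by (simp add: sum.distrib F0 sum_distrib_left T_def)
qed

section \<open>Riesz means of sequences satisfying Yang's inequality\<close>

text \<open>All that the study of the Riesz means takes from the spectrum. Here \<open>d\<close> is
  any positive real; it becomes the dimension when the locale is interpreted.\<close>

locale Yang_sequence =
  fixes ev :: "nat \<Rightarrow> real" and d :: real
  assumes fin: "\<And>z. finite {k. ev k < z}" and mono_ev: "mono ev"
    and ev_pos: "ev 0 > 0" and d_pos: "d > 0"
    and Yang: "\<And>z. d * (\<Sum>k | ev k < z. (z - ev k)\<^sup>2) \<le> 4 * (\<Sum>k | ev k < z. (z - ev k) * ev k)"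
begin

abbreviation "R \<equiv> riesz_mean ev"

lemma ev_gt_0: "ev k > 0"
  using ev_pos monoD[OF mono_ev, of 0 k] by simp

lemma suminf_riesz:
  "(\<Sum>k. max 0 (z - ev k) powr s) = (\<Sum>k | ev k < z. (z - ev k) powr s)"
  by (subst suminf_finite[OF fin[of z]]) (auto intro!: sum.cong)

text \<open>The three cases of the definition merge into one finite sum: \<open>0 powr s\<close> is
  0 for every \<open>s\<close>, so the truncated terms drop out, and as \<open>s\<close> tends to 0
  each remaining term is continuous in the exponent because its base is positive.\<close>

lemma riesz_mean_eq_sum: "R s z = (\<Sum>k | ev k < z. (z - ev k) powr s)"
proof (cases "s = 0")
  case True
  have "((\<lambda>s. \<Sum>k | ev k < z. (z - ev k) powr s) \<longlongrightarrow> (\<Sum>k | ev k < z. (z - ev k) powr 0)) (at_right 0)"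
    by (intro tendsto_sum tendsto_powr tendsto_const tendsto_ident_at) auto
  then show ?thesis
    using True by (simp add: riesz_mean_def suminf_riesz tendsto_Lim)
qed (auto simp: riesz_mean_def suminf_riesz)

text \<open>The index set in the definition moves with \<open>t\<close>. Below a bound
  \<open>b\<close> it can be frozen, which makes \<open>R s\<close> a finite sum of fixed functions,
  ready for continuity and differentiation.\<close>

lemma riesz_mean_local:
  assumes "t \<le> b" "s > 0"
  shows "R s t = (\<Sum>k | ev k < b. max 0 (t - ev k) powr s)"
  unfolding riesz_mean_eq_sum using assms
  by (intro sum.mono_neutral_cong_left fin) auto

text \<open>From \<open>ev k = z - (z - ev k)\<close>; this turns the right side of Yang's
  inequality into Riesz means.\<close>

lemma sum_weighted_eigenvalues:
  "(\<Sum>k | ev k < z. (z - ev k) powr (s - 1) * ev k) = z * R (s - 1) z - R s z"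
proof -
  have "(z - ev k) powr (s - 1) * ev k = z * (z - ev k) powr (s - 1) - (z - ev k) powr s"
    if "ev k < z" for k
  proof -
    have "(z - ev k) powr s = (z - ev k) powr (s - 1) * (z - ev k)"
      using that powr_add[of "z - ev k" "s - 1" 1] by simp
    then show ?thesis by (simp add: algebra_simps)
  qed
  then show ?thesis
    unfolding riesz_mean_eq_sum sum_distrib_left sum_subtractf[symmetric] by (intro sum.cong) auto
qed

text \<open>The bracket \<open>d (z - \<mu>) - 4 \<mu>\<close> changes sign once, at \<open>c\<close>, so that replacing the weight
  \<open>z - \<mu>\<close> of Yang's inequality by \<open>(z - \<mu>)\<^bsup>s - 1\<^esup>\<close> favours the negative terms.\<close>
lemma riesz_mean_le_2:
  assumes "0 < s" "s \<le> 2" "z > 0"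
  shows "(1 + d / 4) * R s z \<le> z * R (s - 1) z"
proof -
  define c where "c = d * z / (d + 4)"
  have c: "c < z" "d * (z - c) = 4 * c"
    using d_pos assms by (auto simp: c_def field_simps)
  have "(z - ev k) powr (s - 1) * (d * (z - ev k) - 4 * ev k)
      \<le> (z - c) powr (s - 2) * ((z - ev k) * (d * (z - ev k) - 4 * ev k))" if "ev k < z" for k
  proof -
    have e: "(z - ev k) powr (s - 1) = (z - ev k) powr (s - 2) * (z - ev k)"
      using that powr_add[of "z - ev k" "s - 2" 1] by simp
    have b: "d * (z - ev k) - 4 * ev k = (d + 4) * (c - ev k)"
      using c(2) by (simp add: algebra_simps)
    \<comment> \<open>As \<open>s - 2\<close> is not positive, the weight is nondecreasing in the
      eigenvalue; the two factors therefore have opposite signs on either side of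
      \<open>c\<close>.\<close>
    have "((z - ev k) powr (s - 2) - (z - c) powr (s - 2)) * (c - ev k) \<le> 0"
    proof (cases "ev k \<le> c")
      case True
      then have "(z - ev k) powr (s - 2) \<le> (z - c) powr (s - 2)"
        using c assms by (intro powr_mono2') auto
      then show ?thesis using True by (intro mult_nonpos_nonneg) auto
    next
      case False
      then have "(z - c) powr (s - 2) \<le> (z - ev k) powr (s - 2)"
        using c assms that by (intro powr_mono2') auto
      then show ?thesis using False by (intro mult_nonneg_nonpos) auto
    qed
    then have "((d + 4) * (z - ev k)) * (((z - ev k) powr (s - 2) - (z - c) powr (s - 2)) * (c - ev k)) \<le> 0"
      by (rule mult_nonneg_nonpos[rotated]) (use d_pos that in auto)
    then show ?thesis unfolding e b by (simp add: algebra_simps)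
  qed
  then have "(\<Sum>k | ev k < z. (z - ev k) powr (s - 1) * (d * (z - ev k) - 4 * ev k))
      \<le> (\<Sum>k | ev k < z. (z - c) powr (s - 2) * ((z - ev k) * (d * (z - ev k) - 4 * ev k)))"
    by (intro sum_mono) auto
  also have "\<dots> = (z - c) powr (s - 2) *
      (d * (\<Sum>k | ev k < z. (z - ev k)\<^sup>2) - 4 * (\<Sum>k | ev k < z. (z - ev k) * ev k))"
    unfolding sum_distrib_left sum_subtractf[symmetric]
    by (intro sum.cong refl) (simp add: power2_eq_square algebra_simps)
  also have "\<dots> \<le> 0"
    using Yang[of z] by (intro mult_nonneg_nonpos) auto
  also have "(\<Sum>k | ev k < z. (z - ev k) powr (s - 1) * (d * (z - ev k) - 4 * ev k))
     = (\<Sum>k | ev k < z. d * (z - ev k) powr s - 4 * ((z - ev k) powr (s - 1) * ev k))"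
  proof (intro sum.cong refl)
    fix k assume "k \<in> {k. ev k < z}"
    then have e: "(z - ev k) powr s = (z - ev k) powr (s - 1) * (z - ev k)"
      using powr_add[of "z - ev k" "s - 1" 1] by simp
    show "(z - ev k) powr (s - 1) * (d * (z - ev k) - 4 * ev k)
        = d * (z - ev k) powr s - 4 * ((z - ev k) powr (s - 1) * ev k)"
      unfolding e by (simp add: algebra_simps)
  qed
  also have "\<dots> = d * R s z - 4 * (z * R (s - 1) z - R s z)"
    unfolding sum_weighted_eigenvalues[symmetric]
    by (simp add: sum_subtractf sum_distrib_left riesz_mean_eq_sum)
  finally show ?thesis by (simp add: algebra_simps)
qed

end

text \<open>Beta integrals, evaluated by writing \<open>t - l\<close> as
  \<open>(z - l) - (z - t)\<close>. For \<open>p < 1\<close> the kernel is unbounded at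
  \<open>z\<close>, so the fundamental theorem is applied in the form that asks for the derivative
  only in the interior.\<close>

lemma has_integral_power_kernel:
  fixes p L z l :: real
  assumes p: "p > 0" and l: "0 \<le> l" "l \<le> z"
  shows "((\<lambda>t. (z - t) powr (p - 1) * max 0 (t - l)) has_integral
           (z - l) powr (p + 1) / (p * (p + 1))) {0..z}" (is ?A)
    and "((\<lambda>t. (z - t) powr (p - 1) * (max 0 (t - l))\<^sup>2) has_integral
           2 * (z - l) powr (p + 2) / (p * (p + 1) * (p + 2))) {0..z}" (is ?B)
proof -
  define L where "L = z - l"
  have L: "L \<ge> 0" using l by (simp add: L_def)
  \<comment> \<open>An antiderivative of \<open>(z - t) powr (q - 1)\<close> that vanishes at
    \<open>z\<close>, so that only the lower limit contributes.\<close>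
  define W where "W q t = - ((z - t) powr q / q)" for q t
  have W_cont: "continuous_on {l..z} (W q)" if "q > 0" for q
    unfolding W_def using that by (intro continuous_intros continuous_on_powr') auto
  have W_der: "(W q has_real_derivative (z - t) powr (q - 1)) (at t)" if "q > 0" "t < z" for q t
    unfolding W_def using that
    by (auto intro!: derivative_eq_intros simp: field_simps powr_diff)
  have W_z: "W q z = 0" for q by (simp add: W_def)
  have LL: "L powr (q + 1) = L powr q * L" "L powr (q + 2) = L powr q * L\<^sup>2" if "q > 0" for q
    using L that by (auto simp: powr_add power2_eq_square powr_numeral)
  have shift: "(z - t) powr p = (z - t) powr (p - 1) * (z - t)"
      "(z - t) powr (p + 1) = (z - t) powr (p - 1) * (z - t)\<^sup>2" if "t < z" for t
  proof -
    show "(z - t) powr p = (z - t) powr (p - 1) * (z - t)"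
      using powr_add[of "z - t" "p - 1" 1] that by simp
    show "(z - t) powr (p + 1) = (z - t) powr (p - 1) * (z - t)\<^sup>2"
      using powr_add[of "z - t" "p - 1" 2] that by (simp add: powr_numeral add.commute)
  qed
  \<comment> \<open>Below \<open>l\<close> the truncated factor is zero; all eigenvalues can thus
    share the interval from 0 to \<open>z\<close>.\<close>
  have restrict: "(f has_integral i) {0..z}"
    if "(f has_integral i) {l..z}" "\<And>t. t < l \<Longrightarrow> f t = 0" for f :: "real \<Rightarrow> real" and i
  proof -
    have "((\<lambda>t. if t \<in> {l..z} then f t else 0) has_integral i) {0..z}"
      using that(1) l by (subst has_integral_restrict) auto
    then show ?thesis
      by (rule has_integral_eq[rotated]) (use that(2) in auto)
  qed
  show ?A
  proof (rule restrict)
    have "((\<lambda>t. (z - t) powr (p - 1) * max 0 (t - l)) has_integral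
      (L * W p z - W (p + 1) z) - (L * W p l - W (p + 1) l)) {l..z}"
    proof (rule fundamental_theorem_of_calculus_interior)
      show "continuous_on {l..z} (\<lambda>t. L * W p t - W (p + 1) t)"
        using p by (intro continuous_intros W_cont) auto
    next
      fix t assume t: "t \<in> {l<..<z}"
      have "((\<lambda>t. L * W p t - W (p + 1) t) has_real_derivative
          L * (z - t) powr (p - 1) - (z - t) powr (p + 1 - 1)) (at t)"
        using t p by (intro derivative_intros DERIV_cmult W_der) auto
      also have "L * (z - t) powr (p - 1) - (z - t) powr (p + 1 - 1) = (z - t) powr (p - 1) * max 0 (t - l)"
        using t shift[of t] by (simp add: L_def max_def algebra_simps)
      finally show "((\<lambda>t. L * W p t - W (p + 1) t) has_vector_derivative
          (z - t) powr (p - 1) * max 0 (t - l)) (at t)"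
        by (simp add: has_real_derivative_iff_has_vector_derivative)
    qed (use l in auto)
    also have "(L * W p z - W (p + 1) z) - (L * W p l - W (p + 1) l) = (z - l) powr (p + 1) / (p * (p + 1))"
      using p unfolding W_z unfolding W_def L_def[symmetric] LL[OF p]
      by (simp add: divide_simps) (simp add: algebra_simps)
    finally show "((\<lambda>t. (z - t) powr (p - 1) * max 0 (t - l)) has_integral
           (z - l) powr (p + 1) / (p * (p + 1))) {l..z}" .
  qed auto
  show ?B
  proof (rule restrict)
    let ?G = "\<lambda>t. L\<^sup>2 * W p t - 2 * L * W (p + 1) t + W (p + 2) t"
    have "((\<lambda>t. (z - t) powr (p - 1) * (max 0 (t - l))\<^sup>2) has_integral ?G z - ?G l) {l..z}"
    proof (rule fundamental_theorem_of_calculus_interior)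
      show "continuous_on {l..z} ?G"
        using p by (intro continuous_intros W_cont) auto
    next
      fix t assume t: "t \<in> {l<..<z}"
      have "(?G has_real_derivative
          L\<^sup>2 * (z - t) powr (p - 1) - 2 * L * (z - t) powr (p + 1 - 1) + (z - t) powr (p + 2 - 1)) (at t)"
        using t p by (intro derivative_intros DERIV_cmult W_der) auto
      also have "L\<^sup>2 * (z - t) powr (p - 1) - 2 * L * (z - t) powr (p + 1 - 1) + (z - t) powr (p + 2 - 1)
          = (z - t) powr (p - 1) * (max 0 (t - l))\<^sup>2"
      proof -
        have e: "p + 1 - 1 = p" "p + 2 - 1 = p + 1" by simp_all
        have "max 0 (t - l) = t - l" "t < z" using t by auto
        then show ?thesis
          unfolding e shift[OF \<open>t < z\<close>] L_def by (simp add: algebra_simps power2_eq_square)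
      qed
      finally show "(?G has_vector_derivative (z - t) powr (p - 1) * (max 0 (t - l))\<^sup>2) (at t)"
        by (simp add: has_real_derivative_iff_has_vector_derivative)
    qed (use l in auto)
    also have "?G z - ?G l = 2 * (z - l) powr (p + 2) / (p * (p + 1) * (p + 2))"
      using p unfolding W_z unfolding W_def L_def[symmetric] LL[OF p]
      by (simp add: divide_simps power2_eq_square) (simp add: algebra_simps)
    finally show "((\<lambda>t. (z - t) powr (p - 1) * (max 0 (t - l))\<^sup>2) has_integral
           2 * (z - l) powr (p + 2) / (p * (p + 1) * (p + 2))) {l..z}" .
  qed auto
qed

text \<open>Delicate only at the kink: for \<open>s > 1\<close> the difference quotient at 0 is at
  most \<open>\<bar>h\<bar> powr (s - 1)\<close>, which tends to 0. The strict \<open>x > 0\<close>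
  in the derivative agrees with the strict \<open>ev k < z\<close> in the Riesz means.\<close>

lemma has_real_derivative_pos_part_powr:
  fixes s x :: real
  assumes "s > 1 \<or> (s > 0 \<and> x \<noteq> 0)"
  shows "((\<lambda>x. max 0 x powr s) has_real_derivative s * (if x > 0 then x powr (s - 1) else 0)) (at x)"
proof -
  consider "x > 0" | "x < 0" | "x = 0" "s > 1" using assms by linarith
  then show ?thesis
  proof cases
    case 1
    have "((\<lambda>x. x powr s) has_real_derivative s * x powr (s - 1)) (at x)"
      using 1 by (auto intro!: derivative_eq_intros)
    then have "((\<lambda>x. max 0 x powr s) has_real_derivative s * x powr (s - 1)) (at x)"
      by (rule has_field_derivative_transform_within_open[of _ _ _ "{0<..}"]) (use 1 in auto)
    then show ?thesis using 1 by simp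
  next
    case 2
    have "((\<lambda>x. 0) has_real_derivative 0) (at x)" by simp
    then have "((\<lambda>x. max 0 x powr s) has_real_derivative 0) (at x)"
      by (rule has_field_derivative_transform_within_open[of _ _ _ "{..<0}"]) (use 2 in auto)
    then show ?thesis using 2 by simp
  next
    case 3
    have "((\<lambda>h. max 0 h powr s / h) \<longlongrightarrow> 0) (at 0)"
    proof (rule Lim_null_comparison)
      show "\<forall>\<^sub>F h in at 0. norm (max 0 h powr s / h) \<le> \<bar>h\<bar> powr (s - 1)"
      proof (rule always_eventually, rule allI)
        fix h :: real
        show "norm (max 0 h powr s / h) \<le> \<bar>h\<bar> powr (s - 1)"
        proof (cases "h > 0")
          case True
          then show ?thesis by (simp add: powr_diff)
        next
          case False
          then have "max 0 h = 0" by simp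
          then show ?thesis by simp
        qed
      qed
      have "((\<lambda>h. \<bar>h\<bar> powr (s - 1)) \<longlongrightarrow> \<bar>0\<bar> powr (s - 1)) (at (0::real))"
        using 3 by (intro tendsto_powr' tendsto_rabs tendsto_ident_at tendsto_const) auto
      then show "((\<lambda>h. \<bar>h\<bar> powr (s - 1)) \<longlongrightarrow> 0) (at (0::real))" by simp
    qed
    then show ?thesis using 3 by (simp add: DERIV_def)
  qed
qed

section \<open>Orders above two, derivatives of Riesz means and monotone quotients\<close>

context Yang_sequence
begin

text \<open>The kernel exponent is \<open>s - 3 = p - 1\<close>. At \<open>s = 2\<close> this kernel
  is not integrable, so that value is taken from the other range, where both constants agree. The
  common factor \<open>2 / (p * (p + 1))\<close> of the two moments cancels and leaves
  \<open>d / s\<close> against 2.\<close>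

lemma riesz_mean_ge_2:
  assumes "s \<ge> 2" "z > 0"
  shows "(1 + d / (2 * s)) * R s z \<le> z * R (s - 1) z"
proof (cases "s = 2")
  case True
  then show ?thesis using riesz_mean_le_2[of 2 z] assms by simp
next
  case False
  define p where "p = s - 2"
  have p: "p > 0" using False assms by (simp add: p_def)
  let ?K = "{k. ev k < z}"
  let ?I = "\<lambda>k. d * (2 * (z - ev k) powr (p + 2) / (p * (p + 1) * (p + 2)))
                - 4 * ev k * ((z - ev k) powr (p + 1) / (p * (p + 1)))"
  have "((\<lambda>t. \<Sum>k\<in>?K. d * ((z - t) powr (p - 1) * (max 0 (t - ev k))\<^sup>2)
      - 4 * ev k * ((z - t) powr (p - 1) * max 0 (t - ev k))) has_integral (\<Sum>k\<in>?K. ?I k)) {0..z}"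
    using ev_gt_0
    by (intro has_integral_sum fin has_integral_diff has_integral_mult_right has_integral_power_kernel p)
      (auto intro: less_imp_le)
  from has_integral_neg[OF this] have "0 \<le> - (\<Sum>k\<in>?K. ?I k)"
  proof (rule has_integral_nonneg)
    fix t assume t: "t \<in> {0..z}"
    \<comment> \<open>Truncation lets one index set, that of \<open>z\<close>, serve for every
      \<open>t\<close>: the terms with \<open>ev k\<close> at or above \<open>t\<close> vanish, and
      Yang's inequality at \<open>t\<close> applies.\<close>
    have "(\<Sum>k\<in>?K. d * (max 0 (t - ev k))\<^sup>2 - 4 * (max 0 (t - ev k) * ev k))
       = (\<Sum>k | ev k < t. d * (t - ev k)\<^sup>2 - 4 * ((t - ev k) * ev k))"
      using t by (intro sum.mono_neutral_cong_right fin) auto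
    also have "\<dots> \<le> 0" using Yang[of t] by (simp add: sum_subtractf sum_distrib_left)
    finally have "(z - t) powr (p - 1) *
        (\<Sum>k\<in>?K. d * (max 0 (t - ev k))\<^sup>2 - 4 * (max 0 (t - ev k) * ev k)) \<le> 0"
      by (intro mult_nonneg_nonpos) auto
    then show "0 \<le> - (\<Sum>k\<in>?K. d * ((z - t) powr (p - 1) * (max 0 (t - ev k))\<^sup>2)
      - 4 * ev k * ((z - t) powr (p - 1) * max 0 (t - ev k)))"
      by (simp add: sum_distrib_left algebra_simps)
  qed
  then have "(\<Sum>k\<in>?K. ?I k) \<le> 0" by simp
  also have "(\<Sum>k\<in>?K. ?I k) = (\<Sum>k\<in>?K. (2 / (p * (p + 1))) *
      (d / s * (z - ev k) powr s - 2 * ((z - ev k) powr (s - 1) * ev k)))"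
  proof (intro sum.cong refl)
    fix k
    have ps: "p + 2 = s" "p + 1 = s - 1" by (simp_all add: p_def)
    show "?I k = (2 / (p * (p + 1))) * (d / s * (z - ev k) powr s - 2 * ((z - ev k) powr (s - 1) * ev k))"
      using p assms unfolding ps by (simp add: divide_simps)
  qed
  also have "\<dots> = (2 / (p * (p + 1))) * (d / s * R s z - 2 * (z * R (s - 1) z - R s z))"
    unfolding sum_weighted_eigenvalues[symmetric]
    unfolding riesz_mean_eq_sum sum_distrib_left sum_subtractf[symmetric] by simp
  finally have "(2 / (p * (p + 1))) * (d / s * R s z - 2 * (z * R (s - 1) z - R s z)) \<le> 0" .
  moreover have "2 / (p * (p + 1)) > 0" using p by simp
  ultimately have "d / s * R s z - 2 * (z * R (s - 1) z - R s z) \<le> 0"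
    by (metis mult_pos_pos not_le)
  then show ?thesis using assms by (simp add: field_simps)
qed

lemma riesz_mean_has_derivative:
  assumes "s > 1 \<or> (s > 0 \<and> z \<notin> range ev)"
  shows "(R s has_real_derivative s * R (s - 1) z) (at z)"
proof -
  \<comment> \<open>Any bound above \<open>z\<close> would do; the index set has to be fixed in a
    two-sided neighbourhood of \<open>z\<close>.\<close>
  let ?K = "{k. ev k < z + 1}"
  have s: "s > 0" using assms by auto
  have "((\<lambda>t. \<Sum>k\<in>?K. max 0 (t - ev k) powr s) has_real_derivative
      (\<Sum>k\<in>?K. s * (if z - ev k > 0 then (z - ev k) powr (s - 1) else 0))) (at z)"
  proof (rule DERIV_sum)
    fix k
    have "((\<lambda>x. max 0 x powr s) has_real_derivative
        s * (if z - ev k > 0 then (z - ev k) powr (s - 1) else 0)) (at (z - ev k))"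
      using assms by (intro has_real_derivative_pos_part_powr) auto
    moreover have "((\<lambda>t. t - ev k) has_real_derivative 1) (at z)"
      by (auto intro!: derivative_eq_intros)
    ultimately show "((\<lambda>t. max 0 (t - ev k) powr s) has_real_derivative
        s * (if z - ev k > 0 then (z - ev k) powr (s - 1) else 0)) (at z)"
      using DERIV_chain2[of "\<lambda>x. max 0 x powr s" _ "\<lambda>t. t - ev k" z 1] by fastforce
  qed
  also have "(\<Sum>k\<in>?K. s * (if z - ev k > 0 then (z - ev k) powr (s - 1) else 0)) = s * R (s - 1) z"
    unfolding riesz_mean_eq_sum sum_distrib_left
    by (intro sum.mono_neutral_cong_right fin) auto
  finally show ?thesis
    by (rule has_field_derivative_transform_within_open[of _ _ _ "{..<z + 1}"])
      (use s riesz_mean_local[of _ "z + 1" s] in auto)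
qed

text \<open>To the left of \<open>z\<close> only the eigenvalues strictly below \<open>z\<close>
  contribute, and each such term is smooth at \<open>z\<close>. The left derivative is thus given by
  the formula even at a kink, and any two-sided derivative has to agree with it.\<close>

lemma riesz_mean_left_derivative:
  assumes "s > 0" "(R s has_real_derivative D) (at z)"
  shows "D = s * R (s - 1) z"
proof -
  let ?K = "{k. ev k < z}"
  have "((\<lambda>t. \<Sum>k\<in>?K. (t - ev k) powr s) has_real_derivative (\<Sum>k\<in>?K. s * (z - ev k) powr (s - 1))) (at z)"
    by (rule DERIV_sum) (auto intro!: derivative_eq_intros)
  then have "((\<lambda>t. \<Sum>k\<in>?K. (t - ev k) powr s) has_real_derivative s * R (s - 1) z) (at z within {..z})"
    unfolding riesz_mean_eq_sum sum_distrib_left by (rule has_field_derivative_at_within)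
  moreover have "\<forall>\<^sub>F t in at z within {..z}. (\<Sum>k\<in>?K. (t - ev k) powr s) = R s t"
  proof -
    have "\<forall>\<^sub>F t in at z. \<forall>k\<in>?K. ev k < t"
      using fin[of z] by (intro eventually_ball_finite) (auto intro: order_tendstoD tendsto_ident_at)
    then have "\<forall>\<^sub>F t in at z within {..z}. \<forall>k\<in>?K. ev k < t"
      by (rule filter_leD[OF at_le[OF subset_UNIV], of _ z])
    moreover have "\<forall>\<^sub>F t in at z within {..z}. t \<le> z"
      by (simp add: eventually_at_filter)
    ultimately show ?thesis
    proof eventually_elim
      case (elim t)
      then show ?case
        unfolding riesz_mean_eq_sum by (intro sum.cong) auto
    qed
  qed
  moreover have "(\<Sum>k\<in>?K. (z - ev k) powr s) = R s z" by (simp add: riesz_mean_eq_sum)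
  ultimately have "(R s has_real_derivative s * R (s - 1) z) (at z within {..z})"
    by (rule has_field_derivative_cong_eventually[THEN iffD1, rotated 2])
  moreover have "(R s has_real_derivative D) (at z within {..z})"
    using assms(2) by (rule has_field_derivative_at_within)
  moreover have "at z within {..z} \<noteq> bot"
  proof -
    have "at_left z \<le> at z within {..z}" by (rule at_le) auto
    then show ?thesis using trivial_limit_at_left_real[of z] by (auto simp: bot_unique)
  qed
  ultimately show ?thesis
    unfolding has_field_derivative_iff using tendsto_unique by blast
qed

lemma continuous_on_riesz_mean: "s > 0 \<Longrightarrow> continuous_on {a..b} (R s)"
proof -
  assume s: "s > 0"
  have "continuous_on {a..b} (\<lambda>t. \<Sum>k | ev k < b. max 0 (t - ev k) powr s)"
    using s by (intro continuous_intros continuous_on_powr') auto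
  then show ?thesis
    by (rule continuous_on_cong[THEN iffD1, rotated -1]) (use s riesz_mean_local in auto)
qed

text \<open>For \<open>s \<le> 1\<close> the quotient is not differentiable at eigenvalues. It is
  continuous, and only finitely many eigenvalues lie between \<open>x\<close> and \<open>y\<close>,
  so the fundamental theorem with a finite exceptional set applies.\<close>

lemma mono_on_riesz_quotient:
  assumes s: "s > 0" and q: "\<And>z. z \<ge> ev 0 \<Longrightarrow> q * R s z \<le> z * (s * R (s - 1) z)"
  shows "mono_on {ev 0..} (\<lambda>z. R s z / z powr q)"
proof (rule mono_onI)
  fix x y assume xy: "x \<in> {ev 0..}" "y \<in> {ev 0..}" "x \<le> y"
  define E where "E = ev ` {k. ev k < y + 1}"
  \<comment> \<open>The hypothesis on \<open>q\<close> makes the derivative nonnegative; the value 0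
    on the exceptional set keeps the integrand nonnegative everywhere.\<close>
  define g where "g z = (if z \<in> E then 0 else z powr (- q - 1) * (z * (s * R (s - 1) z) - q * R s z))" for z
  have E: "z \<notin> range ev" if "z \<in> {x..y} - E" for z using that by (auto simp: E_def)
  have "(g has_integral (R s y * y powr (-q) - R s x * x powr (-q))) {x..y}"
  proof (rule fundamental_theorem_of_calculus_strong)
    show "finite E" by (simp add: E_def fin)
    fix z assume z: "z \<in> {x..y} - E"
    have z0: "z > 0" using z xy ev_pos by auto
    have e: "z powr (- q) = z powr (- q - 1) * z"
      using powr_add[of z "- q - 1" 1] z0 by simp
    have "((\<lambda>z. R s z * z powr (- q)) has_real_derivative
        s * R (s - 1) z * z powr (-q) + (- q * z powr (- q - 1)) * R s z) (at z)"
      using z0 by (intro DERIV_mult riesz_mean_has_derivative) (use s E[OF z] in \<open>auto intro!: derivative_eq_intros\<close>)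
    also have "s * R (s - 1) z * z powr (-q) + (- q * z powr (- q - 1)) * R s z = g z"
      using z unfolding e by (simp add: g_def algebra_simps)
    finally show "((\<lambda>z. R s z * z powr (- q)) has_vector_derivative g z) (at z)"
      by (simp add: has_real_derivative_iff_has_vector_derivative)
  next
    show "continuous_on {x..y} (\<lambda>z. R s z * z powr (- q))"
      using xy ev_pos by (intro continuous_intros continuous_on_riesz_mean s) auto
  qed (use xy in auto)
  then have "0 \<le> R s y * y powr (-q) - R s x * x powr (-q)"
    by (rule has_integral_nonneg) (use q xy in \<open>auto simp: g_def\<close>)
  then show "R s x / x powr q \<le> R s y / y powr q" by (simp add: powr_minus_divide)
qed

text \<open>Multiplying the bound for \<open>R (\<sigma> - 1)\<close> by \<sigma> gives both the
  derivative bound and the exponent of the monotone quotient. For \<sigma> \<le> 2 the derivative is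
  identified through the left derivative, so a point of differentiability is treated alike above and
  below order one.\<close>

lemma riesz_mean_inequalities:
  "(\<forall>\<sigma>. 0 < \<sigma> \<and> \<sigma> \<le> 2 \<longrightarrow>
        (\<forall>z\<ge>ev 0.
           R (\<sigma> - 1) z \<ge> (1 + d / 4) * (1 / z) * R \<sigma> z \<and>
           (1 < \<sigma> \<longrightarrow> R \<sigma> differentiable (at z)) \<and>
           (R \<sigma> differentiable (at z) \<longrightarrow>
              deriv (R \<sigma>) z \<ge> (1 + d / 4) * (\<sigma> / z) * R \<sigma> z)) \<and>
        mono_on {ev 0..} (\<lambda>z. R \<sigma> z / z powr (\<sigma> + d * \<sigma> / 4)))
     \<and>
     (\<forall>\<sigma>\<ge>2.
        (\<forall>z\<ge>ev 0.
           R (\<sigma> - 1) z \<ge> (1 + d / (2 * \<sigma>)) * (1 / z) * R \<sigma> z \<and>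
           R \<sigma> differentiable (at z) \<and>
           deriv (R \<sigma>) z \<ge> (\<sigma> + d / 2) * (1 / z) * R \<sigma> z) \<and>
        mono_on {ev 0..} (\<lambda>z. R \<sigma> z / z powr (\<sigma> + d / 2)))"
proof (intro conjI allI impI)
  fix \<sigma> :: real assume \<sigma>: "0 < \<sigma> \<and> \<sigma> \<le> 2"
  then have *: "(1 + d / 4) * R \<sigma> z \<le> z * R (\<sigma> - 1) z" if "z \<ge> ev 0" for z
    using riesz_mean_le_2[of \<sigma> z] ev_pos that by simp
  show "mono_on {ev 0..} (\<lambda>z. R \<sigma> z / z powr (\<sigma> + d * \<sigma> / 4))"
  proof (rule mono_on_riesz_quotient)
    fix z assume "z \<ge> ev 0"
    from mult_left_mono[OF *[OF this], of \<sigma>] \<sigma>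
    show "(\<sigma> + d * \<sigma> / 4) * R \<sigma> z \<le> z * (\<sigma> * R (\<sigma> - 1) z)" by (simp add: algebra_simps)
  qed (use \<sigma> in auto)
  fix z assume z: "z \<ge> ev 0"
  then have z0: "z > 0" using ev_pos by simp
  show 1: "R (\<sigma> - 1) z \<ge> (1 + d / 4) * (1 / z) * R \<sigma> z"
    using *[OF z] z0 by (simp add: field_simps)
  show "R \<sigma> differentiable (at z)" if "1 < \<sigma>"
    using riesz_mean_has_derivative[of \<sigma> z] that by (auto simp: real_differentiable_def)
  show "deriv (R \<sigma>) z \<ge> (1 + d / 4) * (\<sigma> / z) * R \<sigma> z" if "R \<sigma> differentiable (at z)"
  proof -
    have "(R \<sigma> has_real_derivative deriv (R \<sigma>) z) (at z)"
      using that DERIV_deriv_iff_real_differentiable by blast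
    then have "deriv (R \<sigma>) z = \<sigma> * R (\<sigma> - 1) z"
      using riesz_mean_left_derivative \<sigma> by blast
    then show ?thesis using mult_left_mono[OF 1, of \<sigma>] \<sigma> by (simp add: mult_ac)
  qed
next
  fix \<sigma> :: real assume \<sigma>: "\<sigma> \<ge> 2"
  then have *: "(1 + d / (2 * \<sigma>)) * R \<sigma> z \<le> z * R (\<sigma> - 1) z" if "z \<ge> ev 0" for z
    using riesz_mean_ge_2[of \<sigma> z] ev_pos that by simp
  have \<sigma>d: "\<sigma> * (1 + d / (2 * \<sigma>)) = \<sigma> + d / 2" using \<sigma> by (simp add: field_simps)
  show "mono_on {ev 0..} (\<lambda>z. R \<sigma> z / z powr (\<sigma> + d / 2))"
  proof (rule mono_on_riesz_quotient)
    fix z assume "z \<ge> ev 0"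
    from mult_left_mono[OF *[OF this], of \<sigma>] \<sigma>
    show "(\<sigma> + d / 2) * R \<sigma> z \<le> z * (\<sigma> * R (\<sigma> - 1) z)"
      unfolding \<sigma>d[symmetric] by (simp add: mult_ac)
  qed (use \<sigma> in auto)
  fix z assume z: "z \<ge> ev 0"
  then have z0: "z > 0" using ev_pos by simp
  show 1: "R (\<sigma> - 1) z \<ge> (1 + d / (2 * \<sigma>)) * (1 / z) * R \<sigma> z"
    using *[OF z] z0 by (simp add: field_simps)
  have der: "(R \<sigma> has_real_derivative \<sigma> * R (\<sigma> - 1) z) (at z)"
    using riesz_mean_has_derivative[of \<sigma> z] \<sigma> by auto
  then show "R \<sigma> differentiable (at z)" by (auto simp: real_differentiable_def)
  have "deriv (R \<sigma>) z = \<sigma> * R (\<sigma> - 1) z" using der by (rule DERIV_imp_deriv)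
  then show "deriv (R \<sigma>) z \<ge> (\<sigma> + d / 2) * (1 / z) * R \<sigma> z"
    unfolding \<sigma>d[symmetric] using mult_left_mono[OF 1, of \<sigma>] \<sigma> by (simp add: mult_ac)
qed

end

section \<open>Test functions\<close>

lemma grad_eqI:
  assumes "(f has_derivative (\<lambda>h. G \<bullet> h)) (at x)"
  shows "grad f x = G"
  unfolding grad_def frechet_derivative_at[OF assms, symmetric]
  by (rule euclidean_representation)

lemma grad_has_derivative:
  assumes "f differentiable (at x)"
  shows "(f has_derivative (\<lambda>h. grad f x \<bullet> h)) (at x)"
proof -
  let ?D = "frechet_derivative f (at x)"
  have D: "(f has_derivative ?D) (at x)" using assms by (simp add: frechet_derivative_works)
  have "?D h = grad f x \<bullet> h" for h
  proof -
    have "?D h = ?D (\<Sum>b\<in>Basis. (h \<bullet> b) *\<^sub>R b)" by (simp add: euclidean_representation)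
    also have "\<dots> = (\<Sum>b\<in>Basis. (h \<bullet> b) * ?D b)"
      using has_derivative_linear[OF D] by (simp add: linear_sum linear_scale)
    also have "\<dots> = grad f x \<bullet> h"
      unfolding grad_def inner_sum_left by (intro sum.cong) (simp_all add: inner_commute)
    finally show ?thesis .
  qed
  then show ?thesis using D by (metis (no_types, lifting) ext)
qed

section \<open>Closure properties of test functions\<close>

lemma Ck_Suc_imp: "Ck (Suc k) f \<Longrightarrow> Ck k f"
proof (induction k arbitrary: f)
  case 0
  then show ?case
    by (auto intro!: differentiable_imp_continuous_on simp: differentiable_on_def differentiable_at_withinI)
next
  case (Suc k)
  then show ?case by (metis Ck.simps(2))
qed

lemma Ck_const: "Ck k (\<lambda>x. c)"
  by (induction k arbitrary: c) auto

lemma Ck_add: "Ck k f \<Longrightarrow> Ck k g \<Longrightarrow> Ck k (\<lambda>x. f x + g x)"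
proof (induction k arbitrary: f g)
  case 0
  then show ?case by (auto intro: continuous_on_add)
next
  case (Suc k)
  have "frechet_derivative (\<lambda>x. f x + g x) (at x) b
      = frechet_derivative f (at x) b + frechet_derivative g (at x) b" for x b
  proof -
    have "(f has_derivative frechet_derivative f (at x)) (at x)"
      "(g has_derivative frechet_derivative g (at x)) (at x)"
      using Suc.prems by (simp_all add: frechet_derivative_works)
    from has_derivative_add[OF this] show ?thesis
      by (simp add: frechet_derivative_at[symmetric])
  qed
  then show ?case using Suc by auto
qed

lemma Ck_cmult: "Ck k f \<Longrightarrow> Ck k (\<lambda>x. c * f x)"
proof (induction k arbitrary: f)
  case 0
  then show ?case by (auto intro: continuous_intros)
next
  case (Suc k)
  have "frechet_derivative (\<lambda>x. c * f x) (at x) b = c * frechet_derivative f (at x) b" for x b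
  proof -
    have "(f has_derivative frechet_derivative f (at x)) (at x)"
      using Suc.prems by (simp add: frechet_derivative_works)
    from has_derivative_mult_right[OF this, of c] show ?thesis
      by (simp add: frechet_derivative_at[symmetric])
  qed
  then show ?case using Suc by auto
qed

text \<open>The product rule returns a multiple of \<open>f\<close> plus the coordinate times a
  derivative of \<open>f\<close>. The second term is again of the form treated by the induction
  hypothesis; the first loses one order, which \<open>Ck_Suc_imp\<close> allows.\<close>

lemma Ck_coordinate_mult: "Ck k f \<Longrightarrow> Ck k (\<lambda>x. (x \<bullet> b) * f x)"
proof (induction k arbitrary: f)
  case 0
  then show ?case by (auto intro!: continuous_intros)
next
  case (Suc k)
  have der: "((\<lambda>x. (x \<bullet> b) * f x) has_derivative
      (\<lambda>h. (h \<bullet> b) * f x + (x \<bullet> b) * frechet_derivative f (at x) h)) (at x)" for x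
  proof -
    have "(f has_derivative frechet_derivative f (at x)) (at x)"
      using Suc.prems by (simp add: frechet_derivative_works)
    then show ?thesis by (auto intro!: derivative_eq_intros)
  qed
  have "frechet_derivative (\<lambda>x. (x \<bullet> b) * f x) (at x) c
      = (c \<bullet> b) * f x + (x \<bullet> b) * frechet_derivative f (at x) c" for x c
    by (simp add: frechet_derivative_at[OF der, symmetric])
  moreover have "Ck k f" using Suc.prems by (rule Ck_Suc_imp)
  moreover have "(\<lambda>x. (x \<bullet> b) * f x) differentiable (at x)" for x
    using der[of x] unfolding differentiable_def by blast
  ultimately show ?case
    using Suc by (auto intro!: Ck_add Ck_cmult)
qed

lemma compact_closure_subset:
  fixes A B :: "'a::euclidean_space set"
  assumes "A \<subseteq> B" "compact (closure B)"
  shows "compact (closure A)"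
  using assms closure_mono[OF assms(1)] by (meson closed_closure compact_eq_bounded_closed bounded_subset)

lemma zero_test_function: "(\<lambda>x. 0) \<in> test_functions \<Omega>"
  by (simp add: test_functions_def smooth_def Ck_const)

lemma test_function_add:
  assumes "\<phi> \<in> test_functions \<Omega>" "\<psi> \<in> test_functions \<Omega>"
  shows "(\<lambda>x. \<phi> x + \<psi> x) \<in> test_functions \<Omega>"
proof -
  have sub: "{x. \<phi> x + \<psi> x \<noteq> 0} \<subseteq> {x. \<phi> x \<noteq> 0} \<union> {x. \<psi> x \<noteq> 0}" by auto
  have "compact (closure ({x. \<phi> x \<noteq> 0} \<union> {x. \<psi> x \<noteq> 0}))"
    using assms by (auto simp: test_functions_def closure_Un)
  moreover have "closure ({x. \<phi> x \<noteq> 0} \<union> {x. \<psi> x \<noteq> 0}) \<subseteq> \<Omega>"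
    using assms by (auto simp: test_functions_def closure_Un)
  ultimately show ?thesis
    using assms compact_closure_subset[OF sub] closure_mono[OF sub]
    by (auto simp: test_functions_def smooth_def Ck_add)
qed

lemma test_function_mult_support:
  assumes "\<phi> \<in> test_functions \<Omega>" "smooth (\<lambda>x. h x * \<phi> x)"
  shows "(\<lambda>x. h x * \<phi> x) \<in> test_functions \<Omega>"
proof -
  have sub: "{x. h x * \<phi> x \<noteq> 0} \<subseteq> {x. \<phi> x \<noteq> 0}" by auto
  show ?thesis
    using assms compact_closure_subset[OF sub] closure_mono[OF sub]
    by (auto simp: test_functions_def)
qed

lemma test_function_cmult: "\<phi> \<in> test_functions \<Omega> \<Longrightarrow> (\<lambda>x. c * \<phi> x) \<in> test_functions \<Omega>"
  by (intro test_function_mult_support) (auto simp: test_functions_def smooth_def Ck_cmult)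

lemma test_function_coordinate_mult:
  "\<phi> \<in> test_functions \<Omega> \<Longrightarrow> (\<lambda>x. (x \<bullet> b) * \<phi> x) \<in> test_functions \<Omega>"
  by (intro test_function_mult_support) (auto simp: test_functions_def smooth_def Ck_coordinate_mult)

text \<open>The gradient is an explicit argument and \<open>K\<close> may be larger than the
  support. A whole sequence can then share one \<open>K\<close>, and products and differences stay
  in the class with known gradients.\<close>

definition C1_supported :: "'a::euclidean_space set \<Rightarrow> ('a \<Rightarrow> real) \<Rightarrow> ('a \<Rightarrow> 'a) \<Rightarrow> bool" where
  "C1_supported K f G \<longleftrightarrow> compact K \<and> continuous_on UNIV f \<and> continuous_on UNIV G \<and>
     (\<forall>x. (f has_derivative (\<lambda>h. G x \<bullet> h)) (at x)) \<and> (\<forall>x. x \<notin> K \<longrightarrow> f x = 0 \<and> G x = 0)"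

lemma test_function_C1:
  assumes "\<phi> \<in> test_functions \<Omega>"
  shows "\<exists>K\<subseteq>\<Omega>. C1_supported K \<phi> (grad \<phi>)"
proof (intro exI[of _ "closure {x. \<phi> x \<noteq> 0}"] conjI)
  let ?K = "closure {x. \<phi> x \<noteq> 0}"
  have sm: "smooth \<phi>" and K: "compact ?K" and sub: "?K \<subseteq> \<Omega>"
    using assms by (auto simp: test_functions_def)
  show "?K \<subseteq> \<Omega>" by (rule sub)
  have "Ck 0 \<phi>" "Ck (Suc 0) \<phi>" using sm unfolding smooth_def by blast+
  then have c: "continuous_on UNIV \<phi>" and d: "\<And>x. \<phi> differentiable (at x)"
    and g: "\<And>b. b \<in> Basis \<Longrightarrow> continuous_on UNIV (\<lambda>x. frechet_derivative \<phi> (at x) b)" by auto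
  have "grad \<phi> x = 0" if "x \<notin> ?K" for x
  proof (rule grad_eqI)
    have "((\<lambda>x. 0) has_derivative (\<lambda>h. 0 \<bullet> h)) (at x)" by simp
    then show "(\<phi> has_derivative (\<lambda>h. 0 \<bullet> h)) (at x)"
      by (rule has_derivative_transform_within_open[of _ _ _ _ "- ?K"])
        (use that closure_subset[of "{x. \<phi> x \<noteq> 0}"] in auto)
  qed
  then show "C1_supported ?K \<phi> (grad \<phi>)"
    unfolding C1_supported_def using K c grad_has_derivative[OF d] closure_subset[of "{x. \<phi> x \<noteq> 0}"]
    by (auto simp: grad_def[abs_def] intro!: continuous_intros g)
qed

lemma C1_supported_integrable:
  assumes "C1_supported K f G" "continuous_on UNIV h" "\<And>x. x \<notin> K \<Longrightarrow> h x = 0"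
  shows "integrable lborel (h :: 'a::euclidean_space \<Rightarrow> 'b::euclidean_space)"
proof -
  have "integrable lborel (\<lambda>x. indicator K x *\<^sub>R h x)"
    using assms by (intro borel_integrable_compact) (auto simp: C1_supported_def intro: continuous_on_subset)
  also have "(\<lambda>x. indicator K x *\<^sub>R h x) = h" using assms(3) by (auto simp: indicator_def)
  finally show ?thesis .
qed

lemma C1_supported_bounded_gradient:
  assumes "C1_supported K f G"
  obtains L where "L \<ge> 0" "\<And>x. norm (G x) \<le> L"
proof -
  have "compact (G ` K)"
    using assms by (auto simp: C1_supported_def intro!: compact_continuous_image intro: continuous_on_subset)
  then obtain L where "\<And>x. x \<in> K \<Longrightarrow> norm (G x) \<le> L"
    using compact_imp_bounded bounded_iff by (metis imageI)
  then have "norm (G x) \<le> max L 0" for x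
    using assms by (cases "x \<in> K") (auto simp: C1_supported_def le_max_iff_disj)
  then show ?thesis by (intro that[of "max L 0"]) auto
qed

text \<open>Difference quotients have mean zero by translation invariance.\<close>
lemma integral_directional_derivative_eq_0:
  assumes f: "C1_supported K f G"
  shows "(\<integral>x. G x \<bullet> b \<partial>lborel) = 0"
proof -
  define t :: "nat \<Rightarrow> real" where "t n = 1 / real (Suc n)" for n
  have t: "t n > 0" "t n \<le> 1" for n by (auto simp: t_def)
  have t0: "t \<longlonglongrightarrow> 0" unfolding t_def by (rule LIMSEQ_Suc[OF lim_1_over_n])
  obtain L where L: "L \<ge> 0" "\<And>x. norm (G x) \<le> L" using C1_supported_bounded_gradient[OF f] by blast
  have cont: "continuous_on UNIV f" and der: "\<And>x. (f has_derivative (\<lambda>h. G x \<bullet> h)) (at x)"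
    and supp: "\<And>x. x \<notin> K \<Longrightarrow> f x = 0" using f by (auto simp: C1_supported_def)
  have int: "integrable lborel f" using C1_supported_integrable[OF f cont supp] .
  have contG: "continuous_on UNIV G" using f by (simp add: C1_supported_def)
  have [measurable]: "f \<in> borel_measurable borel" "G \<in> borel_measurable borel"
    using cont contG by (auto intro: borel_measurable_continuous_onI)
  obtain \<rho> where \<rho>: "K \<subseteq> cball 0 \<rho>"
    using bounded_subset_ballD[of K 0] f compact_imp_bounded[of K] ball_subset_cball
    unfolding C1_supported_def by (metis order_trans)
  define s where "s n x = (f (x + t n *\<^sub>R b) - f x) / t n" for n x
  have "(\<lambda>n. \<integral>x. s n x \<partial>lborel) \<longlonglongrightarrow> (\<integral>x. G x \<bullet> b \<partial>lborel)"
  proof (rule integral_dominated_convergence)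
    show "(\<lambda>x. G x \<bullet> b) \<in> borel_measurable lborel" by measurable
    show "s n \<in> borel_measurable lborel" for n unfolding s_def by measurable
    \<comment> \<open>The Lipschitz constant bounds the quotients by \<open>L * norm b\<close>, and
      since \<open>t n \<le> 1\<close> their supports stay within distance \<open>norm b\<close> of
      \<open>K\<close>.\<close>
    show "integrable lborel (\<lambda>x. indicator (cball 0 (\<rho> + norm b)) x *\<^sub>R (L * norm b))"
      by (intro borel_integrable_compact) auto
    show "AE x in lborel. (\<lambda>n. s n x) \<longlonglongrightarrow> G x \<bullet> b"
    proof (rule AE_I2)
      fix x
      have "((\<lambda>r. f (x + r *\<^sub>R b)) has_derivative (\<lambda>r. G (x + 0 *\<^sub>R b) \<bullet> (r *\<^sub>R b))) (at 0)"
        by (rule has_derivative_compose[OF _ der]) (auto intro!: derivative_eq_intros)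
      then have "((\<lambda>r. f (x + r *\<^sub>R b)) has_real_derivative G x \<bullet> b) (at 0)"
        by (rule has_derivative_imp_has_field_derivative) simp
      then have "((\<lambda>r. (f (x + r *\<^sub>R b) - f x) / r) \<longlongrightarrow> G x \<bullet> b) (at 0)"
        by (simp add: DERIV_def)
      moreover have "filterlim t (at 0) sequentially"
      proof -
        have "t n \<noteq> 0" for n using t(1)[of n] by simp
        then show ?thesis using t0 by (simp add: filterlim_at)
      qed
      ultimately show "(\<lambda>n. s n x) \<longlonglongrightarrow> G x \<bullet> b"
        unfolding s_def by (rule filterlim_compose)
    qed
    show "AE x in lborel. norm (s n x) \<le> indicator (cball 0 (\<rho> + norm b)) x *\<^sub>R (L * norm b)" for n
    proof (rule AE_I2)
      fix x
      have lip: "norm (f (x + t n *\<^sub>R b) - f x) \<le> L * norm (x + t n *\<^sub>R b - x)"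
      proof (rule differentiable_bound[where S = UNIV and f' = "\<lambda>x h. G x \<bullet> h"])
        show "onorm (\<lambda>h. G x \<bullet> h) \<le> L" for x
        proof (rule onorm_le)
          fix h show "norm (G x \<bullet> h) \<le> L * norm h"
            using Cauchy_Schwarz_ineq2[of "G x" h] mult_right_mono[OF L(2)[of x] norm_ge_zero[of h]]
            by simp
        qed
      qed (use der in auto)
      show "norm (s n x) \<le> indicator (cball 0 (\<rho> + norm b)) x *\<^sub>R (L * norm b)"
      proof (cases "x \<in> cball 0 (\<rho> + norm b)")
        case True
        then show ?thesis using lip t[of n] by (simp add: s_def field_simps)
      next
        case False
        have "norm x \<le> norm (x + t n *\<^sub>R b) + norm b"
        proof -
          have "norm x \<le> norm (x + t n *\<^sub>R b) + norm (t n *\<^sub>R b)"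
            using norm_triangle_ineq4[of "x + t n *\<^sub>R b" "t n *\<^sub>R b"] by simp
          also have "norm (t n *\<^sub>R b) \<le> norm b" using t[of n] by (simp add: mult_left_le_one_le)
          finally show ?thesis by simp
        qed
        then have "\<not> norm (x + t n *\<^sub>R b) \<le> \<rho>" "\<not> norm x \<le> \<rho>"
          using False norm_ge_zero[of b] unfolding mem_cball_0 by linarith+
        then have "x + t n *\<^sub>R b \<notin> K" "x \<notin> K" using \<rho> by (auto simp: subset_iff)
        then show ?thesis using L(1) by (simp add: s_def supp)
      qed
    qed
  qed
  moreover have "(\<integral>x. s n x \<partial>lborel) = 0" for n
  proof -
    have "(\<integral>x. f (x + t n *\<^sub>R b) \<partial>lborel) = (\<integral>x. f x \<partial>lborel)"
      by (subst (2) lborel_distr_plus[of "t n *\<^sub>R b", symmetric])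
        (simp add: integral_distr add.commute)
    moreover have "integrable lborel (\<lambda>x. f (x + t n *\<^sub>R b))"
    proof -
      have "integrable (distr lborel borel ((+) (t n *\<^sub>R b))) f"
        by (simp add: lborel_distr_plus int)
      then show ?thesis by (subst (asm) integrable_distr_eq) (auto simp: add.commute)
    qed
    ultimately show ?thesis using int by (simp add: s_def)
  qed
  ultimately show ?thesis by (simp add: LIMSEQ_const_iff)
qed

lemma C1_supported_mult:
  assumes f: "C1_supported K f F" and g: "C1_supported L g G"
  shows "C1_supported K (\<lambda>x. f x * g x) (\<lambda>x. f x *\<^sub>R G x + g x *\<^sub>R F x)"
  unfolding C1_supported_def
proof (intro conjI allI impI)
  show "((\<lambda>x. f x * g x) has_derivative (\<lambda>h. (f x *\<^sub>R G x + g x *\<^sub>R F x) \<bullet> h)) (at x)" for x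
  proof -
    have "(f has_derivative (\<lambda>h. F x \<bullet> h)) (at x)" "(g has_derivative (\<lambda>h. G x \<bullet> h)) (at x)"
      using f g by (auto simp: C1_supported_def)
    from has_derivative_mult[OF this] show ?thesis
      by (simp add: inner_add_left mult.commute)
  qed
qed (use f g in \<open>auto simp: C1_supported_def intro!: continuous_intros\<close>)

lemma integral_by_parts_C1_supported:
  assumes f: "C1_supported K f F" and g: "C1_supported L g G"
  shows "(\<integral>x. f x * (G x \<bullet> b) \<partial>lborel) = - (\<integral>x. (F x \<bullet> b) * g x \<partial>lborel)"
proof -
  have "(\<integral>x. (f x *\<^sub>R G x + g x *\<^sub>R F x) \<bullet> b \<partial>lborel) = 0"
    by (rule integral_directional_derivative_eq_0[OF C1_supported_mult[OF f g]])
  moreover have "integrable lborel (\<lambda>x. f x * (G x \<bullet> b))" "integrable lborel (\<lambda>x. (F x \<bullet> b) * g x)"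
    by (rule C1_supported_integrable[OF f]; use f g in \<open>auto simp: C1_supported_def intro!: continuous_intros\<close>)+
  ultimately show ?thesis by (simp add: inner_add_left mult.commute[of "g _"])
qed

text \<open>A bridge: the definitions integrate over \<open>lebesgue_on \<Omega>\<close>, whereas
  translations and Tonelli's theorem act on the whole space with \<open>lborel\<close>.\<close>

lemma lebesgue_on_eq_lborel:
  fixes f :: "'a::euclidean_space \<Rightarrow> 'b::euclidean_space"
  assumes "f \<in> borel_measurable borel" "\<And>x. x \<notin> \<Omega> \<Longrightarrow> f x = 0" "\<Omega> \<in> sets lebesgue"
  shows "integral\<^sup>L (lebesgue_on \<Omega>) f = integral\<^sup>L lborel f"
    and "integrable (lebesgue_on \<Omega>) f \<longleftrightarrow> integrable lborel f"
proof -
  have e: "(\<lambda>x. indicator \<Omega> x *\<^sub>R f x) = f" using assms(2) by (auto simp: indicator_def)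
  show "integral\<^sup>L (lebesgue_on \<Omega>) f = integral\<^sup>L lborel f"
    using assms by (subst integral_restrict_space) (auto simp: e integral_completion)
  show "integrable (lebesgue_on \<Omega>) f \<longleftrightarrow> integrable lborel f"
    using assms by (subst integrable_restrict_space) (auto simp: e integrable_completion)
qed

section \<open>Rellich's theorem\<close>

lemma norm_diff_sq_le:
  fixes a b :: "'b::real_normed_vector"
  shows "(norm (a - b))\<^sup>2 \<le> 2 * (norm a)\<^sup>2 + 2 * (norm b)\<^sup>2"
proof -
  have "(norm (a - b))\<^sup>2 \<le> (norm a + norm b)\<^sup>2"
    by (intro power_mono norm_triangle_ineq4) simp
  also have "\<dots> \<le> 2 * (norm a)\<^sup>2 + 2 * (norm b)\<^sup>2"
    using sum_squares_bound[of "norm a" "norm b"] by (simp add: power2_sum)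
  finally show ?thesis .
qed

section \<open>Translation estimates and ball averages\<close>

lemma nn_integral_lborel_translate:
  fixes h :: "'a::euclidean_space"
  assumes [measurable]: "f \<in> borel_measurable borel"
  shows "(\<integral>\<^sup>+x. f (x + h) \<partial>lborel) = (\<integral>\<^sup>+x. f x \<partial>lborel)"
  by (subst (2) lborel_distr_plus[of h, symmetric]) (simp add: nn_integral_distr add.commute)

text \<open>Nonnegativity of the variance: \<open>g\<close> minus its mean \<open>c\<close> has a
  nonnegative mean square over \<open>B\<close>. The result is stated in \<open>ennreal\<close> so
  that it can be fed into iterated integrals directly.\<close>

lemma Jensen_lborel:
  fixes g :: "'a::euclidean_space \<Rightarrow> real"
  assumes B: "compact B" "measure lborel B > 0" and g: "continuous_on UNIV g"
  shows "ennreal (((\<integral>y. indicator B y * g y \<partial>lborel) / measure lborel B)\<^sup>2)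
     \<le> ennreal (1 / measure lborel B) * (\<integral>\<^sup>+y. indicator B y * ennreal ((g y)\<^sup>2) \<partial>lborel)"
proof -
  define \<mu> where "\<mu> = measure lborel B"
  define c where "c = (\<integral>y. indicator B y * g y \<partial>lborel) / \<mu>"
  define q where "q = (\<integral>y. indicator B y * (g y)\<^sup>2 \<partial>lborel)"
  have \<mu>: "\<mu> > 0" using B by (simp add: \<mu>_def)
  have int: "integrable lborel (\<lambda>y. indicator B y * h y)" if "continuous_on UNIV h" for h :: "'a \<Rightarrow> real"
    using borel_integrable_compact[OF B(1), of h] that continuous_on_subset by fastforce
  have "0 \<le> (\<integral>y. indicator B y * (g y - c)\<^sup>2 \<partial>lborel)"
    by (intro integral_nonneg_AE AE_I2) auto
  also have "(\<lambda>y. indicator B y * (g y - c)\<^sup>2) =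
      (\<lambda>y. indicator B y * (g y)\<^sup>2 - 2 * c * (indicator B y * g y) + c\<^sup>2 * (indicator B y * 1))"
    by (auto simp: fun_eq_iff power2_eq_square algebra_simps)
  also have "(\<integral>y. \<dots> y \<partial>lborel) = q - 2 * c * (c * \<mu>) + c\<^sup>2 * \<mu>"
  proof -
    have "(\<integral>y. indicator B y * g y \<partial>lborel) = c * \<mu>" using \<mu> by (simp add: c_def)
    moreover have "(\<integral>y. indicator B y * (1::real) \<partial>lborel) = \<mu>"
      using B by (simp add: \<mu>_def)
    moreover have "integrable lborel (\<lambda>y. indicator B y * (g y)\<^sup>2)"
      "integrable lborel (\<lambda>y. indicator B y * g y)" "integrable lborel (\<lambda>y. indicator B y * (1::real))"
      by (rule int, intro continuous_intros g)+
    ultimately show ?thesis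
      unfolding q_def by (simp del: mult_1_right)
  qed
  finally have "c\<^sup>2 \<le> 1 / \<mu> * q" using \<mu> by (simp add: field_simps power2_eq_square)
  then have "ennreal (c\<^sup>2) \<le> ennreal (1 / \<mu> * q)" by (rule ennreal_leI)
  also have "\<dots> = ennreal (1 / \<mu>) * ennreal q" by (rule ennreal_mult') (use \<mu> in simp)
  also have "ennreal q = (\<integral>\<^sup>+y. ennreal (indicator B y * (g y)\<^sup>2) \<partial>lborel)"
    unfolding q_def by (intro nn_integral_eq_integral[symmetric] int AE_I2 continuous_intros g) auto
  also have "(\<lambda>y. ennreal (indicator B y * (g y)\<^sup>2)) = (\<lambda>y. indicator B y * ennreal ((g y)\<^sup>2))"
    by (auto simp: fun_eq_iff indicator_def)
  finally show ?thesis by (simp add: c_def \<mu>_def)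
qed

abbreviation nn_energy :: "('a::euclidean_space \<Rightarrow> 'a) \<Rightarrow> ennreal" where
  "nn_energy G \<equiv> \<integral>\<^sup>+x. ennreal ((norm (G x))\<^sup>2) \<partial>lborel"

text \<open>The increment is the integral of \<open>G (x + t *\<^sub>R h) \<bullet> h\<close> over
  \<open>t\<close> from 0 to 1. Its square is at most the integral of the squares; exchanging the
  integrals and translating each slice back leaves the energy.\<close>

lemma C1_translation_estimate:
  fixes f :: "'a::euclidean_space \<Rightarrow> real"
  assumes f: "C1_supported K f G"
  shows "(\<integral>\<^sup>+x. ennreal ((f (x + h) - f x)\<^sup>2) \<partial>lborel)
     \<le> ennreal ((norm h)\<^sup>2) * nn_energy G"
proof -
  have der: "\<And>x. (f has_derivative (\<lambda>h. G x \<bullet> h)) (at x)" and contG: "continuous_on UNIV G"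
    using f by (auto simp: C1_supported_def)
  have mG[measurable]: "G \<in> borel_measurable borel"
    using contG by (auto intro: borel_measurable_continuous_onI)
  let ?F = "\<lambda>x t. (norm h)\<^sup>2 * (norm (G (x + t *\<^sub>R h)))\<^sup>2"
  have "ennreal ((f (x + h) - f x)\<^sup>2) \<le> (\<integral>\<^sup>+t. ennreal (indicator {0..1} t * ?F x t) \<partial>lborel)" for x
  proof -
    define g where "g t = G (x + t *\<^sub>R h) \<bullet> h" for t :: real
    define c where "c = f (x + h) - f x"
    have contGt: "continuous_on A (\<lambda>t. G (x + t *\<^sub>R h))" for A :: "real set"
      by (rule continuous_on_compose2[OF contG]) (auto intro!: continuous_intros)
    have cg: "continuous_on {0..1} g" unfolding g_def by (intro continuous_intros contGt)
    have "(g has_integral f (x + 1 *\<^sub>R h) - f (x + 0 *\<^sub>R h)) {0..1}"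
    proof (rule fundamental_theorem_of_calculus)
      fix t :: real
      have "((\<lambda>t. f (x + t *\<^sub>R h)) has_derivative (\<lambda>r. G (x + t *\<^sub>R h) \<bullet> (r *\<^sub>R h))) (at t within {0..1})"
        by (rule has_derivative_compose[OF _ der]) (auto intro!: derivative_eq_intros)
      then show "((\<lambda>t. f (x + t *\<^sub>R h)) has_vector_derivative g t) (at t within {0..1})"
        by (simp add: has_vector_derivative_def g_def)
    qed simp
    then have Ig: "(g has_integral c) {0..1}" by (simp add: c_def)
    obtain q where q: "((\<lambda>t. (g t)\<^sup>2) has_integral q) {0..1}"
    proof -
      have "(\<lambda>t. (g t)\<^sup>2) integrable_on {0..1}"
        by (intro integrable_continuous_real continuous_intros cg)
      then show ?thesis using that by (auto simp: integrable_on_def)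
    qed
    obtain J where J: "(?F x has_integral J) {0..1}"
    proof -
      have "?F x integrable_on {0..1}"
        by (intro integrable_continuous_real continuous_intros contGt)
      then show ?thesis using that by (auto simp: integrable_on_def)
    qed
    \<comment> \<open>The integrand is the square of \<open>g t - c\<close>, with \<open>c\<close>
      the mean of \<open>g\<close> on the unit interval; its nonnegative integral is
      \<open>q\<close> minus the square of \<open>c\<close>.\<close>
    have "((\<lambda>t. (g t)\<^sup>2 - 2 * c * g t + c\<^sup>2) has_integral q - 2 * c * c + (1 - 0) *\<^sub>R c\<^sup>2) {0..1}"
      by (intro has_integral_add has_integral_diff has_integral_mult_right q Ig has_integral_const_real)
        (use has_integral_const_real[of "c\<^sup>2" 0 1] in simp)
    then have "0 \<le> q - 2 * c * c + (1 - 0) *\<^sub>R c\<^sup>2"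
    proof (rule has_integral_nonneg)
      fix t
      have "(g t)\<^sup>2 - 2 * c * g t + c\<^sup>2 = (g t - c)\<^sup>2" by (simp add: power2_eq_square algebra_simps)
      then show "0 \<le> (g t)\<^sup>2 - 2 * c * g t + c\<^sup>2" by simp
    qed
    then have "c\<^sup>2 \<le> q" by (simp add: power2_eq_square)
    also have "q \<le> J"
    proof (rule has_integral_le[OF q J])
      fix t :: real
      have "\<bar>g t\<bar> \<le> norm (G (x + t *\<^sub>R h)) * norm h"
        unfolding g_def by (rule Cauchy_Schwarz_ineq2)
      then have "(g t)\<^sup>2 \<le> (norm (G (x + t *\<^sub>R h)) * norm h)\<^sup>2"
        by (metis abs_ge_zero power2_abs power_mono)
      then show "(g t)\<^sup>2 \<le> ?F x t" by (simp add: power_mult_distrib mult.commute)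
    qed
    finally have "ennreal (c\<^sup>2) \<le> ennreal J" by (rule ennreal_leI)
    also have "ennreal J = (\<integral>\<^sup>+t. ennreal (indicator {0..1} t * ?F x t) \<partial>lborel)"
      by (rule nn_integral_has_integral_lebesgue[symmetric, OF _ J]) auto
    finally show ?thesis by (simp add: c_def)
  qed
  then have "(\<integral>\<^sup>+x. ennreal ((f (x + h) - f x)\<^sup>2) \<partial>lborel)
      \<le> (\<integral>\<^sup>+x. \<integral>\<^sup>+t. ennreal (indicator {0..1} t * ?F x t) \<partial>lborel \<partial>lborel)"
    by (intro nn_integral_mono)
  also have "\<dots> = (\<integral>\<^sup>+t. \<integral>\<^sup>+x. ennreal (indicator {0..1} t * ?F x t) \<partial>lborel \<partial>lborel)"
    by (rule lborel_pair.Fubini'[symmetric]) measurable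
  also have "\<dots> = (\<integral>\<^sup>+t. indicator {0..1} t * (ennreal ((norm h)\<^sup>2) * nn_energy G) \<partial>(lborel :: real measure))"
  proof (rule nn_integral_cong)
    fix t :: real
    have "(\<integral>\<^sup>+x. ennreal (indicator {0..1} t * ?F x t) \<partial>lborel)
        = (\<integral>\<^sup>+x. (indicator {0..1} t * ennreal ((norm h)\<^sup>2)) * ennreal ((norm (G (x + t *\<^sub>R h)))\<^sup>2) \<partial>lborel)"
      by (intro nn_integral_cong) (auto simp: indicator_def ennreal_mult')
    also have "\<dots> = (indicator {0..1} t * ennreal ((norm h)\<^sup>2)) * (\<integral>\<^sup>+x. ennreal ((norm (G (x + t *\<^sub>R h)))\<^sup>2) \<partial>lborel)"
      by (rule nn_integral_cmult) measurable
    also have "(\<integral>\<^sup>+x. ennreal ((norm (G (x + t *\<^sub>R h)))\<^sup>2) \<partial>lborel) = nn_energy G"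
      by (rule nn_integral_lborel_translate) measurable
    finally show "(\<integral>\<^sup>+x. ennreal (indicator {0..1} t * ?F x t) \<partial>lborel)
        = indicator {0..1} t * (ennreal ((norm h)\<^sup>2) * nn_energy G)"
      by (simp add: mult_ac)
  qed
  also have "\<dots> = ennreal ((norm h)\<^sup>2) * nn_energy G"
    by (subst nn_integral_multc) auto
  finally show ?thesis .
qed

lemma borel_measurable_translate_pair:
  fixes f :: "'a::euclidean_space \<Rightarrow> real"
  assumes [measurable]: "f \<in> borel_measurable borel" and M: "sets M = sets borel" "sets N = sets borel"
  shows "(\<lambda>p. f (fst p + snd p)) \<in> borel_measurable (M \<Otimes>\<^sub>M N)" (is ?A)
    and "(\<lambda>p. f (fst p)) \<in> borel_measurable (M \<Otimes>\<^sub>M N)" (is ?B)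
    and "(\<lambda>p. indicator (cball 0 s) (snd p :: 'a) :: real) \<in> borel_measurable (M \<Otimes>\<^sub>M N)" (is ?C)
    and "(\<lambda>p. indicator (cball 0 s) (snd p :: 'a) :: ennreal) \<in> borel_measurable (M \<Otimes>\<^sub>M N)" (is ?D)
proof -
  have [measurable]: "cball (0::'a) s \<in> sets borel" by simp
  show ?A ?B ?C ?D
    unfolding measurable_cong_sets[OF sets_pair_measure_cong[OF M] refl] by measurable
qed

text \<open>Convolution with the normalized indicator of a ball. This is regular enough to serve as
  a mollifier here: the averages are bounded by the mass and Lipschitz by the energy.\<close>

definition ball_avg :: "real \<Rightarrow> ('a::euclidean_space \<Rightarrow> real) \<Rightarrow> 'a \<Rightarrow> real" where
  "ball_avg s f x = (\<integral>y. indicator (cball 0 s) y * f (x + y) \<partial>lborel) / measure lborel (cball (0::'a) s)"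

lemma measure_cball_pos: "s > 0 \<Longrightarrow> measure lborel (cball (x::'a::euclidean_space) s) > 0"
  using content_cball_pos[of s x] by simp

lemma integrable_cball_translate:
  fixes f :: "'a::euclidean_space \<Rightarrow> real"
  assumes "continuous_on UNIV f"
  shows "integrable lborel (\<lambda>y. indicator (cball 0 s) y * f (x + y))"
proof -
  have "continuous_on (cball 0 s) (\<lambda>y. f (x + y))"
    by (rule continuous_on_compose2[OF assms]) (auto intro!: continuous_intros)
  from borel_integrable_compact[OF compact_cball this] show ?thesis by simp
qed

lemma ball_avg_diff:
  fixes f g :: "'a::euclidean_space \<Rightarrow> real"
  assumes "continuous_on UNIV f" "continuous_on UNIV g"
  shows "ball_avg s (\<lambda>x. f x - g x) x = ball_avg s f x - ball_avg s g x"
  using integrable_cball_translate[OF assms(1), of s x] integrable_cball_translate[OF assms(2), of s x]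
  by (simp add: ball_avg_def right_diff_distrib diff_divide_distrib)

text \<open>Jensen's inequality over the ball reduces each claim to an integral of squares. The
  first then uses the translation estimate for shifts of length at most \<open>s\<close>, the second
  drops the ball, and the third uses the translation estimate for the shift
  \<open>x - y\<close>.\<close>

lemma ball_avg_estimates:
  fixes f :: "'a::euclidean_space \<Rightarrow> real"
  assumes f: "C1_supported K f G" and s: "s > 0"
  defines "\<mu> \<equiv> measure lborel (cball (0::'a) s)"
    and "E \<equiv> nn_energy G"
  shows "(\<integral>\<^sup>+x. ennreal ((ball_avg s f x - f x)\<^sup>2) \<partial>lborel) \<le> ennreal (s\<^sup>2) * E"
    and "ennreal ((ball_avg s f x)\<^sup>2) \<le> ennreal (1 / \<mu>) * (\<integral>\<^sup>+x. ennreal ((f x)\<^sup>2) \<partial>lborel)"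
    and "ennreal ((ball_avg s f x - ball_avg s f y)\<^sup>2) \<le> ennreal (1 / \<mu>) * (ennreal ((norm (x - y))\<^sup>2) * E)"
proof -
  have \<mu>: "\<mu> > 0" using s by (simp add: \<mu>_def measure_cball_pos)
  have cont: "continuous_on UNIV f" using f by (simp add: C1_supported_def)
  have mf[measurable]: "f \<in> borel_measurable borel"
    using cont by (auto intro: borel_measurable_continuous_onI)
  have [measurable]: "cball (0::'a) s \<in> sets borel" by simp
  note mp[measurable] = borel_measurable_translate_pair[OF mf, of lborel lborel, OF sets_lborel sets_lborel]
  have mjoint[measurable]: "(\<lambda>p. indicator (cball 0 s) (snd p) * ennreal ((f (fst p + snd p) - f (fst p))\<^sup>2))
      \<in> borel_measurable (lborel \<Otimes>\<^sub>M lborel)"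
    by (intro borel_measurable_times_ennreal mp measurable_compose[OF _ measurable_ennreal] borel_measurable_power borel_measurable_diff)
  have ct: "continuous_on UNIV (\<lambda>y. f (x + y))" for x
    by (rule continuous_on_compose2[OF cont]) (auto intro!: continuous_intros)
  have Jen: "ennreal (((\<integral>y. indicator (cball 0 s) y * g y \<partial>lborel) / \<mu>)\<^sup>2)
     \<le> ennreal (1 / \<mu>) * (\<integral>\<^sup>+y. indicator (cball 0 s) y * ennreal ((g y)\<^sup>2) \<partial>lborel)"
    if "continuous_on UNIV g" for g :: "'a \<Rightarrow> real"
    using Jensen_lborel[OF compact_cball _ that, of 0 s] \<mu> by (simp add: \<mu>_def)
  have const: "(\<integral>y. indicator (cball (0::'a) s) y * c \<partial>lborel) = \<mu> * c" for c :: real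
    by (simp add: \<mu>_def)
  have "ball_avg s f x - f x = (\<integral>y. indicator (cball 0 s) y * (f (x + y) - f x) \<partial>lborel) / \<mu>" for x
  proof -
    have "(\<integral>y. indicator (cball 0 s) y * (f (x + y) - f x) \<partial>lborel)
        = (\<integral>y. indicator (cball 0 s) y * f (x + y) \<partial>lborel) - \<mu> * f x"
      unfolding right_diff_distrib
      using integrable_cball_translate[OF cont, of s x] integrable_cball_translate[of "\<lambda>_. f x" s 0] const[of "f x"]
      by (subst Bochner_Integration.integral_diff) auto
    then show ?thesis using \<mu> by (simp add: ball_avg_def \<mu>_def[symmetric] diff_divide_distrib)
  qed
  then have "ennreal ((ball_avg s f x - f x)\<^sup>2) \<le>
      ennreal (1 / \<mu>) * (\<integral>\<^sup>+y. indicator (cball 0 s) y * ennreal ((f (x + y) - f x)\<^sup>2) \<partial>lborel)" for x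
    using Jen[of "\<lambda>y. f (x + y) - f x"] ct by (simp add: continuous_on_diff)
  then have "(\<integral>\<^sup>+x. ennreal ((ball_avg s f x - f x)\<^sup>2) \<partial>lborel) \<le>
      (\<integral>\<^sup>+x. ennreal (1 / \<mu>) * (\<integral>\<^sup>+y. indicator (cball 0 s) y * ennreal ((f (x + y) - f x)\<^sup>2) \<partial>lborel) \<partial>lborel)"
    by (intro nn_integral_mono)
  also have "\<dots> = ennreal (1 / \<mu>) *
      (\<integral>\<^sup>+x. \<integral>\<^sup>+y. indicator (cball 0 s) y * ennreal ((f (x + y) - f x)\<^sup>2) \<partial>lborel \<partial>lborel)"
    by (intro nn_integral_cmult lborel.borel_measurable_nn_integral) (use mjoint in \<open>simp add: case_prod_beta'\<close>)
  also have "(\<integral>\<^sup>+x. \<integral>\<^sup>+y. indicator (cball 0 s) y * ennreal ((f (x + y) - f x)\<^sup>2) \<partial>lborel \<partial>lborel)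
      = (\<integral>\<^sup>+y. \<integral>\<^sup>+x. indicator (cball 0 s) y * ennreal ((f (x + y) - f x)\<^sup>2) \<partial>lborel \<partial>lborel)"
    by (rule lborel_pair.Fubini'[symmetric]) (use mjoint in \<open>simp add: case_prod_beta'\<close>)
  also have "\<dots> \<le> (\<integral>\<^sup>+y. indicator (cball 0 s) y * (ennreal (s\<^sup>2) * E) \<partial>(lborel :: 'a measure))"
  proof (rule nn_integral_mono)
    fix y
    have "(\<integral>\<^sup>+x. indicator (cball 0 s) y * ennreal ((f (x + y) - f x)\<^sup>2) \<partial>lborel) =
        indicator (cball 0 s) y * (\<integral>\<^sup>+x. ennreal ((f (x + y) - f x)\<^sup>2) \<partial>lborel)"
      by (rule nn_integral_cmult) measurable
    also have "\<dots> \<le> indicator (cball 0 s) y * (ennreal (s\<^sup>2) * E)"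
    proof (cases "y \<in> cball 0 s")
      case True
      have "(\<integral>\<^sup>+x. ennreal ((f (x + y) - f x)\<^sup>2) \<partial>lborel) \<le> ennreal ((norm y)\<^sup>2) * E"
        unfolding E_def by (rule C1_translation_estimate[OF f])
      also have "\<dots> \<le> ennreal (s\<^sup>2) * E"
        using True by (intro mult_right_mono ennreal_leI power_mono) auto
      finally show ?thesis by (intro mult_left_mono) auto
    qed auto
    finally show "(\<integral>\<^sup>+x. indicator (cball 0 s) y * ennreal ((f (x + y) - f x)\<^sup>2) \<partial>lborel) \<le>
        indicator (cball 0 s) y * (ennreal (s\<^sup>2) * E)" .
  qed
  also have "\<dots> = emeasure lborel (cball (0::'a) s) * (ennreal (s\<^sup>2) * E)"
    by (subst nn_integral_multc) auto
  also have "emeasure lborel (cball (0::'a) s) = ennreal \<mu>"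
    unfolding \<mu>_def by (rule emeasure_eq_ennreal_measure) (use emeasure_lborel_cball_finite in \<open>auto simp: less_top\<close>)
  also have "ennreal (1 / \<mu>) * (ennreal \<mu> * (ennreal (s\<^sup>2) * E)) = ennreal (s\<^sup>2) * E"
  proof -
    have "ennreal (1 / \<mu>) * ennreal \<mu> = 1" using \<mu> by (simp add: ennreal_mult'[symmetric])
    then show ?thesis by (simp add: mult.assoc[symmetric])
  qed
  finally show "(\<integral>\<^sup>+x. ennreal ((ball_avg s f x - f x)\<^sup>2) \<partial>lborel) \<le> ennreal (s\<^sup>2) * E"
    by (simp add: mult_left_mono)

  have drop_indicator: "(\<integral>\<^sup>+y. indicator (cball 0 s) y * g y \<partial>lborel) \<le> (\<integral>\<^sup>+y. g y \<partial>lborel)"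
    for g :: "'a \<Rightarrow> ennreal"
    by (intro nn_integral_mono) (auto simp: indicator_def)
  have "ennreal ((ball_avg s f x)\<^sup>2) \<le>
      ennreal (1 / \<mu>) * (\<integral>\<^sup>+y. indicator (cball 0 s) y * ennreal ((f (x + y))\<^sup>2) \<partial>lborel)"
    using Jen[OF ct[of x]] by (simp add: ball_avg_def \<mu>_def[symmetric])
  also have "\<dots> \<le> ennreal (1 / \<mu>) * (\<integral>\<^sup>+y. ennreal ((f (y + x))\<^sup>2) \<partial>lborel)"
    unfolding add.commute[of x] by (intro mult_left_mono drop_indicator) auto
  also have "(\<integral>\<^sup>+y. ennreal ((f (y + x))\<^sup>2) \<partial>lborel) = (\<integral>\<^sup>+x. ennreal ((f x)\<^sup>2) \<partial>lborel)"
    by (rule nn_integral_lborel_translate) measurable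
  finally show "ennreal ((ball_avg s f x)\<^sup>2) \<le> ennreal (1 / \<mu>) * (\<integral>\<^sup>+x. ennreal ((f x)\<^sup>2) \<partial>lborel)" .

  have "ball_avg s f x - ball_avg s f y =
      (\<integral>z. indicator (cball 0 s) z * (f (x + z) - f (y + z)) \<partial>lborel) / \<mu>"
    using integrable_cball_translate[OF cont, of s x] integrable_cball_translate[OF cont, of s y]
    by (simp add: ball_avg_def right_diff_distrib diff_divide_distrib \<mu>_def)
  then have "ennreal ((ball_avg s f x - ball_avg s f y)\<^sup>2) \<le>
      ennreal (1 / \<mu>) * (\<integral>\<^sup>+z. indicator (cball 0 s) z * ennreal ((f (x + z) - f (y + z))\<^sup>2) \<partial>lborel)"
    using Jen[of "\<lambda>z. f (x + z) - f (y + z)"] ct by (simp add: continuous_on_diff)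
  also have "\<dots> \<le> ennreal (1 / \<mu>) * (\<integral>\<^sup>+z. ennreal ((f (x + z) - f (y + z))\<^sup>2) \<partial>lborel)"
    by (intro mult_left_mono drop_indicator) auto
  also have "(\<integral>\<^sup>+z. ennreal ((f (x + z) - f (y + z))\<^sup>2) \<partial>lborel)
      = (\<integral>\<^sup>+z. ennreal ((f ((z + y) + (x - y)) - f (z + y))\<^sup>2) \<partial>lborel)"
    by (simp add: algebra_simps)
  also have "\<dots> = (\<integral>\<^sup>+z. ennreal ((f (z + (x - y)) - f z)\<^sup>2) \<partial>lborel)"
    by (rule nn_integral_lborel_translate) measurable
  also have "ennreal (1 / \<mu>) * \<dots> \<le> ennreal (1 / \<mu>) * (ennreal ((norm (x - y))\<^sup>2) * E)"
    unfolding E_def by (intro mult_left_mono C1_translation_estimate[OF f]) auto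
  finally show "ennreal ((ball_avg s f x - ball_avg s f y)\<^sup>2) \<le> ennreal (1 / \<mu>) * (ennreal ((norm (x - y))\<^sup>2) * E)" .
qed

section \<open>Extraction of Cauchy subsequences\<close>

lemma C1_supported_diff:
  assumes "C1_supported K f F" "C1_supported K g G"
  shows "C1_supported K (\<lambda>x. f x - g x) (\<lambda>x. F x - G x)"
proof -
  have "((\<lambda>x. f x - g x) has_derivative (\<lambda>h. (F x - G x) \<bullet> h)) (at x)" for x
  proof -
    have "(f has_derivative (\<lambda>h. F x \<bullet> h)) (at x)" "(g has_derivative (\<lambda>h. G x \<bullet> h)) (at x)"
      using assms by (auto simp: C1_supported_def)
    from has_derivative_diff[OF this] show ?thesis by (simp add: inner_diff_left)
  qed
  then show ?thesis using assms by (auto simp: C1_supported_def intro!: continuous_intros)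
qed

lemma C1_supported_mono:
  assumes "C1_supported K f F" "K \<subseteq> L" "compact L"
  shows "C1_supported L f F"
  using assms by (auto simp: C1_supported_def)

lemma C1_supported_sq_integrable:
  assumes "C1_supported K f G"
  shows "integrable lborel (\<lambda>x. (f x)\<^sup>2)" "integrable lborel (\<lambda>x. (norm (G x))\<^sup>2)"
  by (rule C1_supported_integrable[OF assms]; use assms in \<open>auto simp: C1_supported_def intro!: continuous_intros\<close>)+

text \<open>Diagonal argument. It suffices that every subsequence can be thinned out until all
  mutual distances are below a given \<epsilon>, so the averaging radius in Rellich's theorem may
  depend on \<epsilon>.\<close>

lemma ex_Cauchy_subsequence:
  fixes d :: "nat \<Rightarrow> nat \<Rightarrow> real"
  assumes "\<And>\<epsilon> s. \<epsilon> > 0 \<Longrightarrow> strict_mono (s :: nat \<Rightarrow> nat) \<Longrightarrow>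
      \<exists>k :: nat \<Rightarrow> nat. strict_mono k \<and> (\<forall>i j. d (s (k i)) (s (k j)) < \<epsilon>)"
  shows "\<exists>r :: nat \<Rightarrow> nat. strict_mono r \<and> (\<forall>\<epsilon>>0. \<exists>N. \<forall>i\<ge>N. \<forall>j\<ge>N. d (r i) (r j) < \<epsilon>)"
proof -
  let ?P = "\<lambda>n (s :: nat \<Rightarrow> nat). \<forall>i j. d (s i) (s j) < 1 / real (Suc n)"
  interpret subseqs ?P
  proof
    fix n and s :: "nat \<Rightarrow> nat" assume "strict_mono s"
    from assms[OF _ this, of "1 / real (Suc n)"] show "\<exists>r'. strict_mono r' \<and> ?P n (s \<circ> r')"
      by (simp add: o_def)
  qed
  have "\<exists>N. \<forall>i\<ge>N. \<forall>j\<ge>N. d (diagseq i) (diagseq j) < \<epsilon>" if \<epsilon>: "\<epsilon> > 0" for \<epsilon>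
  proof -
    obtain n where n: "1 / real (Suc n) < \<epsilon>" using nat_approx_posE[OF \<epsilon>] .
    have P: "?P n (diagseq \<circ> (+) (Suc n))" by (rule diagseq_holds) simp
    have "d (diagseq i) (diagseq j) < \<epsilon>" if "i \<ge> Suc n" "j \<ge> Suc n" for i j
      using P[rule_format, of "i - Suc n" "j - Suc n"] that n by simp
    then show ?thesis by blast
  qed
  then show ?thesis using subseq_diagseq by blast
qed

text \<open>Ball averages of radius \<open>s\<close> are \<open>O(s)\<close>-close in \<open>L\<^sup>2\<close>, uniformly bounded and equi-Lipschitz.\<close>
lemma Rellich_test_functions:
  fixes f :: "nat \<Rightarrow> 'a::euclidean_space \<Rightarrow> real"
  assumes f: "\<And>n. C1_supported K (f n) (G n)" and K: "compact K"
    and C1: "\<And>n. (\<integral>x. (f n x)\<^sup>2 \<partial>lborel) \<le> C" and C2: "\<And>n. (\<integral>x. (norm (G n x))\<^sup>2 \<partial>lborel) \<le> C"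
  shows "\<exists>r :: nat \<Rightarrow> nat. strict_mono r \<and>
      (\<forall>\<epsilon>>0. \<exists>N. \<forall>i\<ge>N. \<forall>j\<ge>N. (\<integral>x. (f (r i) x - f (r j) x)\<^sup>2 \<partial>lborel) < \<epsilon>)"
proof (rule ex_Cauchy_subsequence)
  fix \<epsilon> :: real and r :: "nat \<Rightarrow> nat" assume \<epsilon>: "\<epsilon> > 0" and r: "strict_mono r"
  \<comment> \<open>The final bound consists of \<open>8 * C\<close> times the square of
    \<open>s\<close> and \<open>8 * measure lborel K\<close> times the square of \<delta>. This
    radius, and \<delta> below, make each part at most \<epsilon>/4; the added 1 keeps the
    denominators positive.\<close>
  define s where "s = sqrt (\<epsilon> / (32 * (\<bar>C\<bar> + 1)))"
  have s: "s > 0" using \<epsilon> by (simp add: s_def)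
  have s2: "s\<^sup>2 = \<epsilon> / (32 * (\<bar>C\<bar> + 1))" using \<epsilon> by (simp add: s_def)
  define \<mu> where "\<mu> = measure lborel (cball (0::'a) s)"
  have \<mu>: "\<mu> > 0" using s by (simp add: \<mu>_def measure_cball_pos)
  define M where "M = sqrt (\<bar>C\<bar> / \<mu>)"
  have "0 \<le> (\<integral>x. (f 0 x)\<^sup>2 \<partial>lborel)" by (intro integral_nonneg_AE AE_I2) auto
  then have C: "C \<ge> 0" using C1[of 0] by linarith
  have M2: "M\<^sup>2 = C / \<mu>" and M0: "M \<ge> 0" using C \<mu> by (auto simp: M_def)
  have nn1: "(\<integral>\<^sup>+x. ennreal ((f n x)\<^sup>2) \<partial>lborel) \<le> ennreal C" for n
    using C1_supported_sq_integrable(1)[OF f] C1[of n]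
    by (subst nn_integral_eq_integral) (auto intro: ennreal_leI)
  have nn2: "nn_energy (G n) \<le> ennreal C" for n
    using C1_supported_sq_integrable(2)[OF f] C2[of n]
    by (subst nn_integral_eq_integral) (auto intro: ennreal_leI)
  have bound: "norm (ball_avg s (f n) x) \<le> M" for n x
  proof -
    have "ennreal ((ball_avg s (f n) x)\<^sup>2) \<le> ennreal (1 / \<mu>) * ennreal C"
      unfolding \<mu>_def by (rule order_trans[OF ball_avg_estimates(2)[OF f s]]) (intro mult_left_mono nn1, auto)
    also have "\<dots> = ennreal (M\<^sup>2)" using \<mu> C by (simp add: M2 ennreal_mult'[symmetric])
    finally have "(ball_avg s (f n) x)\<^sup>2 \<le> M\<^sup>2" by (simp add: ennreal_le_iff)
    then show ?thesis using abs_le_square_iff[of "ball_avg s (f n) x" M] M0 by simp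
  qed
  have lip: "norm (ball_avg s (f n) x - ball_avg s (f n) y) \<le> M * norm (x - y)" for n x y
  proof -
    have "ennreal ((ball_avg s (f n) x - ball_avg s (f n) y)\<^sup>2) \<le> ennreal (1 / \<mu>) * (ennreal ((norm (x - y))\<^sup>2) * ennreal C)"
      unfolding \<mu>_def by (rule order_trans[OF ball_avg_estimates(3)[OF f s]]) (intro mult_left_mono nn2, auto)
    also have "\<dots> = ennreal ((M * norm (x - y))\<^sup>2)"
      using \<mu> C by (simp add: M2 ennreal_mult'[symmetric] power_mult_distrib mult.commute)
    finally have "(ball_avg s (f n) x - ball_avg s (f n) y)\<^sup>2 \<le> (M * norm (x - y))\<^sup>2" by (simp add: ennreal_le_iff)
    then show ?thesis
      using abs_le_square_iff[of "ball_avg s (f n) x - ball_avg s (f n) y" "M * norm (x - y)"] M0 by simp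
  qed
  define \<delta> where "\<delta> = sqrt (\<epsilon> / (32 * (measure lborel K + 1)))"
  have \<delta>: "\<delta> > 0" and \<delta>2: "\<delta>\<^sup>2 = \<epsilon> / (32 * (measure lborel K + 1))"
    using \<epsilon> measure_nonneg[of lborel K] by (auto simp: \<delta>_def add_nonneg_pos)
  \<comment> \<open>Uniform convergence on \<open>K\<close> is enough: outside \<open>K\<close> the
    functions themselves vanish, and only their distance from the averages is estimated on the whole
    space.\<close>
  obtain g k where k: "strict_mono (k :: nat \<Rightarrow> nat)"
    and g: "\<And>e. 0 < e \<Longrightarrow> \<exists>N. \<forall>n x. n \<ge> N \<and> x \<in> K \<longrightarrow> norm (ball_avg s (f (r (k n))) x - g x) < e"
  proof (rule Arzela_Ascoli[of K "\<lambda>n. ball_avg s (f (r n))" M])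
    fix x :: 'a and e :: real assume e: "e > 0"
    show "\<exists>d>0. \<forall>n y. y \<in> K \<and> norm (x - y) < d \<longrightarrow> norm (ball_avg s (f (r n)) x - ball_avg s (f (r n)) y) < e"
    proof (intro exI[of _ "e / (M + 1)"] conjI allI impI)
      show "e / (M + 1) > 0" using e M0 by simp
      fix n y assume y: "y \<in> K \<and> norm (x - y) < e / (M + 1)"
      have "norm (ball_avg s (f (r n)) x - ball_avg s (f (r n)) y) \<le> M * norm (x - y)" by (rule lip)
      also have "\<dots> \<le> (M + 1) * norm (x - y)" by (intro mult_right_mono) auto
      also have "\<dots> < e" using y M0 by (simp add: field_simps)
      finally show "norm (ball_avg s (f (r n)) x - ball_avg s (f (r n)) y) < e" .
    qed
  qed (use K bound in auto)
  obtain N where N: "\<And>n x. n \<ge> N \<Longrightarrow> x \<in> K \<Longrightarrow> norm (ball_avg s (f (r (k n))) x - g x) < \<delta>"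
    using g[OF \<delta>] by blast
  define k' where "k' i = k (i + N)" for i
  have "strict_mono k'" using k by (auto simp: k'_def strict_mono_def)
  moreover have "(\<integral>x. (f (r (k' i)) x - f (r (k' j)) x)\<^sup>2 \<partial>lborel) < \<epsilon>" for i j
  proof -
    define h where "h x = f (r (k' i)) x - f (r (k' j)) x" for x
    define H where "H x = G (r (k' i)) x - G (r (k' j)) x" for x
    have hH: "C1_supported K h H" unfolding h_def H_def by (intro C1_supported_diff f)
    have cont: "continuous_on UNIV (f n)" for n using f[of n] by (simp add: C1_supported_def)
    have mh[measurable]: "h \<in> borel_measurable borel"
      using hH by (auto simp: C1_supported_def intro: borel_measurable_continuous_onI)
    have ma[measurable]: "ball_avg s h \<in> borel_measurable borel"
    proof -
      have "(\<lambda>x. \<integral>y. indicator (cball 0 s) y * h (x + y) \<partial>lborel) \<in> borel_measurable borel"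
        using borel_measurable_translate_pair[OF mh, of borel lborel]
        by (intro lborel.borel_measurable_lebesgue_integral) (simp add: case_prod_beta')
      then show ?thesis unfolding ball_avg_def[abs_def] by (rule borel_measurable_divide) simp
    qed
    have avg: "(ball_avg s h x)\<^sup>2 \<le> 4 * \<delta>\<^sup>2" if "x \<in> K" for x
    proof -
      have "ball_avg s h x = ball_avg s (f (r (k' i))) x - ball_avg s (f (r (k' j))) x"
        unfolding h_def by (rule ball_avg_diff[OF cont cont])
      then have "norm (ball_avg s h x) \<le> 2 * \<delta>"
        using N[OF _ that, of "i + N"] N[OF _ that, of "j + N"] by (simp add: k'_def)
      then have "(ball_avg s h x)\<^sup>2 \<le> (2 * \<delta>)\<^sup>2" using \<delta> abs_le_square_iff[of "ball_avg s h x" "2 * \<delta>"] by simp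
      then show ?thesis by (simp add: power_mult_distrib)
    qed
    have HE: "nn_energy H \<le> ennreal (4 * C)"
    proof -
      have "nn_energy H = ennreal (\<integral>x. (norm (H x))\<^sup>2 \<partial>lborel)"
        using C1_supported_sq_integrable(2)[OF hH] by (intro nn_integral_eq_integral) auto
      also have "(\<integral>x. (norm (H x))\<^sup>2 \<partial>lborel) \<le>
          (\<integral>x. 2 * (norm (G (r (k' i)) x))\<^sup>2 + 2 * (norm (G (r (k' j)) x))\<^sup>2 \<partial>lborel)"
      proof (rule integral_mono)
        show "(norm (H x))\<^sup>2 \<le> 2 * (norm (G (r (k' i)) x))\<^sup>2 + 2 * (norm (G (r (k' j)) x))\<^sup>2" for x
          unfolding H_def by (rule norm_diff_sq_le)
      qed (use C1_supported_sq_integrable(2)[OF hH] C1_supported_sq_integrable(2)[OF f] in auto)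
      also have "\<dots> = 2 * (\<integral>x. (norm (G (r (k' i)) x))\<^sup>2 \<partial>lborel) + 2 * (\<integral>x. (norm (G (r (k' j)) x))\<^sup>2 \<partial>lborel)"
        using C1_supported_sq_integrable(2)[OF f] by simp
      also have "\<dots> \<le> 4 * C" using C2[of "r (k' i)"] C2[of "r (k' j)"] by linarith
      finally show ?thesis by (simp add: ennreal_leI)
    qed
    have "ennreal (\<integral>x. (h x)\<^sup>2 \<partial>lborel) = (\<integral>\<^sup>+x. ennreal ((h x)\<^sup>2) \<partial>lborel)"
      using C1_supported_sq_integrable(1)[OF hH] by (intro nn_integral_eq_integral[symmetric]) auto
    also have "\<dots> \<le> (\<integral>\<^sup>+x. ennreal 2 * ennreal ((ball_avg s h x - h x)\<^sup>2) + indicator K x * ennreal (8 * \<delta>\<^sup>2) \<partial>lborel)"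
    proof (rule nn_integral_mono)
      fix x
      show "ennreal ((h x)\<^sup>2) \<le> ennreal 2 * ennreal ((ball_avg s h x - h x)\<^sup>2) + indicator K x * ennreal (8 * \<delta>\<^sup>2)"
      proof (cases "x \<in> K")
        case True
        have "(h x)\<^sup>2 \<le> 2 * (ball_avg s h x - h x)\<^sup>2 + 2 * (ball_avg s h x)\<^sup>2"
          using zero_le_power2[of "2 * ball_avg s h x - h x"] by (simp add: power2_eq_square algebra_simps)
        also have "\<dots> \<le> 2 * (ball_avg s h x - h x)\<^sup>2 + 8 * \<delta>\<^sup>2" using avg[OF True] by simp
        finally have "ennreal ((h x)\<^sup>2) \<le> ennreal (2 * (ball_avg s h x - h x)\<^sup>2 + 8 * \<delta>\<^sup>2)" by (rule ennreal_leI)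
        also have "\<dots> = ennreal 2 * ennreal ((ball_avg s h x - h x)\<^sup>2) + ennreal (8 * \<delta>\<^sup>2)"
          by (subst ennreal_plus) (auto simp: ennreal_mult')
        finally show ?thesis using True by simp
      next
        case False
        then show ?thesis using hH by (simp add: C1_supported_def)
      qed
    qed
    also have "\<dots> = ennreal 2 * (\<integral>\<^sup>+x. ennreal ((ball_avg s h x - h x)\<^sup>2) \<partial>lborel) + emeasure lborel K * ennreal (8 * \<delta>\<^sup>2)"
      using K by (subst nn_integral_add) (auto simp: nn_integral_cmult nn_integral_multc compact_imp_closed)
    also have "emeasure lborel K = ennreal (measure lborel K)"
      using emeasure_compact_finite[OF K] by (intro emeasure_eq_ennreal_measure) auto
    also have "ennreal 2 * (\<integral>\<^sup>+x. ennreal ((ball_avg s h x - h x)\<^sup>2) \<partial>lborel) \<le> ennreal 2 * (ennreal (s\<^sup>2) * ennreal (4 * C))"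
      by (intro mult_left_mono order_trans[OF ball_avg_estimates(1)[OF hH s]] HE) auto
    also have "ennreal 2 * (ennreal (s\<^sup>2) * ennreal (4 * C)) + ennreal (measure lborel K) * ennreal (8 * \<delta>\<^sup>2)
        = ennreal (8 * C * s\<^sup>2 + 8 * measure lborel K * \<delta>\<^sup>2)"
      using C by (subst ennreal_plus) (auto simp: ennreal_mult'[symmetric] mult_ac simp del: ennreal_numeral)
    finally have "ennreal (\<integral>x. (h x)\<^sup>2 \<partial>lborel) \<le> ennreal (8 * C * s\<^sup>2 + 8 * measure lborel K * \<delta>\<^sup>2)"
      by (simp add: add_right_mono)
    then have "(\<integral>x. (h x)\<^sup>2 \<partial>lborel) \<le> 8 * C * s\<^sup>2 + 8 * measure lborel K * \<delta>\<^sup>2"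
      by (rule ennreal_le_iff[THEN iffD1, rotated]) (use C in auto)
    also have "\<dots> < \<epsilon>"
    proof -
      have "8 * C * s\<^sup>2 \<le> \<epsilon> / 4" unfolding s2 using C \<epsilon> by (simp add: field_simps)
      moreover have "8 * measure lborel K * \<delta>\<^sup>2 \<le> \<epsilon> / 4"
      proof -
        have "8 * m * (\<epsilon> / (32 * (m + 1))) \<le> \<epsilon> / 4" if "m \<ge> 0" for m
          using that \<epsilon> by (simp add: field_simps)
        then show ?thesis unfolding \<delta>2 using measure_nonneg by blast
      qed
      ultimately show ?thesis using \<epsilon> by linarith
    qed
    finally show ?thesis by (simp add: h_def)
  qed
  ultimately show "\<exists>k :: nat \<Rightarrow> nat. strict_mono k \<and> (\<forall>i j. (\<integral>x. (f (r (k i)) x - f (r (k j)) x)\<^sup>2 \<partial>lborel) < \<epsilon>)" by blast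
qed

section \<open>The space of square-integrable functions\<close>

text \<open>Pointwise operations turn all functions into a real vector space, so that
  \<open>L2 \<Omega>\<close> is a subspace of it and the semi-inner product results apply to
  representatives directly.\<close>

instantiation "fun" :: (type, scaleR) scaleR
begin
definition scaleR_fun_def: "r *\<^sub>R f = (\<lambda>x. r *\<^sub>R f x)"
instance ..
end

lemma scaleR_fun_apply [simp]: "(r *\<^sub>R f) x = r *\<^sub>R f x"
  by (simp add: scaleR_fun_def)

instance "fun" :: (type, real_vector) real_vector
  by standard (auto simp: fun_eq_iff scaleR_add_left scaleR_add_right)

lemma sum_fun_apply: "(\<Sum>i\<in>I. f i) x = (\<Sum>i\<in>I. f i x)"
  by (induction I rule: infinite_finite_induct) auto

text \<open>The values may lie in any Euclidean space: scalar functions, gradient fields and pairs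
  of both share the same lemmas.\<close>

definition L2_inner :: "'a::euclidean_space set \<Rightarrow> ('a \<Rightarrow> 'b::euclidean_space) \<Rightarrow> ('a \<Rightarrow> 'b) \<Rightarrow> real" where
  "L2_inner \<Omega> f g = (\<integral>x. f x \<bullet> g x \<partial>lebesgue_on \<Omega>)"

lemma norm_add_sq_le:
  fixes a b :: "'b::real_normed_vector"
  shows "(norm (a + b))\<^sup>2 \<le> 2 * (norm a)\<^sup>2 + 2 * (norm b)\<^sup>2"
  using norm_diff_sq_le[of a "- b"] by simp

lemma L2_measurable: "f \<in> L2 \<Omega> \<Longrightarrow> f \<in> borel_measurable (lebesgue_on \<Omega>)"
  and L2_integrable: "f \<in> L2 \<Omega> \<Longrightarrow> integrable (lebesgue_on \<Omega>) (\<lambda>x. (norm (f x))\<^sup>2)"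
  by (auto simp: L2_def)

lemma L2_dominated:
  assumes f: "f \<in> borel_measurable (lebesgue_on \<Omega>)"
    and g: "integrable (lebesgue_on \<Omega>) g" "\<And>x. x \<in> \<Omega> \<Longrightarrow> (norm (f x))\<^sup>2 \<le> g x"
  shows "f \<in> L2 \<Omega>"
proof -
  note [measurable] = f
  have "integrable (lebesgue_on \<Omega>) (\<lambda>x. (norm (f x))\<^sup>2)"
    by (rule Bochner_Integration.integrable_bound[OF g(1)])
      (use g(2) in \<open>auto intro!: AE_I2 simp: space_restrict_space\<close>, fastforce)
  then show ?thesis using f by (simp add: L2_def)
qed

lemma L2_inner_integrable:
  assumes f: "f \<in> L2 \<Omega>" and g: "g \<in> L2 \<Omega>"
  shows "integrable (lebesgue_on \<Omega>) (\<lambda>x. f x \<bullet> g x)"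
proof -
  note [measurable] = L2_measurable[OF f] L2_measurable[OF g]
  show ?thesis
  proof (rule Bochner_Integration.integrable_bound)
    show "integrable (lebesgue_on \<Omega>) (\<lambda>x. (norm (f x))\<^sup>2 + (norm (g x))\<^sup>2)"
      using L2_integrable[OF f] L2_integrable[OF g] by simp
    show "AE x in lebesgue_on \<Omega>. norm (f x \<bullet> g x) \<le> norm ((norm (f x))\<^sup>2 + (norm (g x))\<^sup>2)"
    proof (rule AE_I2)
      fix x
      have "\<bar>f x \<bullet> g x\<bar> \<le> norm (f x) * norm (g x)" by (rule Cauchy_Schwarz_ineq2)
      also have "\<dots> \<le> 2 * (norm (f x) * norm (g x))" by simp
      also have "\<dots> \<le> (norm (f x))\<^sup>2 + (norm (g x))\<^sup>2"
        using sum_squares_bound[of "norm (f x)" "norm (g x)"] by simp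
      finally show "norm (f x \<bullet> g x) \<le> norm ((norm (f x))\<^sup>2 + (norm (g x))\<^sup>2)" by simp
    qed
  qed measurable
qed

lemma L2_add:
  assumes f: "f \<in> L2 \<Omega>" and g: "g \<in> L2 \<Omega>"
  shows "f + g \<in> L2 \<Omega>"
proof (rule L2_dominated)
  note [measurable] = L2_measurable[OF f] L2_measurable[OF g]
  show "f + g \<in> borel_measurable (lebesgue_on \<Omega>)" unfolding plus_fun_def by measurable
  show "integrable (lebesgue_on \<Omega>) (\<lambda>x. 2 * (norm (f x))\<^sup>2 + 2 * (norm (g x))\<^sup>2)"
    using L2_integrable[OF f] L2_integrable[OF g] by simp
qed (simp add: norm_add_sq_le)

lemma L2_scaleR:
  assumes f: "f \<in> L2 \<Omega>"
  shows "c *\<^sub>R f \<in> L2 \<Omega>"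
proof (rule L2_dominated)
  note [measurable] = L2_measurable[OF f]
  show "c *\<^sub>R f \<in> borel_measurable (lebesgue_on \<Omega>)" unfolding scaleR_fun_def by measurable
  show "integrable (lebesgue_on \<Omega>) (\<lambda>x. c\<^sup>2 * (norm (f x))\<^sup>2)"
    using L2_integrable[OF f] by simp
qed (simp add: power_mult_distrib)

lemma L2_zero: "0 \<in> L2 \<Omega>"
  by (simp add: L2_def zero_fun_def)

lemma subspace_L2: "subspace (L2 \<Omega>)"
  by (simp add: subspace_def L2_add L2_scaleR L2_zero)

lemma semi_inner_L2: "semi_inner (L2 \<Omega> :: ('a::euclidean_space \<Rightarrow> 'b::euclidean_space) set) (L2_inner \<Omega>)"
proof
  fix x y z :: "'a \<Rightarrow> 'b" and c :: real
  show "subspace (L2 \<Omega> :: ('a \<Rightarrow> 'b) set)" by (rule subspace_L2)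
  show "L2_inner \<Omega> x y = L2_inner \<Omega> y x" by (simp add: L2_inner_def inner_commute)
  show "L2_inner \<Omega> (x + y) z = L2_inner \<Omega> x z + L2_inner \<Omega> y z"
    if "x \<in> L2 \<Omega>" "y \<in> L2 \<Omega>" "z \<in> L2 \<Omega>"
    using that by (simp add: L2_inner_def inner_add_left L2_inner_integrable)
  show "L2_inner \<Omega> (c *\<^sub>R x) z = c * L2_inner \<Omega> x z"
    by (simp add: L2_inner_def)
  show "0 \<le> L2_inner \<Omega> x x"
    unfolding L2_inner_def by (intro integral_nonneg_AE AE_I2) simp
qed

text \<open>Mass and energy are the inner product of \<open>L2\<close> pulled back along the two
  projections of a pair.\<close>

lemma semi_inner_pullback:
  assumes B: "semi_inner S B" and V: "subspace V" and T: "\<And>x. x \<in> V \<Longrightarrow> T x \<in> S"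
    and lin: "\<And>x y. T (x + y) = T x + T y" "\<And>c x. T (c *\<^sub>R x) = c *\<^sub>R T x"
  shows "semi_inner V (\<lambda>x y. B (T x) (T y))"
proof -
  interpret semi_inner S B by (rule B)
  show ?thesis
  proof
    fix x y assume "x \<in> V" "y \<in> V"
    then show "B (T x) (T y) = B (T y) (T x)" using T by (intro sym) auto
  qed (auto simp: V T lin add_left scale_left nonneg)
qed

lemma L2_linear_image:
  assumes T: "bounded_linear T" and f: "f \<in> L2 \<Omega>"
  shows "T \<circ> f \<in> L2 \<Omega>"
proof (rule L2_dominated)
  note [measurable] = L2_measurable[OF f]
  have [measurable]: "T \<in> borel_measurable borel"
    using linear_continuous_on[OF T, of UNIV] by (rule borel_measurable_continuous_onI)
  show "T \<circ> f \<in> borel_measurable (lebesgue_on \<Omega>)" by measurable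
  show "integrable (lebesgue_on \<Omega>) (\<lambda>x. (onorm T)\<^sup>2 * (norm (f x))\<^sup>2)"
    using L2_integrable[OF f] by simp
  show "(norm ((T \<circ> f) x))\<^sup>2 \<le> (onorm T)\<^sup>2 * (norm (f x))\<^sup>2" for x
    using power_mono[OF onorm[OF T, of "f x"], of 2] by (simp add: power_mult_distrib)
qed

lemma L2_mult_bounded:
  fixes h :: "'a::euclidean_space \<Rightarrow> real"
  assumes h: "h \<in> borel_measurable borel" "\<And>x. x \<in> \<Omega> \<Longrightarrow> \<bar>h x\<bar> \<le> C" and f: "f \<in> L2 \<Omega>"
  shows "(\<lambda>x. h x *\<^sub>R f x) \<in> L2 \<Omega>"
proof (rule L2_dominated)
  note [measurable] = L2_measurable[OF f] h(1)
  have [measurable]: "h \<in> borel_measurable (lebesgue_on \<Omega>)"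
    using h(1) by (intro measurable_restrict_space1 measurable_completion) simp
  show "(\<lambda>x. h x *\<^sub>R f x) \<in> borel_measurable (lebesgue_on \<Omega>)" by measurable
  show "integrable (lebesgue_on \<Omega>) (\<lambda>x. C\<^sup>2 * (norm (f x))\<^sup>2)"
    using L2_integrable[OF f] by simp
  show "(norm (h x *\<^sub>R f x))\<^sup>2 \<le> C\<^sup>2 * (norm (f x))\<^sup>2" if "x \<in> \<Omega>" for x
    using power_mono[OF h(2)[OF that], of 2] by (simp add: power_mult_distrib mult_right_mono)
qed

lemma L2_Pair:
  assumes f: "f \<in> L2 \<Omega>" and g: "g \<in> L2 \<Omega>"
  shows "(\<lambda>x. (f x, g x)) \<in> L2 \<Omega>"
proof (rule L2_dominated)
  note [measurable] = L2_measurable[OF f] L2_measurable[OF g]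
  show "(\<lambda>x. (f x, g x)) \<in> borel_measurable (lebesgue_on \<Omega>)" by (rule borel_measurable_Pair) measurable
  show "integrable (lebesgue_on \<Omega>) (\<lambda>x. (norm (f x))\<^sup>2 + (norm (g x))\<^sup>2)"
    using L2_integrable[OF f] L2_integrable[OF g] by simp
qed (simp add: norm_Pair)

lemma L2_fst: "U \<in> L2 \<Omega> \<Longrightarrow> fst \<circ> U \<in> L2 \<Omega>"
  and L2_snd: "U \<in> L2 \<Omega> \<Longrightarrow> snd \<circ> U \<in> L2 \<Omega>"
  by (auto intro: L2_linear_image bounded_linear_fst bounded_linear_snd)

text \<open>As for the Riesz--Fischer theorem: a rapidly Cauchy subsequence converges almost everywhere,
  and Fatou's lemma identifies the limit.\<close>
lemma L2_complete:
  fixes f :: "nat \<Rightarrow> 'a::euclidean_space \<Rightarrow> 'b::euclidean_space"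
  assumes \<Omega>: "\<Omega> \<in> lmeasurable" and f: "\<And>n. f n \<in> L2 \<Omega>"
    and Cauchy: "\<And>\<epsilon>. \<epsilon> > 0 \<Longrightarrow> \<exists>N. \<forall>i\<ge>N. \<forall>j\<ge>N. sq (L2_inner \<Omega>) (f i - f j) < \<epsilon>"
  shows "\<exists>g\<in>L2 \<Omega>. (\<lambda>n. L2_inner \<Omega> (f n - g) (f n - g)) \<longlonglongrightarrow> 0"
proof -
  let ?M = "lebesgue_on \<Omega>"
  interpret M: finite_measure ?M using \<Omega> by (rule finite_measure_lebesgue_on)
  interpret L2: semi_inner "L2 \<Omega> :: ('a \<Rightarrow> 'b) set" "L2_inner \<Omega>" by (rule semi_inner_L2)
  define D where "D i j = sq (L2_inner \<Omega>) (f i - f j)" for i j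
  have D: "D i j = (\<integral>x. (norm (f i x - f j x))\<^sup>2 \<partial>?M)" for i j
    by (simp add: D_def L2_inner_def power2_norm_eq_inner)
  have mf[measurable]: "f n \<in> borel_measurable ?M" for n by (rule L2_measurable[OF f])
  have dL2: "f i - f j \<in> L2 \<Omega>" for i j by (intro L2.mem_diff f)
  have int: "integrable ?M (\<lambda>x. (norm (f i x - f j x))\<^sup>2)" for i j
    using L2_integrable[OF dL2[of i j]] by simp
  have nnD: "(\<integral>\<^sup>+x. ennreal ((norm (f i x - f j x))\<^sup>2) \<partial>?M) = ennreal (D i j)" for i j
    unfolding D by (rule nn_integral_eq_integral[OF int]) simp
  have "\<exists>N. \<forall>i\<ge>N. \<forall>j\<ge>N. D i j < (1/4) ^ k" for k
    unfolding D_def by (rule Cauchy) simp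
  then obtain N where N: "\<And>k i j. i \<ge> N k \<Longrightarrow> j \<ge> N k \<Longrightarrow> D i j < (1/4) ^ k" by metis
  \<comment> \<open>The sum ensures \<open>r k \<ge> N k\<close> together with monotonicity, and the
    summand \<open>k\<close> makes \<open>r\<close> tend to infinity.\<close>
  define r where "r k = (\<Sum>i\<le>k. N i) + k" for k
  have rN: "r k \<ge> N k" for k
    unfolding r_def by (rule trans_le_add1) (rule member_le_sum, auto)
  have rS: "r (Suc k) \<ge> r k" "r k \<ge> k" for k by (simp_all add: r_def)
  have Dr: "D (r (Suc k)) (r k) < (1/4) ^ k" for k
    by (rule N) (use rN[of k] rS(1)[of k] in auto)
  define h where "h k x = norm (f (r (Suc k)) x - f (r k) x)" for k x
  have h_int: "integrable ?M (h k)" for k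
  proof (rule Bochner_Integration.integrable_bound[of _ "\<lambda>x. 1 + (h k x)\<^sup>2"])
    show "integrable ?M (\<lambda>x. 1 + (h k x)\<^sup>2)"
      unfolding h_def using int by simp
    show "AE x in ?M. norm (h k x) \<le> norm (1 + (h k x)\<^sup>2)"
    proof (rule AE_I2)
      fix x
      show "norm (h k x) \<le> norm (1 + (h k x)\<^sup>2)"
      proof -
        have h0: "0 \<le> h k x" by (simp add: h_def)
        have "2 * h k x \<le> 1 + (h k x)\<^sup>2" using sum_squares_bound[of 1 "h k x"] by simp
        then have "h k x \<le> 1 + (h k x)\<^sup>2" using h0 by linarith
        then show ?thesis using h0 by simp
      qed
    qed
  qed (unfold h_def, measurable)
  have h_le: "(\<integral>x. h k x \<partial>?M) \<le> (1/2) ^ k * (measure ?M (space ?M) + 1)" for k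
  proof -
    have "(\<integral>x. h k x \<partial>?M) \<le> (\<integral>x. (1/2)^k + 2^k * (h k x)\<^sup>2 \<partial>?M)"
    proof (rule integral_mono[OF h_int])
      show "integrable ?M (\<lambda>x. (1/2)^k + 2^k * (h k x)\<^sup>2)"
        unfolding h_def using int by simp
      fix x
      have h0: "h k x \<ge> 0" by (simp add: h_def)
      \<comment> \<open>Weighted arithmetic-geometric mean. The weight \<open>2 ^ k\<close> balances
        the two parts: the domain has finite measure and the integral of the square of
        \<open>h k\<close> is below \<open>(1/4) ^ k\<close>, so both are of order
        \<open>(1/2) ^ k\<close>.\<close>
      have "2 * 1 * (2^k * h k x) \<le> 1\<^sup>2 + (2^k * h k x)\<^sup>2" by (rule sum_squares_bound)
      then have "2^k * h k x \<le> 1 + 2^k * (2^k * (h k x)\<^sup>2)"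
        using h0 by (simp add: power2_eq_square mult_ac) (smt (verit) mult_nonneg_nonneg zero_le_power)
      then have "(1/2)^k * (2^k * h k x) \<le> (1/2)^k * (1 + 2^k * (2^k * (h k x)\<^sup>2))"
        by (intro mult_left_mono) auto
      then show "h k x \<le> (1/2)^k + 2^k * (h k x)\<^sup>2"
        by (simp add: distrib_left mult.assoc[symmetric] power_mult_distrib[symmetric])
    qed
    also have "\<dots> = (1/2)^k * measure ?M (space ?M) + 2^k * D (r (Suc k)) (r k)"
      unfolding h_def D using int by simp
    also have "2^k * D (r (Suc k)) (r k) \<le> 2^k * (1/4)^k"
      using Dr[of k] by (intro mult_left_mono) auto
    also have "(2::real)^k * (1/4)^k = (1/2)^k" by (simp add: power_mult_distrib[symmetric])
    finally show ?thesis by (simp add: algebra_simps)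
  qed
  have "AE x in ?M. summable (\<lambda>k. h k x)"
  proof -
    have mh[measurable]: "h k \<in> borel_measurable ?M" for k unfolding h_def by measurable
    have "(\<integral>\<^sup>+x. (\<Sum>k. ennreal (h k x)) \<partial>?M) = (\<Sum>k. \<integral>\<^sup>+x. ennreal (h k x) \<partial>?M)"
      by (rule nn_integral_suminf) measurable
    also have "\<dots> = (\<Sum>k. ennreal (\<integral>x. h k x \<partial>?M))"
      by (intro suminf_cong nn_integral_eq_integral h_int) (simp add: h_def)
    also have "\<dots> \<le> (\<Sum>k. ennreal ((1/2) ^ k * (measure ?M (space ?M) + 1)))"
      by (intro suminf_le ennreal_leI h_le) auto
    also have "\<dots> < \<infinity>"
    proof -
      have "summable (\<lambda>k. (1/2::real) ^ k * (measure ?M (space ?M) + 1))"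
        by (intro summable_mult2 summable_geometric) auto
      then have "(\<Sum>k. ennreal ((1/2) ^ k * (measure ?M (space ?M) + 1)))
          = ennreal (\<Sum>k. (1/2) ^ k * (measure ?M (space ?M) + 1))"
        by (rule suminf_ennreal2[rotated]) simp
      then show ?thesis by (simp only: infinity_ennreal_def ennreal_less_top)
    qed
    finally have "AE x in ?M. (\<Sum>k. ennreal (h k x)) \<noteq> \<infinity>"
      by (intro nn_integral_PInf_AE) auto
    then show ?thesis
      by eventually_elim (rule summable_suminf_not_top, auto simp: h_def)
  qed
  then have conv: "AE x in ?M. convergent (\<lambda>k. f (r k) x)"
  proof eventually_elim
    case (elim x)
    have "summable (\<lambda>k. f (r (Suc k)) x - f (r k) x)"
      using elim unfolding h_def by (rule summable_norm_cancel)
    then have "convergent (\<lambda>n. \<Sum>k<n. f (r (Suc k)) x - f (r k) x)"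
      by (simp add: summable_iff_convergent)
    then have "convergent (\<lambda>n. f (r n) x - f (r 0) x)"
      using sum_lessThan_telescope[of "\<lambda>k. f (r k) x"] by simp
    from convergent_add[OF this convergent_const[of "f (r 0) x"]] show ?case by simp
  qed
  define g where "g x = lim (\<lambda>k. f (r k) x)" for x
  have mg[measurable]: "g \<in> borel_measurable ?M"
    unfolding g_def by (rule borel_measurable_lim_metric) measurable
  have lim: "AE x in ?M. (\<lambda>k. f (r k) x) \<longlonglongrightarrow> g x"
    using conv by eventually_elim (simp add: g_def convergent_LIMSEQ_iff)
  have Fatou: "(\<integral>\<^sup>+x. ennreal ((norm (f n x - g x))\<^sup>2) \<partial>?M) \<le> ennreal ((1/4) ^ k)" if "n \<ge> N k" for n k
  proof -
    have "(\<integral>\<^sup>+x. ennreal ((norm (f n x - g x))\<^sup>2) \<partial>?M)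
        = (\<integral>\<^sup>+x. liminf (\<lambda>j. ennreal ((norm (f n x - f (r j) x))\<^sup>2)) \<partial>?M)"
    proof (rule nn_integral_cong_AE)
      show "AE x in ?M. ennreal ((norm (f n x - g x))\<^sup>2) = liminf (\<lambda>j. ennreal ((norm (f n x - f (r j) x))\<^sup>2))"
        using lim
      proof eventually_elim
        case (elim x)
        have "(\<lambda>j. ennreal ((norm (f n x - f (r j) x))\<^sup>2)) \<longlonglongrightarrow> ennreal ((norm (f n x - g x))\<^sup>2)"
          by (intro tendsto_intros elim)
        from lim_imp_Liminf[OF _ this] show ?case by simp
      qed
    qed
    also have "\<dots> \<le> liminf (\<lambda>j. \<integral>\<^sup>+x. ennreal ((norm (f n x - f (r j) x))\<^sup>2) \<partial>?M)"
      by (rule nn_integral_liminf) measurable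
    also have "\<dots> = liminf (\<lambda>j. ennreal (D n (r j)))" by (simp add: nnD)
    also have "\<dots> \<le> liminf (\<lambda>j. ennreal ((1/4) ^ k))"
    proof (rule Liminf_mono)
      show "\<forall>\<^sub>F j in sequentially. ennreal (D n (r j)) \<le> ennreal ((1/4) ^ k)"
        unfolding eventually_sequentially
      proof (intro exI[of _ "N k"] allI impI ennreal_leI)
        fix j assume "j \<ge> N k"
        then show "D n (r j) \<le> (1/4) ^ k" using N[of k n "r j"] that rS(2)[of j] by linarith
      qed
    qed
    also have "\<dots> = ennreal ((1/4) ^ k)" by (simp add: Liminf_const)
    finally show ?thesis .
  qed
  have fg: "f n - g \<in> L2 \<Omega>" if "n \<ge> N 0" for n
  proof -
    have "integrable ?M (\<lambda>x. (norm (f n x - g x))\<^sup>2)"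
    proof (rule integrableI_bounded)
      have "(\<integral>\<^sup>+x. ennreal (norm ((norm (f n x - g x))\<^sup>2)) \<partial>?M) \<le> ennreal 1"
        using Fatou[OF that] by simp
      also have "\<dots> < \<infinity>" by simp
      finally show "(\<integral>\<^sup>+x. ennreal (norm ((norm (f n x - g x))\<^sup>2)) \<partial>?M) < \<infinity>" .
    qed measurable
    moreover have "(\<lambda>x. f n x - g x) \<in> borel_measurable ?M" by measurable
    ultimately show ?thesis by (simp add: L2_def fun_diff_def)
  qed
  have "g = f (N 0) - (f (N 0) - g)" by simp
  moreover have "\<dots> \<in> L2 \<Omega>" by (intro L2.mem_diff f fg) simp
  ultimately have gL2: "g \<in> L2 \<Omega>" by simp
  have "(\<lambda>n. L2_inner \<Omega> (f n - g) (f n - g)) \<longlonglongrightarrow> 0"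
  proof (rule LIMSEQ_I)
    fix \<epsilon> :: real assume "\<epsilon> > 0"
    then obtain k where k: "(1/4) ^ k < \<epsilon>" using real_arch_pow_inv[of \<epsilon> "1/4"] by auto
    show "\<exists>no. \<forall>n\<ge>no. norm (L2_inner \<Omega> (f n - g) (f n - g) - 0) < \<epsilon>"
    proof (intro exI[of _ "N k"] allI impI)
      fix n assume n: "n \<ge> N k"
      have fgn: "f n - g \<in> L2 \<Omega>" by (intro L2.mem_diff f gL2)
      have "ennreal (L2_inner \<Omega> (f n - g) (f n - g)) = (\<integral>\<^sup>+x. ennreal ((norm (f n x - g x))\<^sup>2) \<partial>?M)"
        using L2_integrable[OF fgn]
        by (simp add: L2_inner_def power2_norm_eq_inner nn_integral_eq_integral)
      also have "\<dots> \<le> ennreal ((1/4) ^ k)" by (rule Fatou[OF n])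
      finally have "L2_inner \<Omega> (f n - g) (f n - g) \<le> (1/4) ^ k" by (simp add: ennreal_le_iff)
      then show "norm (L2_inner \<Omega> (f n - g) (f n - g) - 0) < \<epsilon>"
        using k L2.nonneg[OF fgn] by simp
    qed
  qed
  then show ?thesis using gL2 by blast
qed

section \<open>The Dirichlet form\<close>

definition jet :: "('a::euclidean_space \<Rightarrow> real) \<Rightarrow> 'a \<Rightarrow> real \<times> 'a" where
  "jet \<phi> x = (\<phi> x, grad \<phi> x)"

definition mass :: "'a::euclidean_space set \<Rightarrow> ('a \<Rightarrow> real \<times> 'a) \<Rightarrow> ('a \<Rightarrow> real \<times> 'a) \<Rightarrow> real" where
  "mass \<Omega> U W = L2_inner \<Omega> (fst \<circ> U) (fst \<circ> W)"

definition energy :: "'a::euclidean_space set \<Rightarrow> ('a \<Rightarrow> real \<times> 'a) \<Rightarrow> ('a \<Rightarrow> real \<times> 'a) \<Rightarrow> real" where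
  "energy \<Omega> U W = L2_inner \<Omega> (snd \<circ> U) (snd \<circ> W)"

text \<open>The space \<open>H\<^sup>1\<^sub>0(\<Omega>)\<close>, each function paired with its weak gradient.\<close>
definition H10_pairs :: "'a::euclidean_space set \<Rightarrow> ('a \<Rightarrow> real \<times> 'a) set" where
  "H10_pairs \<Omega> = {U \<in> L2 \<Omega>. \<exists>\<phi>. (\<forall>n. \<phi> n \<in> test_functions \<Omega>) \<and>
     (\<lambda>n::nat. sq (L2_inner \<Omega>) (jet (\<phi> n) - U)) \<longlonglongrightarrow> 0}"

text \<open>These act on pairs of a function and its gradient; the gradient slot of \<open>partial b U\<close> is a
  dummy that is never used.\<close>
definition coord_mult :: "'a::euclidean_space \<Rightarrow> ('a \<Rightarrow> real \<times> 'a) \<Rightarrow> 'a \<Rightarrow> real \<times> 'a" where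
  "coord_mult b U x = ((x \<bullet> b) * fst (U x), (x \<bullet> b) *\<^sub>R snd (U x) + fst (U x) *\<^sub>R b)"

definition partial :: "'a::euclidean_space \<Rightarrow> ('a \<Rightarrow> real \<times> 'a) \<Rightarrow> 'a \<Rightarrow> real \<times> 'a" where
  "partial b U x = (snd (U x) \<bullet> b, 0)"

lemma test_function_has_derivative:
  "\<phi> \<in> test_functions \<Omega> \<Longrightarrow> (\<phi> has_derivative (\<lambda>h. grad \<phi> x \<bullet> h)) (at x)"
  using test_function_C1 by (auto simp: C1_supported_def)

lemma jet_add:
  assumes "\<phi> \<in> test_functions \<Omega>" "\<psi> \<in> test_functions \<Omega>"
  shows "jet (\<lambda>x. \<phi> x + \<psi> x) = jet \<phi> + jet \<psi>"
proof -
  have "grad (\<lambda>x. \<phi> x + \<psi> x) x = grad \<phi> x + grad \<psi> x" for x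
    by (rule grad_eqI)
      (use has_derivative_add[OF assms[THEN test_function_has_derivative]] in \<open>simp add: inner_add_left\<close>)
  then show ?thesis by (simp add: jet_def fun_eq_iff)
qed

lemma jet_cmult:
  assumes "\<phi> \<in> test_functions \<Omega>"
  shows "jet (\<lambda>x. c * \<phi> x) = c *\<^sub>R jet \<phi>"
proof -
  have "grad (\<lambda>x. c * \<phi> x) x = c *\<^sub>R grad \<phi> x" for x
    by (rule grad_eqI)
      (use has_derivative_mult_right[OF test_function_has_derivative[OF assms], of c] in simp)
  then show ?thesis by (simp add: jet_def fun_eq_iff)
qed

lemma jet_coord_mult:
  assumes "\<phi> \<in> test_functions \<Omega>"
  shows "jet (\<lambda>x. (x \<bullet> b) * \<phi> x) = coord_mult b (jet \<phi>)"
proof -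
  have "grad (\<lambda>x. (x \<bullet> b) * \<phi> x) x = (x \<bullet> b) *\<^sub>R grad \<phi> x + \<phi> x *\<^sub>R b" for x
  proof (rule grad_eqI)
    have "((\<lambda>x. x \<bullet> b) has_derivative (\<lambda>h. h \<bullet> b)) (at x)" by (auto intro!: derivative_eq_intros)
    from has_derivative_mult[OF this test_function_has_derivative[OF assms]]
    show "((\<lambda>x. (x \<bullet> b) * \<phi> x) has_derivative (\<lambda>h. ((x \<bullet> b) *\<^sub>R grad \<phi> x + \<phi> x *\<^sub>R b) \<bullet> h)) (at x)"
      by (rule has_derivative_eq_rhs) (auto simp: fun_eq_iff inner_add_left inner_add_right inner_commute mult.commute)
  qed
  then show ?thesis by (simp add: jet_def coord_mult_def fun_eq_iff)
qed

section \<open>The form domain over a bounded open set\<close>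

locale bounded_domain =
  fixes \<Omega> :: "'a::euclidean_space set"
  assumes open_domain: "open \<Omega>" and bounded_domain: "bounded \<Omega>"
begin

abbreviation "T \<equiv> test_functions \<Omega>"
abbreviation "ip \<equiv> L2_inner \<Omega> :: ('a \<Rightarrow> real \<times> 'a) \<Rightarrow> _"
abbreviation "m \<equiv> mass \<Omega>"
abbreviation "a \<equiv> energy \<Omega>"
abbreviation "V \<equiv> H10_pairs \<Omega>"
abbreviation "S \<equiv> L2 \<Omega> :: ('a \<Rightarrow> real \<times> 'a) set"

lemma lmeasurable_domain: "\<Omega> \<in> lmeasurable"
  using bounded_domain open_domain by (rule lmeasurable_open)

lemma sets_domain: "\<Omega> \<in> sets lebesgue"
  using lmeasurable_domain by (rule fmeasurableD)

lemma semi_inner_mass: "semi_inner S m"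
  unfolding mass_def[abs_def]
  by (rule semi_inner_pullback[OF semi_inner_L2 subspace_L2]) (auto simp: L2_fst fun_eq_iff)

lemma semi_inner_energy: "semi_inner S a"
  unfolding energy_def[abs_def]
  by (rule semi_inner_pullback[OF semi_inner_L2 subspace_L2]) (auto simp: L2_snd fun_eq_iff)

sublocale ip: semi_inner S ip by (rule semi_inner_L2)
sublocale m: semi_inner S m by (rule semi_inner_mass)
sublocale a: semi_inner S a by (rule semi_inner_energy)

lemma mass_integrable: "U \<in> S \<Longrightarrow> W \<in> S \<Longrightarrow> integrable (lebesgue_on \<Omega>) (\<lambda>x. fst (U x) * fst (W x))"
  using L2_inner_integrable[OF L2_fst L2_fst, of U \<Omega> W] by simp

lemma energy_integrable: "U \<in> S \<Longrightarrow> W \<in> S \<Longrightarrow> integrable (lebesgue_on \<Omega>) (\<lambda>x. snd (U x) \<bullet> snd (W x))"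
  using L2_inner_integrable[OF L2_snd L2_snd, of U \<Omega> W] by simp

lemma mass_eq: "m U W = (\<integral>x. fst (U x) * fst (W x) \<partial>lebesgue_on \<Omega>)"
  by (simp add: mass_def L2_inner_def)

lemma energy_eq: "a U W = (\<integral>x. snd (U x) \<bullet> snd (W x) \<partial>lebesgue_on \<Omega>)"
  by (simp add: energy_def L2_inner_def)

lemma ip_eq: "U \<in> S \<Longrightarrow> W \<in> S \<Longrightarrow> ip U W = m U W + a U W"
  by (simp add: L2_inner_def mass_eq energy_eq inner_prod_def mass_integrable energy_integrable)

lemma mass_le_ip: "U \<in> S \<Longrightarrow> m U U \<le> ip U U"
  and energy_le_ip: "U \<in> S \<Longrightarrow> a U U \<le> ip U U"
  using a.nonneg m.nonneg by (simp_all add: ip_eq)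

lemma jet_L2:
  assumes "\<phi> \<in> T"
  shows "jet \<phi> \<in> S"
proof -
  obtain K where K: "K \<subseteq> \<Omega>" "C1_supported K \<phi> (grad \<phi>)" using test_function_C1[OF assms] by blast
  have cont: "continuous_on UNIV (jet \<phi>)"
    using K unfolding jet_def[abs_def] C1_supported_def by (intro continuous_on_Pair) auto
  have zero: "jet \<phi> x = 0" if "x \<notin> K" for x using K that by (simp add: jet_def C1_supported_def zero_prod_def)
  have "jet \<phi> \<in> borel_measurable (lebesgue_on \<Omega>)"
    using cont by (intro measurable_restrict_space1 measurable_completion) (simp add: borel_measurable_continuous_onI)
  moreover have "integrable lborel (\<lambda>x. (norm (jet \<phi> x))\<^sup>2)"
    by (rule C1_supported_integrable[OF K(2)]) (auto intro!: continuous_intros cont simp: zero)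
  then have "integrable (lebesgue_on \<Omega>) (\<lambda>x. (norm (jet \<phi> x))\<^sup>2)"
    using K(1) zero
    by (subst lebesgue_on_eq_lborel(2)[OF _ _ sets_domain])
      (auto intro!: borel_measurable_continuous_onI continuous_intros cont)
  ultimately show ?thesis by (simp add: L2_def)
qed

lemma V_subset: "V \<subseteq> S"
  by (auto simp: H10_pairs_def)

lemma H10_pairsE:
  assumes "U \<in> V"
  obtains \<phi> where "\<And>n. \<phi> n \<in> T" "(\<lambda>n::nat. sq ip (jet (\<phi> n) - U)) \<longlonglongrightarrow> 0"
  using assms by (auto simp: H10_pairs_def)

lemma jet_in_V:
  assumes "\<phi> \<in> T" shows "jet \<phi> \<in> V"
  using assms jet_L2[OF assms] ip.zero_left[OF ip.mem_zero]
  by (auto simp: H10_pairs_def intro!: exI[of _ "\<lambda>_. \<phi>"])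

lemma subspace_V: "subspace V"
  unfolding subspace_def
proof (intro conjI ballI allI)
  have "jet (\<lambda>x. 0) = (0 :: 'a \<Rightarrow> real \<times> 'a)"
    using jet_cmult[OF zero_test_function, of 0] by simp
  then show "0 \<in> V" using jet_in_V[OF zero_test_function] by simp
next
  fix U W assume U: "U \<in> V" and W: "W \<in> V"
  obtain \<phi> where \<phi>: "\<And>n. \<phi> n \<in> T" "(\<lambda>n::nat. sq ip (jet (\<phi> n) - U)) \<longlonglongrightarrow> 0"
    using H10_pairsE[OF U] by blast
  obtain \<psi> where \<psi>: "\<And>n. \<psi> n \<in> T" "(\<lambda>n::nat. sq ip (jet (\<psi> n) - W)) \<longlonglongrightarrow> 0"
    using H10_pairsE[OF W] by blast
  have US: "U \<in> S" "W \<in> S" using U W V_subset by auto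
  let ?\<theta> = "\<lambda>n x. \<phi> n x + \<psi> n x"
  have \<theta>: "?\<theta> n \<in> T" for n by (intro test_function_add \<phi> \<psi>)
  have "(\<lambda>n. sq ip (jet (?\<theta> n) - (U + W))) \<longlonglongrightarrow> 0"
  proof (rule Lim_null_comparison)
    show "\<forall>\<^sub>F n in sequentially. norm (sq ip (jet (?\<theta> n) - (U + W)))
        \<le> 2 * sq ip (jet (\<phi> n) - U) + 2 * sq ip (jet (\<psi> n) - W)"
    proof (intro always_eventually allI)
      fix n
      have e: "jet (?\<theta> n) - (U + W) = (jet (\<phi> n) - U) + (jet (\<psi> n) - W)"
        by (simp add: jet_add[OF \<phi>(1) \<psi>(1)])
      have d: "jet (\<phi> n) - U \<in> S" "jet (\<psi> n) - W \<in> S"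
        by (intro ip.mem_diff jet_L2 \<phi> \<psi> US)+
      show "norm (sq ip (jet (?\<theta> n) - (U + W)))
        \<le> 2 * sq ip (jet (\<phi> n) - U) + 2 * sq ip (jet (\<psi> n) - W)"
        unfolding e using ip.sq_add_le[OF d] ip.nonneg[OF ip.mem_add[OF d]]
        by (simp only: real_norm_def abs_of_nonneg)
    qed
    show "(\<lambda>n. 2 * sq ip (jet (\<phi> n) - U) + 2 * sq ip (jet (\<psi> n) - W)) \<longlonglongrightarrow> 0"
      using tendsto_add[OF tendsto_mult_left[OF \<phi>(2), of 2] tendsto_mult_left[OF \<psi>(2), of 2]] by simp
  qed
  then show "U + W \<in> V" using \<theta> US by (auto simp: H10_pairs_def ip.mem_add intro!: exI[of _ ?\<theta>])
next
  fix c U assume U: "U \<in> V"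
  obtain \<phi> where \<phi>: "\<And>n. \<phi> n \<in> T" "(\<lambda>n::nat. sq ip (jet (\<phi> n) - U)) \<longlonglongrightarrow> 0"
    using H10_pairsE[OF U] by blast
  have US: "U \<in> S" using U V_subset by auto
  have e: "jet (\<lambda>x. c * \<phi> n x) - c *\<^sub>R U = c *\<^sub>R (jet (\<phi> n) - U)" for n
    by (simp add: jet_cmult[OF \<phi>(1)] scaleR_diff_right)
  have "sq ip (jet (\<lambda>x. c * \<phi> n x) - c *\<^sub>R U)
      = c\<^sup>2 * sq ip (jet (\<phi> n) - U)" for n
    unfolding e using ip.mem_diff[OF jet_L2[OF \<phi>(1)] US, of n]
    by (simp add: ip.scale_left ip.scale_right ip.mem_scale power2_eq_square)
  then have "(\<lambda>n. sq ip (jet (\<lambda>x. c * \<phi> n x) - c *\<^sub>R U)) \<longlonglongrightarrow> 0"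
    using tendsto_mult_left[OF \<phi>(2), of "c\<^sup>2"] by simp
  then show "c *\<^sub>R U \<in> V"
    using US \<phi>(1) by (auto simp: H10_pairs_def ip.mem_scale intro!: exI[of _ "\<lambda>n x. c * \<phi> n x"] test_function_cmult)
qed

lemma semi_inner_V: "semi_inner V m" "semi_inner V a"
  by (unfold_locales; use V_subset subspace_V in
    \<open>auto simp: subset_iff m.add_left m.scale_left m.nonneg a.add_left a.scale_left a.nonneg intro: m.sym a.sym\<close>)+

lemma coord_mult_L2:
  assumes U: "U \<in> S"
  shows "coord_mult b U \<in> S"
proof -
  obtain B where B: "\<And>x. x \<in> \<Omega> \<Longrightarrow> norm x \<le> B" using bounded_domain bounded_iff by blast
  have bd: "\<bar>x \<bullet> b\<bar> \<le> B * norm b" if "x \<in> \<Omega>" for x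
    using Cauchy_Schwarz_ineq2[of x b] mult_right_mono[OF B[OF that] norm_ge_zero[of b]] by linarith
  have 1: "(\<lambda>x. (x \<bullet> b) *\<^sub>R (fst \<circ> U) x) \<in> L2 \<Omega>"
    by (rule L2_mult_bounded[OF _ bd L2_fst[OF U]]) auto
  have 2: "(\<lambda>x. (x \<bullet> b) *\<^sub>R (snd \<circ> U) x) \<in> L2 \<Omega>"
    by (rule L2_mult_bounded[OF _ bd L2_snd[OF U]]) auto
  have 3: "(\<lambda>r. r *\<^sub>R b) \<circ> (fst \<circ> U) \<in> L2 \<Omega>"
    by (rule L2_linear_image[OF bounded_linear_scaleR_left L2_fst[OF U]])
  show ?thesis
    using L2_Pair[OF 1 L2_add[OF 2 3]] by (simp add: coord_mult_def[abs_def] plus_fun_def)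
qed

text \<open>Coordinates are bounded on a bounded domain, so multiplication by one is bounded for the
  norm of function and gradient together. Approximating test functions can therefore be multiplied
  term by term.\<close>

lemma ip_coord_mult_le: "\<exists>C. \<forall>U\<in>S. sq ip (coord_mult b U) \<le> C * ip U U"
proof -
  obtain B where B: "\<And>x. x \<in> \<Omega> \<Longrightarrow> norm x \<le> B" using bounded_domain bounded_iff by blast
  \<comment> \<open>The function enters with weight
    \<open>(B * norm b)\<^sup>2 + 2 * (norm b)\<^sup>2\<close> and its gradient with
    \<open>2 * (B * norm b)\<^sup>2\<close>; \<open>C\<close> is the sum of the two.\<close>
  define C where "C = 3 * (B * norm b)\<^sup>2 + 2 * (norm b)\<^sup>2"
  have "sq ip (coord_mult b U) \<le> C * ip U U" if U: "U \<in> S" for U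
  proof -
    have "(\<integral>x. coord_mult b U x \<bullet> coord_mult b U x \<partial>lebesgue_on \<Omega>) \<le> (\<integral>x. C * (U x \<bullet> U x) \<partial>lebesgue_on \<Omega>)"
    proof (rule integral_mono)
      fix x assume "x \<in> space (lebesgue_on \<Omega>)"
      then have "x \<in> \<Omega>" by (simp add: space_restrict_space)
      then have "\<bar>x \<bullet> b\<bar> \<le> B * norm b"
        using Cauchy_Schwarz_ineq2[of x b] mult_right_mono[OF B norm_ge_zero[of b]] by fastforce
      then have xb: "(x \<bullet> b)\<^sup>2 \<le> (B * norm b)\<^sup>2" by (metis abs_ge_zero power2_abs power_mono)
      define u g where "u = fst (U x)" and "g = snd (U x)"
      have "coord_mult b U x \<bullet> coord_mult b U x = (x \<bullet> b)\<^sup>2 * u\<^sup>2 + (norm ((x \<bullet> b) *\<^sub>R g + u *\<^sub>R b))\<^sup>2"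
        unfolding power2_norm_eq_inner by (simp add: coord_mult_def u_def g_def power2_eq_square mult_ac)
      also have "\<dots> \<le> (x \<bullet> b)\<^sup>2 * u\<^sup>2 + (2 * ((x \<bullet> b)\<^sup>2 * (norm g)\<^sup>2) + 2 * (u\<^sup>2 * (norm b)\<^sup>2))"
        using norm_add_sq_le[of "(x \<bullet> b) *\<^sub>R g" "u *\<^sub>R b"] by (simp add: power_mult_distrib)
      also have "\<dots> \<le> (B * norm b)\<^sup>2 * u\<^sup>2 + (2 * ((B * norm b)\<^sup>2 * (norm g)\<^sup>2) + 2 * (u\<^sup>2 * (norm b)\<^sup>2))"
        using xb by (intro add_mono mult_mono order_refl) auto
      also have "\<dots> \<le> C * (u\<^sup>2 + (norm g)\<^sup>2)"
      proof -
        have "C * (u\<^sup>2 + (norm g)\<^sup>2) - ((B * norm b)\<^sup>2 * u\<^sup>2 + (2 * ((B * norm b)\<^sup>2 * (norm g)\<^sup>2) + 2 * (u\<^sup>2 * (norm b)\<^sup>2)))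
            = 2 * ((B * norm b)\<^sup>2 * u\<^sup>2) + (B * norm b)\<^sup>2 * (norm g)\<^sup>2 + 2 * ((norm b)\<^sup>2 * (norm g)\<^sup>2)"
          by (simp add: C_def algebra_simps)
        moreover have "\<dots> \<ge> 0" by (intro add_nonneg_nonneg mult_nonneg_nonneg) auto
        ultimately show ?thesis by linarith
      qed
      also have "u\<^sup>2 + (norm g)\<^sup>2 = U x \<bullet> U x"
        unfolding power2_norm_eq_inner by (simp add: u_def g_def inner_prod_def power2_eq_square)
      finally show "coord_mult b U x \<bullet> coord_mult b U x \<le> C * (U x \<bullet> U x)" .
    qed (use L2_inner_integrable U coord_mult_L2[OF U] in auto)
    then show ?thesis by (simp add: L2_inner_def)
  qed
  then show ?thesis by blast
qed

lemma coord_mult_diff: "coord_mult b (U - W) = coord_mult b U - coord_mult b W"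
  by (simp add: coord_mult_def fun_eq_iff algebra_simps)

lemma coord_mult_V:
  assumes U: "U \<in> V"
  shows "coord_mult b U \<in> V"
proof -
  obtain \<phi> where \<phi>: "\<And>n. \<phi> n \<in> T" "(\<lambda>n::nat. sq ip (jet (\<phi> n) - U)) \<longlonglongrightarrow> 0"
    using H10_pairsE[OF U] by blast
  have US: "U \<in> S" using U V_subset by auto
  obtain C where C: "\<And>U. U \<in> S \<Longrightarrow> sq ip (coord_mult b U) \<le> C * ip U U"
    using ip_coord_mult_le by blast
  let ?\<theta> = "\<lambda>n x. (x \<bullet> b) * \<phi> n x"
  have \<theta>: "?\<theta> n \<in> T" for n by (intro test_function_coordinate_mult \<phi>)
  have "(\<lambda>n. sq ip (jet (?\<theta> n) - coord_mult b U)) \<longlonglongrightarrow> 0"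
  proof (rule Lim_null_comparison)
    show "\<forall>\<^sub>F n in sequentially. norm (sq ip (jet (?\<theta> n) - coord_mult b U))
        \<le> C * sq ip (jet (\<phi> n) - U)"
    proof (intro always_eventually allI)
      fix n
      have "jet (?\<theta> n) - coord_mult b U = coord_mult b (jet (\<phi> n) - U)"
        by (simp add: jet_coord_mult[OF \<phi>(1)] coord_mult_diff)
      moreover have "jet (\<phi> n) - U \<in> S" by (intro ip.mem_diff jet_L2 \<phi> US)
      ultimately show "norm (sq ip (jet (?\<theta> n) - coord_mult b U))
        \<le> C * sq ip (jet (\<phi> n) - U)"
        using C ip.nonneg[OF coord_mult_L2] by simp
    qed
    show "(\<lambda>n. C * sq ip (jet (\<phi> n) - U)) \<longlonglongrightarrow> 0"
      using tendsto_mult_left[OF \<phi>(2), of C] by simp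
  qed
  then show ?thesis using \<theta> coord_mult_L2[OF US] by (auto simp: H10_pairs_def intro!: exI[of _ ?\<theta>])
qed

section \<open>Partial derivatives and commutator identities\<close>

lemma partial_L2:
  assumes U: "U \<in> S"
  shows "partial b U \<in> S"
proof -
  have "(\<lambda>g. g \<bullet> b) \<circ> (snd \<circ> U) \<in> L2 \<Omega>"
    by (rule L2_linear_image[OF bounded_linear_inner_left L2_snd[OF U]])
  from L2_Pair[OF this L2_zero] show ?thesis by (simp add: partial_def[abs_def])
qed

lemma partial_diff: "partial b (U - W) = partial b U - partial b W"
  by (simp add: partial_def fun_eq_iff inner_diff_left)

text \<open>Summed over the coordinates, the derivative terms of the commutator inequality become
  the energy, which for a normalized eigenfunction is its eigenvalue.\<close>

lemma sum_mass_partial: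
  assumes U: "U \<in> S"
  shows "(\<Sum>b\<in>Basis. sq m (partial b U)) = a U U"
proof -
  have "(\<Sum>b\<in>Basis. sq m (partial b U))
      = (\<integral>x. (\<Sum>b\<in>Basis. fst (partial b U x) * fst (partial b U x)) \<partial>lebesgue_on \<Omega>)"
    unfolding mass_eq
    by (rule Bochner_Integration.integral_sum[symmetric]) (intro mass_integrable partial_L2 U)
  also have "\<dots> = a U U"
    unfolding energy_eq
    by (rule Bochner_Integration.integral_cong) (auto simp: partial_def euclidean_inner[of "snd (U _)" "snd (U _)"])
  finally show ?thesis .
qed

lemma mass_partial_le:
  assumes "U \<in> S" "b \<in> Basis"
  shows "sq m (partial b U) \<le> a U U"
  unfolding sum_mass_partial[OF assms(1), symmetric]
  by (rule member_le_sum) (auto simp: assms intro!: m.nonneg partial_L2)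

text \<open>The commutator of minus the Laplacian with a coordinate, in weak form. It holds
  pointwise under the integral: the terms containing both gradients agree, and the products of a
  function with a partial derivative remain.\<close>

lemma energy_coord_mult:
  assumes U: "U \<in> S" and W: "W \<in> S"
  shows "a (coord_mult b U) W = a U (coord_mult b W) - m (partial b U) W + m U (partial b W)"
proof -
  have "a U (coord_mult b W) - m (partial b U) W + m U (partial b W)
    = (\<integral>x. snd (U x) \<bullet> snd (coord_mult b W x) - fst (partial b U x) * fst (W x)
        + fst (U x) * fst (partial b W x) \<partial>lebesgue_on \<Omega>)"
    unfolding energy_eq mass_eq
    using energy_integrable[OF U coord_mult_L2[OF W]] mass_integrable[OF partial_L2[OF U] W]
      mass_integrable[OF U partial_L2[OF W]] by simp
  also have "\<dots> = a (coord_mult b U) W"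
    unfolding energy_eq
    by (rule Bochner_Integration.integral_cong)
      (auto simp: coord_mult_def partial_def inner_add_left inner_add_right inner_commute algebra_simps)
  finally show ?thesis by simp
qed

lemma mass_coord_mult: "m (coord_mult b U) W = m U (coord_mult b W)"
  unfolding mass_eq by (rule Bochner_Integration.integral_cong) (auto simp: coord_mult_def)

text \<open>The product rule stored in the gradient slot of \<open>coord_mult\<close>, together with
  \<open>b \<bullet> b = 1\<close>.\<close>

lemma mass_commutator:
  assumes U: "U \<in> S" and b: "b \<in> Basis"
  shows "m (partial b (coord_mult b U)) U = m (partial b U) (coord_mult b U) + m U U"
proof -
  have "m (partial b U) (coord_mult b U) + m U U
     = (\<integral>x. fst (partial b U x) * fst (coord_mult b U x) + fst (U x) * fst (U x) \<partial>lebesgue_on \<Omega>)"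
    unfolding mass_eq
    using mass_integrable[OF partial_L2[OF U] coord_mult_L2[OF U]] mass_integrable[OF U U] by simp
  also have "\<dots> = m (partial b (coord_mult b U)) U"
    unfolding mass_eq
    by (rule Bochner_Integration.integral_cong)
      (use b in \<open>auto simp: coord_mult_def partial_def inner_add_left algebra_simps\<close>)
  finally show ?thesis by simp
qed

lemma partial_skew_jet:
  assumes "\<phi> \<in> T" "\<psi> \<in> T"
  shows "m (partial b (jet \<phi>)) (jet \<psi>) = - m (jet \<phi>) (partial b (jet \<psi>))"
proof -
  obtain K where K: "K \<subseteq> \<Omega>" "C1_supported K \<phi> (grad \<phi>)" using test_function_C1[OF assms(1)] by blast
  obtain L where L: "L \<subseteq> \<Omega>" "C1_supported L \<psi> (grad \<psi>)" using test_function_C1[OF assms(2)] by blast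
  have [measurable]: "\<phi> \<in> borel_measurable borel" "grad \<phi> \<in> borel_measurable borel"
    "\<psi> \<in> borel_measurable borel" "grad \<psi> \<in> borel_measurable borel"
    using K L by (auto simp: C1_supported_def intro: borel_measurable_continuous_onI)
  have "(\<integral>x. \<phi> x * (grad \<psi> x \<bullet> b) \<partial>lborel) = - (\<integral>x. (grad \<phi> x \<bullet> b) * \<psi> x \<partial>lborel)"
    by (rule integral_by_parts_C1_supported[OF K(2) L(2)])
  moreover have "(\<integral>x. \<phi> x * (grad \<psi> x \<bullet> b) \<partial>lebesgue_on \<Omega>) = (\<integral>x. \<phi> x * (grad \<psi> x \<bullet> b) \<partial>lborel)"
    using K by (intro lebesgue_on_eq_lborel(1) sets_domain) (auto simp: C1_supported_def)
  moreover have "(\<integral>x. (grad \<phi> x \<bullet> b) * \<psi> x \<partial>lebesgue_on \<Omega>) = (\<integral>x. (grad \<phi> x \<bullet> b) * \<psi> x \<partial>lborel)"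
    using K by (intro lebesgue_on_eq_lborel(1) sets_domain) (auto simp: C1_supported_def)
  ultimately show ?thesis by (simp add: mass_eq jet_def partial_def)
qed

lemma tendsto_mass_energy_jet:
  assumes \<phi>: "\<And>n. \<phi> n \<in> T" "(\<lambda>n::nat. sq ip (jet (\<phi> n) - U)) \<longlonglongrightarrow> 0"
    and U: "U \<in> S"
  shows "(\<lambda>n. sq m (jet (\<phi> n) - U)) \<longlonglongrightarrow> 0"
    and "(\<lambda>n. sq a (jet (\<phi> n) - U)) \<longlonglongrightarrow> 0"
    and "b \<in> Basis \<Longrightarrow> (\<lambda>n. sq m (partial b (jet (\<phi> n)) - partial b U)) \<longlonglongrightarrow> 0"
proof -
  have d: "jet (\<phi> n) - U \<in> S" for n by (intro ip.mem_diff jet_L2 \<phi> U)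
  show "(\<lambda>n. sq m (jet (\<phi> n) - U)) \<longlonglongrightarrow> 0"
    by (rule Lim_null_comparison[OF _ \<phi>(2)]) (use d m.nonneg mass_le_ip in auto)
  show *: "(\<lambda>n. sq a (jet (\<phi> n) - U)) \<longlonglongrightarrow> 0"
    by (rule Lim_null_comparison[OF _ \<phi>(2)]) (use d a.nonneg energy_le_ip in auto)
  show "(\<lambda>n. sq m (partial b (jet (\<phi> n)) - partial b U)) \<longlonglongrightarrow> 0"
    if b: "b \<in> Basis"
    unfolding partial_diff[symmetric]
    by (rule Lim_null_comparison[OF _ *]) (use d b m.nonneg[OF partial_L2] mass_partial_le in auto)
qed

text \<open>Integration by parts has no boundary term for test functions, and both sides are
  continuous along approximating jets.\<close>

lemma partial_skew:
  assumes U: "U \<in> V" and W: "W \<in> V" and b: "b \<in> Basis"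
  shows "m (partial b U) W = - m U (partial b W)"
proof -
  obtain \<phi> where \<phi>: "\<And>n. \<phi> n \<in> T" "(\<lambda>n::nat. sq ip (jet (\<phi> n) - U)) \<longlonglongrightarrow> 0"
    using H10_pairsE[OF U] by blast
  obtain \<psi> where \<psi>: "\<And>n. \<psi> n \<in> T" "(\<lambda>n::nat. sq ip (jet (\<psi> n) - W)) \<longlonglongrightarrow> 0"
    using H10_pairsE[OF W] by blast
  have S: "U \<in> S" "W \<in> S" using U W V_subset by auto
  note \<phi>_lim = tendsto_mass_energy_jet[OF \<phi> S(1)] and \<psi>_lim = tendsto_mass_energy_jet[OF \<psi> S(2)]
  have 1: "(\<lambda>n. m (partial b (jet (\<phi> n))) (jet (\<psi> n))) \<longlonglongrightarrow> m (partial b U) W"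
    by (intro m.tendsto_form partial_L2 jet_L2 \<phi>(1) \<psi>(1) S \<phi>_lim \<psi>_lim b)
  have "(\<lambda>n. m (jet (\<phi> n)) (partial b (jet (\<psi> n)))) \<longlonglongrightarrow> m U (partial b W)"
    by (intro m.tendsto_form partial_L2 jet_L2 \<phi>(1) \<psi>(1) S \<phi>_lim \<psi>_lim b)
  then have "(\<lambda>n. m (partial b (jet (\<phi> n))) (jet (\<psi> n))) \<longlonglongrightarrow> - m U (partial b W)"
    unfolding partial_skew_jet[OF \<phi>(1) \<psi>(1)] by (rule tendsto_minus)
  then show ?thesis using 1 LIMSEQ_unique by blast
qed

text \<open>For a pair in the closure the weak gradient identity is skewness of the partial
  derivative tested against a jet. The remaining conditions are the \<open>L2\<close> approximation
  of the pair, written as one inner product.\<close>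

lemma H10_iff: "H10 \<Omega> u g \<longleftrightarrow> (\<lambda>x. (u x, g x)) \<in> V"
proof -
  define U where "U = (\<lambda>x. (u x, g x))"
  have e: "(\<integral>x. (u x - \<phi> x)\<^sup>2 + (norm (g x - grad \<phi> x))\<^sup>2 \<partial>lebesgue_on \<Omega>) = sq ip (jet \<phi> - U)" for \<phi>
    unfolding L2_inner_def U_def
  proof (rule Bochner_Integration.integral_cong[OF refl])
    fix x
    have "(u x - \<phi> x)\<^sup>2 = (\<phi> x - u x) * (\<phi> x - u x)"
      by (simp add: power2_eq_square algebra_simps)
    moreover have "(norm (g x - grad \<phi> x))\<^sup>2 = (grad \<phi> x - g x) \<bullet> (grad \<phi> x - g x)"
      by (metis norm_minus_commute power2_norm_eq_inner)
    ultimately show "(u x - \<phi> x)\<^sup>2 + (norm (g x - grad \<phi> x))\<^sup>2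
        = (jet \<phi> - (\<lambda>x. (u x, g x))) x \<bullet> (jet \<phi> - (\<lambda>x. (u x, g x))) x"
      by (simp add: jet_def)
  qed
  have L: "u \<in> L2 \<Omega> \<and> g \<in> L2 \<Omega> \<longleftrightarrow> U \<in> S"
    using L2_Pair[of u \<Omega> g] L2_fst[of U \<Omega>] L2_snd[of U \<Omega>] by (auto simp: U_def o_def)
  have "weak_gradient \<Omega> u g" if "U \<in> V"
    unfolding weak_gradient_def
  proof (intro ballI)
    fix \<phi> and b :: 'a assume "\<phi> \<in> T" "b \<in> Basis"
    then have "m (partial b U) (jet \<phi>) = - m U (partial b (jet \<phi>))"
      using that jet_in_V by (intro partial_skew)
    then show "(\<integral>x. u x * (grad \<phi> x \<bullet> b) \<partial>lebesgue_on \<Omega>) = - (\<integral>x. (g x \<bullet> b) * \<phi> x \<partial>lebesgue_on \<Omega>)"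
      by (simp add: mass_eq partial_def U_def jet_def)
  qed
  then show ?thesis
    unfolding H10_def e U_def[symmetric] using L by (auto simp: H10_pairs_def)
qed

text \<open>Each member of a sequence is replaced by a test function at squared distance below
  \<open>1 / real (Suc n)\<close>. Compactness is then Rellich's theorem for the test functions; for
  completeness the limit of the pairs exists in \<open>L2\<close>, and the same test functions
  approximate it.\<close>

lemma compact_form_V: "compact_form V m a"
proof -
  interpret Vm: semi_inner V m by (rule semi_inner_V)
  interpret Va: semi_inner V a by (rule semi_inner_V)
  have approx: "\<exists>\<phi>\<in>T. sq ip (jet \<phi> - U) < \<epsilon>" if U: "U \<in> V" and \<epsilon>: "\<epsilon> > 0" for U and \<epsilon> :: real
  proof -
    obtain \<phi> where \<phi>: "\<And>n. \<phi> n \<in> T" "(\<lambda>n::nat. sq ip (jet (\<phi> n) - U)) \<longlonglongrightarrow> 0"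
      using H10_pairsE[OF U] by blast
    from order_tendstoD(2)[OF \<phi>(2) \<epsilon>] obtain n where "sq ip (jet (\<phi> n) - U) < \<epsilon>"
      by (auto simp: eventually_sequentially)
    then show ?thesis using \<phi>(1) by blast
  qed
  have approx_seq: "\<exists>\<phi>. \<forall>n. \<phi> n \<in> T \<and> sq ip (jet (\<phi> n) - v n) < 1 / real (Suc n)"
    if "\<And>n. v n \<in> V" for v :: "nat \<Rightarrow> 'a \<Rightarrow> real \<times> 'a"
  proof -
    have "\<forall>n. \<exists>\<phi>. \<phi> \<in> T \<and> sq ip (jet \<phi> - v n) < 1 / real (Suc n)"
    proof
      fix n
      have "1 / real (Suc n) > 0" by simp
      from approx[OF that[of n] this]
      show "\<exists>\<phi>. \<phi> \<in> T \<and> sq ip (jet \<phi> - v n) < 1 / real (Suc n)" by blast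
    qed
    then show ?thesis by (rule choice)
  qed
  show ?thesis
  proof
    fix v :: "nat \<Rightarrow> 'a \<Rightarrow> real \<times> 'a" and C
    assume v: "\<And>n. v n \<in> V" and mC: "\<And>n. m (v n) (v n) \<le> C" and aC: "\<And>n. a (v n) (v n) \<le> C"
    have vS: "v n \<in> S" for n using v V_subset by auto
    obtain \<phi> where \<phi>: "\<And>n. \<phi> n \<in> T"
      and close: "\<And>n. sq ip (jet (\<phi> n) - v n) < 1 / real (Suc n)"
      using approx_seq[of v, OF v] by blast
    have dS: "jet (\<phi> n) - v n \<in> S" for n by (intro ip.mem_diff jet_L2 \<phi> vS)
    have close1: "sq ip (jet (\<phi> n) - v n) < 1" for n
      using close[of n] by (rule order_less_le_trans) simp
    have jm: "sq m (jet (\<phi> n)) \<le> 2 * C + 2" for n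
      using m.sq_add_le[OF dS vS, of n n] mass_le_ip[OF dS, of n] close1[of n] mC[of n] by simp
    have ja: "sq a (jet (\<phi> n)) \<le> 2 * C + 2" for n
      using a.sq_add_le[OF dS vS, of n n] energy_le_ip[OF dS, of n] close1[of n] aC[of n] by simp
    have supp: "C1_supported (closure \<Omega>) (\<phi> n) (grad (\<phi> n))" for n
    proof -
      obtain K where K: "K \<subseteq> \<Omega>" "C1_supported K (\<phi> n) (grad (\<phi> n))"
        using test_function_C1[OF \<phi>[of n]] by blast
      show ?thesis
      proof (rule C1_supported_mono[OF K(2)])
        show "K \<subseteq> closure \<Omega>" using K(1) closure_subset by (rule order_trans)
        show "compact (closure \<Omega>)" using bounded_domain by simp
      qed
    qed
    have zero: "\<phi> n x = 0" "grad (\<phi> n) x = 0" if "x \<notin> \<Omega>" for n x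
      using test_function_C1[OF \<phi>[of n]] that by (auto simp: C1_supported_def)
    have [measurable]: "\<phi> n \<in> borel_measurable borel" "grad (\<phi> n) \<in> borel_measurable borel" for n
      using supp[of n] by (auto simp: C1_supported_def intro: borel_measurable_continuous_onI)
    have "\<exists>r :: nat \<Rightarrow> nat. strict_mono r \<and>
      (\<forall>\<epsilon>>0. \<exists>N. \<forall>i\<ge>N. \<forall>j\<ge>N. (\<integral>x. (\<phi> (r i) x - \<phi> (r j) x)\<^sup>2 \<partial>lborel) < \<epsilon>)"
    proof (rule Rellich_test_functions[OF supp])
      show "compact (closure \<Omega>)" using bounded_domain by simp
      show "(\<integral>x. (\<phi> n x)\<^sup>2 \<partial>lborel) \<le> 2 * C + 2" for n
      proof -
        have "(\<integral>x. (\<phi> n x)\<^sup>2 \<partial>lebesgue_on \<Omega>) = (\<integral>x. (\<phi> n x)\<^sup>2 \<partial>lborel)"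
          by (rule lebesgue_on_eq_lborel(1)[OF _ _ sets_domain]) (auto simp: zero)
        then show ?thesis using jm[of n] by (simp add: mass_eq jet_def power2_eq_square)
      qed
      show "(\<integral>x. (norm (grad (\<phi> n) x))\<^sup>2 \<partial>lborel) \<le> 2 * C + 2" for n
      proof -
        have "(\<integral>x. (norm (grad (\<phi> n) x))\<^sup>2 \<partial>lebesgue_on \<Omega>) = (\<integral>x. (norm (grad (\<phi> n) x))\<^sup>2 \<partial>lborel)"
          by (rule lebesgue_on_eq_lborel(1)[OF _ _ sets_domain]) (auto simp: zero)
        then show ?thesis using ja[of n] by (simp add: energy_eq jet_def power2_norm_eq_inner)
      qed
    qed
    then obtain r :: "nat \<Rightarrow> nat" where r: "strict_mono r"
      and rC: "\<And>\<epsilon>. \<epsilon> > 0 \<Longrightarrow> \<exists>N. \<forall>i\<ge>N. \<forall>j\<ge>N. (\<integral>x. (\<phi> (r i) x - \<phi> (r j) x)\<^sup>2 \<partial>lborel) < \<epsilon>"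
      by blast
    have "\<exists>N. \<forall>i\<ge>N. \<forall>j\<ge>N. sq m (v (r i) - v (r j)) < \<epsilon>" if \<epsilon>: "\<epsilon> > 0" for \<epsilon>
    proof -
      \<comment> \<open>The difference splits into three parts with squared norms below
        \<epsilon>/16; applying the bound for a sum twice counts them 4, 4 and 2 times, which stays
        below \<epsilon>.\<close>
      obtain N1 where N1: "\<And>i j. i \<ge> N1 \<Longrightarrow> j \<ge> N1 \<Longrightarrow> (\<integral>x. (\<phi> (r i) x - \<phi> (r j) x)\<^sup>2 \<partial>lborel) < \<epsilon> / 16"
        using rC[of "\<epsilon> / 16"] \<epsilon> by auto
      obtain N2 where N2: "1 / real (Suc N2) < \<epsilon> / 16"
        using \<epsilon> nat_approx_posE[of "\<epsilon> / 16"] by auto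
      have "sq m (v (r i) - v (r j)) < \<epsilon>" if ij: "i \<ge> max N1 N2" "j \<ge> max N1 N2" for i j
      proof -
        have small: "sq m (jet (\<phi> (r k)) - v (r k)) < \<epsilon> / 16" if "k \<ge> N2" for k
        proof -
          have "1 / real (Suc (r k)) \<le> 1 / real (Suc N2)"
            using seq_suble[OF r, of k] that by (intro divide_left_mono) auto
          then show ?thesis using mass_le_ip[OF dS, of "r k"] close[of "r k"] N2 by linarith
        qed
        have s: "sq m (jet (\<phi> (r i)) - v (r i)) < \<epsilon> / 16"
          "sq m (jet (\<phi> (r j)) - v (r j)) < \<epsilon> / 16"
          by (rule small, use ij in simp)+
        let ?x = "jet (\<phi> (r i)) - v (r i)" and ?y = "jet (\<phi> (r j)) - v (r j)"
          and ?w = "jet (\<phi> (r i)) - jet (\<phi> (r j))"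
        have wS: "?w \<in> S" by (intro ip.mem_diff jet_L2 \<phi>)
        have "m ?w ?w = (\<integral>x. (\<phi> (r i) x - \<phi> (r j) x)\<^sup>2 \<partial>lebesgue_on \<Omega>)"
          by (simp add: mass_eq jet_def power2_eq_square)
        also have "\<dots> = (\<integral>x. (\<phi> (r i) x - \<phi> (r j) x)\<^sup>2 \<partial>lborel)"
          by (rule lebesgue_on_eq_lborel(1)[OF _ _ sets_domain]) (auto simp: zero)
        also have "\<dots> < \<epsilon> / 16" using ij by (intro N1) auto
        finally have w: "m ?w ?w < \<epsilon> / 16" .
        have e: "v (r i) - v (r j) = (?w + ?y) - ?x" by simp
        have "sq m ((?w + ?y) - ?x) \<le> 2 * m (?w + ?y) (?w + ?y) + 2 * m ?x ?x"
          using m.parallelogram[OF m.mem_add[OF wS dS] dS, of "r j" "r i"]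
            m.nonneg[OF m.mem_add[OF m.mem_add[OF wS dS] dS], of "r j" "r i"] by linarith
        moreover have "m (?w + ?y) (?w + ?y) \<le> 2 * m ?w ?w + 2 * m ?y ?y" by (rule m.sq_add_le[OF wS dS])
        ultimately show ?thesis unfolding e using w s \<epsilon> by linarith
      qed
      then show ?thesis by blast
    qed
    then show "\<exists>r::nat \<Rightarrow> nat. strict_mono r \<and> (\<forall>\<epsilon>>0. \<exists>N. \<forall>i\<ge>N. \<forall>j\<ge>N. sq m (v (r i) - v (r j)) < \<epsilon>)"
      using r by blast
  next
    fix v :: "nat \<Rightarrow> 'a \<Rightarrow> real \<times> 'a"
    assume v: "\<And>n. v n \<in> V"
      and mC: "\<And>\<epsilon>. \<epsilon> > 0 \<Longrightarrow> \<exists>N. \<forall>i\<ge>N. \<forall>j\<ge>N. sq m (v i - v j) < \<epsilon>"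
      and aC: "\<And>\<epsilon>. \<epsilon> > 0 \<Longrightarrow> \<exists>N. \<forall>i\<ge>N. \<forall>j\<ge>N. sq a (v i - v j) < \<epsilon>"
    have vS: "v n \<in> S" for n using v V_subset by auto
    have "\<exists>N. \<forall>i\<ge>N. \<forall>j\<ge>N. sq ip (v i - v j) < \<epsilon>" if \<epsilon>: "\<epsilon> > 0" for \<epsilon>
    proof -
      obtain N1 where N1: "\<forall>i\<ge>N1. \<forall>j\<ge>N1. sq m (v i - v j) < \<epsilon> / 2" using mC[of "\<epsilon> / 2"] \<epsilon> by auto
      obtain N2 where N2: "\<forall>i\<ge>N2. \<forall>j\<ge>N2. sq a (v i - v j) < \<epsilon> / 2" using aC[of "\<epsilon> / 2"] \<epsilon> by auto
      have "sq ip (v i - v j) < \<epsilon>" if "i \<ge> max N1 N2" "j \<ge> max N1 N2" for i j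
      proof -
        have "sq m (v i - v j) < \<epsilon> / 2" "sq a (v i - v j) < \<epsilon> / 2"
          using that N1 N2 by auto
        then show ?thesis unfolding ip_eq[OF ip.mem_diff[OF vS vS] ip.mem_diff[OF vS vS]] by linarith
      qed
      then show ?thesis by blast
    qed
    from L2_complete[of \<Omega> v, OF lmeasurable_domain vS this]
    obtain u where u: "u \<in> S" and lim: "(\<lambda>n. ip (v n - u) (v n - u)) \<longlonglongrightarrow> 0" by blast
    have dS: "v n - u \<in> S" for n by (intro ip.mem_diff vS u)
    obtain \<phi> where \<phi>: "\<And>n. \<phi> n \<in> T"
      and close: "\<And>n. sq ip (jet (\<phi> n) - v n) < 1 / real (Suc n)"
      using approx_seq[of v, OF v] by blast
    have "(\<lambda>n. sq ip (jet (\<phi> n) - u)) \<longlonglongrightarrow> 0"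
    proof (rule Lim_null_comparison)
      show "\<forall>\<^sub>F n in sequentially. norm (sq ip (jet (\<phi> n) - u))
          \<le> 2 * (1 / real (Suc n)) + 2 * ip (v n - u) (v n - u)"
      proof (intro always_eventually allI)
        fix n
        have jS: "jet (\<phi> n) - v n \<in> S" by (intro ip.mem_diff jet_L2 \<phi> vS)
        have e: "jet (\<phi> n) - u = (jet (\<phi> n) - v n) + (v n - u)" by simp
        have "sq ip (jet (\<phi> n) - u) \<le>
            2 * sq ip (jet (\<phi> n) - v n) + 2 * ip (v n - u) (v n - u)"
          unfolding e by (rule ip.sq_add_le[OF jS dS])
        moreover have "0 \<le> sq ip (jet (\<phi> n) - u)"
          by (intro ip.nonneg ip.mem_diff jet_L2 \<phi> u)
        ultimately show "norm (sq ip (jet (\<phi> n) - u))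
          \<le> 2 * (1 / real (Suc n)) + 2 * ip (v n - u) (v n - u)" using close[of n] by simp
      qed
      show "(\<lambda>n. 2 * (1 / real (Suc n)) + 2 * ip (v n - u) (v n - u)) \<longlonglongrightarrow> 0"
        using tendsto_add[OF tendsto_mult_left[OF LIMSEQ_Suc[OF lim_1_over_n], of 2] tendsto_mult_left[OF lim, of 2]]
        by simp
    qed
    then have "u \<in> V" using \<phi> u by (auto simp: H10_pairs_def)
    moreover have "(\<lambda>n. m (v n - u) (v n - u)) \<longlonglongrightarrow> 0"
      by (rule Lim_null_comparison[OF _ lim]) (use dS m.nonneg mass_le_ip in auto)
    moreover have "(\<lambda>n. a (v n - u) (v n - u)) \<longlonglongrightarrow> 0"
      by (rule Lim_null_comparison[OF _ lim]) (use dS a.nonneg energy_le_ip in auto)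
    ultimately show "\<exists>u\<in>V. (\<lambda>n. m (v n - u) (v n - u)) \<longlonglongrightarrow> 0 \<and> (\<lambda>n. a (v n - u) (v n - u)) \<longlonglongrightarrow> 0"
      by blast
  qed
qed

sublocale form: compact_form V m a by (rule compact_form_V)

text \<open>The Dirichlet Laplacian is defined with test functions only, whereas the abstract notion
  tests against all of \<open>V\<close>; density of the jets in \<open>V\<close> closes the
  gap.\<close>

lemma eigenspace_eq: "eigenspace \<Omega> \<mu> = {fst \<circ> U | U. form.eigen \<mu> U}"
proof (intro set_eqI iffI)
  fix u assume "u \<in> eigenspace \<Omega> \<mu>"
  then obtain g where g: "H10 \<Omega> u g"
    and weak: "\<And>\<phi>. \<phi> \<in> T \<Longrightarrow>
      (\<integral>x. g x \<bullet> grad \<phi> x \<partial>lebesgue_on \<Omega>) = (\<integral>x. (\<mu> * u x) * \<phi> x \<partial>lebesgue_on \<Omega>)"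
    by (auto simp: eigenspace_def dirichlet_laplacian_def)
  define U where "U = (\<lambda>x. (u x, g x))"
  have UV: "U \<in> V" using g by (simp add: H10_iff U_def)
  have US: "U \<in> S" using UV V_subset by auto
  have jet: "a U (jet \<phi>) = \<mu> * m U (jet \<phi>)" if "\<phi> \<in> T" for \<phi>
    using weak[OF that] by (simp add: energy_eq mass_eq jet_def U_def mult.assoc)
  have "a U W = \<mu> * m U W" if W: "W \<in> V" for W
  proof -
    obtain \<psi> where \<psi>: "\<And>n. \<psi> n \<in> T" "(\<lambda>n::nat. sq ip (jet (\<psi> n) - W)) \<longlonglongrightarrow> 0"
      using H10_pairsE[OF W] by blast
    have WS: "W \<in> S" using W V_subset by auto
    have z: "(\<lambda>n::nat. a (U - U) (U - U)) \<longlonglongrightarrow> 0" "(\<lambda>n::nat. m (U - U) (U - U)) \<longlonglongrightarrow> 0"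
      by (simp_all add: a.zero_left m.zero_left m.mem_zero)
    have "(\<lambda>n. a U (jet (\<psi> n))) \<longlonglongrightarrow> a U W"
      by (intro a.tendsto_form US WS jet_L2 \<psi>(1) z tendsto_mass_energy_jet[OF \<psi> WS])
    moreover have "(\<lambda>n. m U (jet (\<psi> n))) \<longlonglongrightarrow> m U W"
      by (intro m.tendsto_form US WS jet_L2 \<psi>(1) z tendsto_mass_energy_jet[OF \<psi> WS])
    then have "(\<lambda>n. a U (jet (\<psi> n))) \<longlonglongrightarrow> \<mu> * m U W"
      unfolding jet[OF \<psi>(1)] by (rule tendsto_mult_left)
    ultimately show ?thesis using LIMSEQ_unique by blast
  qed
  then have "form.eigen \<mu> U" using UV by (simp add: form.eigen_def)
  moreover have "u = fst \<circ> U" by (simp add: U_def fun_eq_iff)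
  ultimately show "u \<in> {fst \<circ> U | U. form.eigen \<mu> U}" by blast
next
  fix u assume "u \<in> {fst \<circ> U | U. form.eigen \<mu> U}"
  then obtain U where u: "u = fst \<circ> U" and U: "form.eigen \<mu> U" by blast
  have UV: "U \<in> V" using U by (simp add: form.eigen_def)
  then have US: "U \<in> S" using V_subset by auto
  have "H10 \<Omega> u (snd \<circ> U)" using UV by (simp add: H10_iff u)
  moreover have "(\<lambda>x. \<mu> * u x) \<in> L2 \<Omega>"
    using L2_scaleR[OF L2_fst[OF US], of \<mu>] by (simp add: u scaleR_fun_def)
  moreover have "(\<integral>x. (snd \<circ> U) x \<bullet> grad \<phi> x \<partial>lebesgue_on \<Omega>) = (\<integral>x. (\<mu> * u x) * \<phi> x \<partial>lebesgue_on \<Omega>)"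
    if "\<phi> \<in> T" for \<phi>
  proof -
    have "a U (jet \<phi>) = \<mu> * m U (jet \<phi>)" using U jet_in_V[OF that] by (simp add: form.eigen_def)
    then show ?thesis by (simp add: energy_eq mass_eq jet_def u mult.assoc)
  qed
  ultimately show "u \<in> eigenspace \<Omega> \<mu>"
    by (auto simp: eigenspace_def dirichlet_laplacian_def)
qed

end

section \<open>The eigenvalues of the Dirichlet Laplacian\<close>

context bounded_domain
begin

text \<open>Translates between null vectors of the mass and the almost everywhere identities in
  \<open>has_dim_AE\<close>.\<close>

lemma mass_eq_0_iff:
  assumes "U \<in> S"
  shows "m U U = 0 \<longleftrightarrow> (AE x in lebesgue_on \<Omega>. fst (U x) = 0)"
  unfolding mass_eq using mass_integrable[OF assms assms]
  by (subst integral_nonneg_eq_0_iff_AE) auto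

lemma subspace_eigen: "subspace {U. form.eigen \<mu> U}"
  using form.m.subspace
  by (auto simp: subspace_def form.eigen_def form.m.add_left form.a.add_left form.m.scale_left
      form.a.scale_left form.m.zero_left form.a.zero_left algebra_simps)

text \<open>Independence almost everywhere is what Gram-Schmidt asks for in the seminorm. The last
  clause expresses that the basis spans: an eigenvector orthogonal to it is null.\<close>

lemma ex_eigenspace_basis:
  assumes dim: "has_dim_AE (lebesgue_on \<Omega>) (eigenspace \<Omega> \<mu>) n"
  shows "\<exists>F. form.m.orthonormal F {..<n} \<and> (\<forall>i<n. form.eigen \<mu> (F i)) \<and>
    (\<forall>u. form.eigen \<mu> u \<longrightarrow> (\<forall>i<n. m u (F i) = 0) \<longrightarrow> m u u = 0)"
proof -
  obtain f where f: "\<And>i. i < n \<Longrightarrow> f i \<in> eigenspace \<Omega> \<mu>"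
    and ind: "\<And>c. (AE x in lebesgue_on \<Omega>. (\<Sum>i<n. c i * f i x) = 0) \<Longrightarrow> (\<forall>i<n. c i = 0)"
    and gen: "\<And>u. u \<in> eigenspace \<Omega> \<mu> \<Longrightarrow> \<exists>c. AE x in lebesgue_on \<Omega>. u x = (\<Sum>i<n. c i * f i x)"
    using dim unfolding has_dim_AE_def by blast
  have "\<exists>U. i < n \<longrightarrow> form.eigen \<mu> U \<and> f i = fst \<circ> U" for i
    using f[of i] unfolding eigenspace_eq by blast
  then obtain U where U: "\<And>i. i < n \<Longrightarrow> form.eigen \<mu> (U i)" "\<And>i. i < n \<Longrightarrow> f i = fst \<circ> U i"
    by metis
  have UV: "U i \<in> V" if "i < n" for i using U(1)[OF that] by (simp add: form.eigen_def)
  have fst_sum: "fst ((\<Sum>i\<in>I. c i *\<^sub>R U i) x) = (\<Sum>i\<in>I. c i * fst (U i x))" for c I x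
    by (simp add: sum_fun_apply fst_sum)
  have "\<exists>F. form.m.orthonormal F {..<n} \<and> span (F ` {..<n}) = span (U ` {..<n})"
  proof (rule form.m.ex_orthonormal_basis[OF UV])
    fix i s assume i: "i < n" and s: "s \<in> span (U ` {..<i})"
    obtain c where c: "s = (\<Sum>j<i. c j *\<^sub>R U j)" using span_image_lessThan[OF s] by blast
    have sV: "s \<in> V" unfolding c using i by (intro form.m.mem_sum form.m.mem_scale UV) auto
    have dS: "U i - s \<in> S" using form.m.mem_diff[OF UV[OF i] sV] V_subset by auto
    show "m (U i - s) (U i - s) \<noteq> 0"
    proof
      assume "m (U i - s) (U i - s) = 0"
      then have AE: "AE x in lebesgue_on \<Omega>. fst ((U i - s) x) = 0" by (simp add: mass_eq_0_iff[OF dS])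
      \<comment> \<open>The coefficients of \<open>U i - s\<close>, padded with zeros beyond
        \<open>i\<close>. The coefficient at \<open>i\<close> is 1, which contradicts
        independence.\<close>
      define c' where "c' j = (if j < i then - c j else if j = i then 1 else 0)" for j
      have "(\<Sum>j<n. c' j * f j x) = fst ((U i - s) x)" for x
      proof -
        have "(\<Sum>j<n. c' j * f j x) = (\<Sum>j<Suc i. c' j * f j x)"
          using i by (intro sum.mono_neutral_right) (auto simp: c'_def)
        also have "\<dots> = fst (U i x) - (\<Sum>j<i. c j * fst (U j x))"
          using i by (simp add: c'_def U(2) sum_negf)
        also have "\<dots> = fst ((U i - s) x)" unfolding c by (simp add: fst_sum)
        finally show ?thesis .
      qed
      then have "AE x in lebesgue_on \<Omega>. (\<Sum>j<n. c' j * f j x) = 0" using AE by simp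
      from ind[OF this] i have "c' i = 0" by blast
      then show False by (simp add: c'_def)
    qed
  qed
  then obtain F where F: "form.m.orthonormal F {..<n}" and sp: "span (F ` {..<n}) = span (U ` {..<n})"
    by blast
  have "span (U ` {..<n}) \<subseteq> {U. form.eigen \<mu> U}"
    by (rule span_minimal[OF _ subspace_eigen]) (use U(1) in auto)
  then have Feig: "form.eigen \<mu> (F i)" if "i < n" for i
    using that sp span_superset[of "F ` {..<n}"] by (auto simp: subset_iff)
  have FV: "F i \<in> V" if "i < n" for i using Feig[OF that] by (simp add: form.eigen_def)
  have "m u u = 0" if u: "form.eigen \<mu> u" and orth: "\<forall>i<n. m u (F i) = 0" for u
  proof -
    have uV: "u \<in> V" using u by (simp add: form.eigen_def)
    have "fst \<circ> u \<in> eigenspace \<Omega> \<mu>" using u unfolding eigenspace_eq by blast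
    from gen[OF this] obtain c where c: "AE x in lebesgue_on \<Omega>. (fst \<circ> u) x = (\<Sum>i<n. c i * f i x)"
      by blast
    define s where "s = (\<Sum>i<n. c i *\<^sub>R U i)"
    have "s \<in> span (F ` {..<n})"
      unfolding sp s_def by (intro span_sum span_scale span_base) auto
    then obtain c' where s: "s = (\<Sum>i<n. c' i *\<^sub>R F i)" using span_image_lessThan by blast
    have sV: "s \<in> V" unfolding s by (intro form.m.mem_sum form.m.mem_scale FV) auto
    have dS: "u - s \<in> S" using form.m.mem_diff[OF uV sV] V_subset by auto
    have "AE x in lebesgue_on \<Omega>. fst ((u - s) x) = 0"
      using c by eventually_elim (simp add: s_def fst_sum U(2))
    then have "m (u - s) (u - s) = 0" by (simp add: mass_eq_0_iff[OF dS])
    moreover have "m u s = 0"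
    proof -
      have "m u s = (\<Sum>i<n. m u (c' i *\<^sub>R F i))"
        unfolding s by (rule form.m.sum_right) (auto intro: form.m.mem_scale FV uV)
      also have "\<dots> = 0"
        by (intro sum.neutral ballI) (use FV uV orth in \<open>auto simp: form.m.scale_right\<close>)
      finally show ?thesis .
    qed
    \<comment> \<open>By Pythagoras: \<open>u\<close> is orthogonal to the combination
      \<open>s\<close> while \<open>u - s\<close> is null.\<close>
    ultimately have "m u u + m s s = 0"
      using uV sV form.m.sym[OF sV uV] by (simp add: form.m.diff_left form.m.diff_right form.m.mem_diff)
    then show ?thesis using form.m.nonneg[OF uV] form.m.nonneg[OF sV] by linarith
  qed
  then show ?thesis using F Feig by blast
qed

text \<open>Bases of the single eigenspaces are distributed over the indices by bijections from the
  \<open>k\<close> with \<open>ev k = \<mu>\<close>; between different eigenvalues, symmetry of both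
  forms gives orthogonality. If \<mu> does not occur in the sequence, the last clause says that
  every solution for \<mu> is null.\<close>

lemma ex_eigenbasis:
  assumes ev: "dirichlet_eigenvalues \<Omega> ev"
  shows "\<exists>e. form.m.orthonormal e UNIV \<and> (\<forall>k. form.eigen (ev k) (e k)) \<and>
    (\<forall>\<mu> u. form.eigen \<mu> u \<longrightarrow> (\<forall>k. ev k = \<mu> \<longrightarrow> m u (e k) = 0) \<longrightarrow> m u u = 0)"
proof -
  define n where "n \<mu> = card {k. ev k = \<mu>}" for \<mu>
  have fin: "finite {k. ev k = \<mu>}" for \<mu> using ev by (simp add: dirichlet_eigenvalues_def)
  have "\<exists>F. form.m.orthonormal F {..<n \<mu>} \<and> (\<forall>i<n \<mu>. form.eigen \<mu> (F i)) \<and>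
    (\<forall>u. form.eigen \<mu> u \<longrightarrow> (\<forall>i<n \<mu>. m u (F i) = 0) \<longrightarrow> m u u = 0)" for \<mu>
    using ev unfolding n_def by (intro ex_eigenspace_basis) (simp add: dirichlet_eigenvalues_def)
  then obtain F where F: "\<And>\<mu>. form.m.orthonormal (F \<mu>) {..<n \<mu>}"
    and Feig: "\<And>\<mu> i. i < n \<mu> \<Longrightarrow> form.eigen \<mu> (F \<mu> i)"
    and Fnull: "\<And>\<mu> u. form.eigen \<mu> u \<Longrightarrow> (\<And>i. i < n \<mu> \<Longrightarrow> m u (F \<mu> i) = 0) \<Longrightarrow> m u u = 0"
    by metis
  have "\<exists>h. bij_betw h {k. ev k = \<mu>} {0..<n \<mu>}" for \<mu>
    unfolding n_def using fin by (rule ex_bij_betw_finite_nat)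
  then obtain h where h: "\<And>\<mu>. bij_betw (h \<mu>) {k. ev k = \<mu>} {0..<n \<mu>}" by metis
  define e where "e k = F (ev k) (h (ev k) k)" for k
  have hk: "h (ev k) k < n (ev k)" for k
    using bij_betwE[OF h[of "ev k"]] by auto
  have eig: "form.eigen (ev k) (e k)" for k unfolding e_def by (rule Feig[OF hk])
  have eV: "e k \<in> V" for k using eig by (simp add: form.eigen_def)
  have "m (e i) (e j) = (if i = j then 1 else 0)" for i j
  proof (cases "ev i = ev j")
    case True
    have "h (ev j) i = h (ev j) j \<longleftrightarrow> i = j"
      using bij_betw_imp_inj_on[OF h[of "ev j"]] True by (auto simp: inj_on_def)
    then show ?thesis
      using F[of "ev j"] hk[of i] hk[of j] True by (auto simp: form.m.orthonormal_def e_def)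
  next
    case False
    have "a (e i) (e j) = ev i * m (e i) (e j)" "a (e j) (e i) = ev j * m (e j) (e i)"
      using eig eV by (auto simp: form.eigen_def)
    then have "ev i * m (e i) (e j) = ev j * m (e i) (e j)"
      using form.m.sym[OF eV eV, of i j] form.a.sym[OF eV eV, of i j] by metis
    then show ?thesis using False by auto
  qed
  then have "form.m.orthonormal e UNIV" using eV by (auto simp: form.m.orthonormal_def)
  moreover have "m u u = 0" if u: "form.eigen \<mu> u" and orth: "\<And>k. ev k = \<mu> \<Longrightarrow> m u (e k) = 0" for \<mu> u
  proof (rule Fnull[OF u])
    fix i assume "i < n \<mu>"
    then have "i \<in> h \<mu> ` {k. ev k = \<mu>}" using bij_betw_imp_surj_on[OF h[of \<mu>]] by auto
    then obtain k where "ev k = \<mu>" "i = h \<mu> k" by auto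
    then show "m u (F \<mu> i) = 0" using orth[of k] by (simp add: e_def)
  qed
  ultimately show ?thesis using eig by blast
qed

text \<open>Positivity of the eigenvalues also comes from the commutator identity: it gives
  \<open>1 = - 2 \<langle>\<partial>\<^sub>b e, x\<^sub>b e\<rangle>\<close> for normalized \<open>e\<close>, hence \<open>\<partial>\<^sub>b e \<noteq> 0\<close>.\<close>
lemma dirichlet_eigenvalues_Yang:
  assumes ev: "dirichlet_eigenvalues \<Omega> ev"
  shows "Yang_sequence ev (real DIM('a))"
proof -
  obtain e where on: "form.m.orthonormal e UNIV" and eig: "\<And>k. form.eigen (ev k) (e k)"
    and null: "\<And>\<mu> u. form.eigen \<mu> u \<Longrightarrow> (\<And>k. ev k = \<mu> \<Longrightarrow> m u (e k) = 0) \<Longrightarrow> m u u = 0"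
    using ex_eigenbasis[OF ev] by blast
  have eV: "e k \<in> V" for k using eig by (simp add: form.eigen_def)
  have eS: "e k \<in> S" for k using eV V_subset by auto
  have one: "m (e k) (e k) = 1" for k using on by (simp add: form.m.orthonormal_def)
  have aee: "a (e k) (e k) = ev k" for k using eig[of k] eV[of k] one[of k] by (simp add: form.eigen_def)
  have onK: "form.m.orthonormal e K" for K using on by (auto simp: form.m.orthonormal_def)
  have onK': "m.orthonormal e K" for K
    using on eS by (auto simp: form.m.orthonormal_def m.orthonormal_def)
  show ?thesis
  proof
    show "mono ev" using ev by (simp add: dirichlet_eigenvalues_def)
    show fin: "finite {k. ev k < z}" for z
      by (rule form.finite_eigen_bounded[OF onK eig, of _ z]) auto
    show "0 < real DIM('a)" by simp
    show "0 < ev 0"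
    proof (rule ccontr)
      assume "\<not> 0 < ev 0"
      then have a0: "a (e 0) (e 0) \<le> 0" by (simp add: aee)
      obtain b :: 'a where b: "b \<in> Basis" using nonempty_Basis by blast
      have "sq m (partial b (e 0)) = 0"
        using mass_partial_le[OF eS b, of 0] m.nonneg[OF partial_L2[OF eS], of b 0] a0 by linarith
      then have "m (partial b (e 0)) (coord_mult b (e 0)) = 0"
        by (rule m.null_orthogonal[OF partial_L2[OF eS] coord_mult_L2[OF eS]])
      moreover have "m (partial b (coord_mult b (e 0))) (e 0) = - m (coord_mult b (e 0)) (partial b (e 0))"
        by (rule partial_skew[OF coord_mult_V[OF eV] eV b])
      ultimately show False
        using mass_commutator[OF eS b, of 0] one[of 0]
          m.sym[OF partial_L2[OF eS] coord_mult_L2[OF eS], of b 0 b 0] by simp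
    qed
    fix z
    let ?K = "{k. ev k < z}"
    \<comment> \<open>An eigenvector with eigenvalue below \<open>z\<close> that is orthogonal to
      the \<open>e k\<close> with \<open>k\<close> in \<open>?K\<close> is in particular orthogonal
      to those of its own eigenvalue, hence null.\<close>
    have low: "z * m v v \<le> a v v" if "v \<in> V" "\<And>k. k \<in> ?K \<Longrightarrow> m v (e k) = 0" for v
      by (rule form.min_max_lower_bound[OF onK fin eig]) (use that null in auto)
    have "(\<Sum>k\<in>?K. (z - ev k)\<^sup>2) \<le> 4 * (\<Sum>k\<in>?K. (z - ev k) * sq m (partial b (e k)))"
      if b: "b \<in> Basis" for b
    proof (rule Yang_commutator_inequality[where V = V and S = S and m = m and a = a and X = "coord_mult b" and D = "partial b"])
      show "semi_inner S m" "semi_inner V a" by (rule semi_inner_mass, rule semi_inner_V)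
      show "m.orthonormal e ?K" by (rule onK')
      show "partial b v \<in> S" if "v \<in> V" for v using that V_subset partial_L2 by auto
      show "m (partial b (coord_mult b u)) u = m (partial b u) (coord_mult b u) + m u u" if "u \<in> V" for u
        using that V_subset mass_commutator[OF _ b] by auto
      show "a (coord_mult b u) w = a u (coord_mult b w) - m (partial b u) w + m u (partial b w)"
        if "u \<in> V" "w \<in> V" for u w
        by (rule energy_coord_mult) (use that V_subset in auto)
      show "a (e k) w = ev k * m (e k) w" if "w \<in> V" for k w using eig that by (simp add: form.eigen_def)
    qed (use V_subset fin eV low coord_mult_V partial_skew b mass_coord_mult in auto)
    \<comment> \<open>The left side does not depend on the coordinate, so summation multiplies it by
      the dimension; on the right the partial derivatives combine to \<open>ev k\<close>.\<close>
    then have "(\<Sum>b\<in>(Basis :: 'a set). \<Sum>k\<in>?K. (z - ev k)\<^sup>2)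
        \<le> (\<Sum>b\<in>Basis. 4 * (\<Sum>k\<in>?K. (z - ev k) * sq m (partial b (e k))))"
      by (rule sum_mono)
    also have "\<dots> = 4 * (\<Sum>k\<in>?K. \<Sum>b\<in>Basis. (z - ev k) * sq m (partial b (e k)))"
      by (simp add: sum_distrib_left[symmetric] sum.swap[of _ ?K])
    also have "\<dots> = 4 * (\<Sum>k\<in>?K. (z - ev k) * ev k)"
      by (simp add: sum_distrib_left[symmetric] sum_mass_partial[OF eS] aee)
    finally show "real DIM('a) * (\<Sum>k\<in>?K. (z - ev k)\<^sup>2) \<le> 4 * (\<Sum>k\<in>?K. (z - ev k) * ev k)" by simp
  qed
qed

end

theorem theorem2p1:
  fixes \<Omega> :: "'a::euclidean_space set" and ev :: "nat \<Rightarrow> real"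
    and R :: "real \<Rightarrow> real \<Rightarrow> real" and d :: real
  assumes domain: "open \<Omega>" "connected \<Omega>" "\<Omega> \<noteq> {}" "bounded \<Omega>"
    and ev: "dirichlet_eigenvalues \<Omega> ev"
  defines "R \<equiv> riesz_mean ev" and "d \<equiv> real DIM('a)"
  shows
    "(\<forall>\<sigma>. 0 < \<sigma> \<and> \<sigma> \<le> 2 \<longrightarrow>
        (\<forall>z\<ge>ev 0.
           R (\<sigma> - 1) z \<ge> (1 + d / 4) * (1 / z) * R \<sigma> z \<and>
           (1 < \<sigma> \<longrightarrow> R \<sigma> differentiable (at z)) \<and>
           (R \<sigma> differentiable (at z) \<longrightarrow>
              deriv (R \<sigma>) z \<ge> (1 + d / 4) * (\<sigma> / z) * R \<sigma> z)) \<and>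
        mono_on {ev 0..} (\<lambda>z. R \<sigma> z / z powr (\<sigma> + d * \<sigma> / 4)))
     \<and>
     (\<forall>\<sigma>\<ge>2.
        (\<forall>z\<ge>ev 0.
           R (\<sigma> - 1) z \<ge> (1 + d / (2 * \<sigma>)) * (1 / z) * R \<sigma> z \<and>
           R \<sigma> differentiable (at z) \<and>
           deriv (R \<sigma>) z \<ge> (\<sigma> + d / 2) * (1 / z) * R \<sigma> z) \<and>
        mono_on {ev 0..} (\<lambda>z. R \<sigma> z / z powr (\<sigma> + d / 2)))"
proof -
  interpret bounded_domain \<Omega> by unfold_locales (use domain in auto)
  interpret Yang_sequence ev d unfolding d_def by (rule dirichlet_eigenvalues_Yang[OF ev])
  show ?thesis unfolding R_def by (rule riesz_mean_inequalities)
qed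

end
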